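(* Let $H$ be a complex Hilbert space (possibly infinite-dimensional), and let ${\mathcal C}$ be a conjugacy class of rank $k$ operators from ${\mathcal F}_{s}(H)$ such that for every operator from ${\mathcal C}$ the dimensions of any two distinct maximal eigenspaces are distinct. Suppose that $\dim H\ge 4k$. Let $f:{\mathcal C}\to{\mathcal C}$ be a bijection preserving commutativity in both directions, i.e. $$AB=BA\;\Longleftrightarrow\; f(A)f(B)=f(B)f(A)$$ for all $A,B\in {\mathcal C}$. Then there is a unitary or anti-unitary operator $U$ on $H$ such that $f(A)=UAU^{*}$ for all $A\in {\mathcal C}$.
   Context: ${\mathcal F}_{s}(H)$ denotes the real vector space of all self-adjoint (bounded) operators of finite rank on $H$. A conjugacy class in ${\mathcal F}_{s}(H)$ is an orbit under the action of unitary operators, i.e. a set of the form $\{UA_0U^{*} : U \text{ unitary on } H\}$ for some $A_0\in{\mathcal F}_s(H)$; all its elements have the same rank. For $A\in{\mathcal F}_s(H)$, a maximal eigenspace of $A$ is the subspace $\{x\in H: A(x)=\alpha x\}$ of all vectors corresponding to a non-zero eigenvalue $\alpha$ of $A$ (the kernel of $A$ is not considered as an eigenspace). An anti-unitary operator is a conjugate-linear bijection $U:H\to H$ with $\langle Ux,Uy\rangle=\overline{\langle x,y\rangle}$ for all $x,y\in H$; for it $U^{*}=U^{-1}$. *)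

theory Defs
  imports "HOL-Analysis.Analysis" "HOL-Library.Extended_Nat"
begin

class complex_vector = real_vector +
  fixes scaleC :: "complex \<Rightarrow> 'a \<Rightarrow> 'a"  (infixr "*\<^sub>C" 75)
  assumes scaleC_add_right: "a *\<^sub>C (x + y) = a *\<^sub>C x + a *\<^sub>C y"
    and scaleC_add_left: "(a + b) *\<^sub>C x = a *\<^sub>C x + b *\<^sub>C x"
    and scaleC_scaleC: "a *\<^sub>C (b *\<^sub>C x) = (a * b) *\<^sub>C x"
    and scaleC_one: "1 *\<^sub>C x = x"
    and scaleR_scaleC: "r *\<^sub>R x = complex_of_real r *\<^sub>C x"

text \<open>The inner product is linear in its first argument.\<close>

class complex_inner = complex_vector + real_normed_vector +
  fixes cinner :: "'a \<Rightarrow> 'a \<Rightarrow> complex"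
  assumes cinner_commute: "cinner x y = cnj (cinner y x)"
    and cinner_add_left: "cinner (x + y) z = cinner x z + cinner y z"
    and cinner_scaleC_left: "cinner (a *\<^sub>C x) y = a * cinner x y"
    and norm_cinner: "cinner x x = complex_of_real ((norm x)\<^sup>2)"

class chilbert_space = complex_inner + complete_space

instantiation complex :: chilbert_space
begin

definition scaleC_complex :: "complex \<Rightarrow> complex \<Rightarrow> complex" where
  "scaleC_complex a x = a * x"

definition cinner_complex :: "complex \<Rightarrow> complex \<Rightarrow> complex" where
  "cinner_complex x y = x * cnj y"

instance
proof
  fix a b x y z :: complex and r :: real
  show "a *\<^sub>C (x + y) = a *\<^sub>C x + a *\<^sub>C y"
    and "(a + b) *\<^sub>C x = a *\<^sub>C x + b *\<^sub>C x"
    and "a *\<^sub>C (b *\<^sub>C x) = (a * b) *\<^sub>C x"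
    and "1 *\<^sub>C x = x"
    and "r *\<^sub>R x = complex_of_real r *\<^sub>C x"
    by (simp_all add: scaleC_complex_def ring_distribs scaleR_conv_of_real)
  show "cinner x y = cnj (cinner y x)"
    and "cinner (x + y) z = cinner x z + cinner y z"
    and "cinner (a *\<^sub>C x) y = a * cinner x y"
    by (simp_all add: cinner_complex_def scaleC_complex_def ring_distribs)
  show "cinner x x = complex_of_real ((norm x)\<^sup>2)"
    unfolding cinner_complex_def by (rule complex_norm_square[symmetric])
qed

end

global_interpretation complex_vector: vector_space "scaleC :: complex \<Rightarrow> 'a \<Rightarrow> 'a::complex_vector"
  defines cspan = complex_vector.span
    and cdim = complex_vector.dim
  by standard (simp_all add: scaleC_add_right scaleC_add_left scaleC_scaleC scaleC_one)

abbreviation clinear :: "('a::complex_vector \<Rightarrow> 'b::complex_vector) \<Rightarrow> bool" where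
  "clinear \<equiv> Vector_Spaces.linear scaleC scaleC"

text \<open>Since \<^const>\<open>cdim\<close> is a natural number and carries no information on
  infinite-dimensional subspaces, the dimension is taken as an extended natural number.\<close>

definition ecdim :: "'a::complex_vector set \<Rightarrow> enat" where
  "ecdim S = (if \<exists>B. finite B \<and> S \<subseteq> cspan B then enat (cdim S) else \<infinity>)"

definition bounded_clinear :: "('a::complex_inner \<Rightarrow> 'b::complex_inner) \<Rightarrow> bool" where
  "bounded_clinear A \<longleftrightarrow> clinear A \<and> (\<exists>K. \<forall>x. norm (A x) \<le> norm x * K)"

definition is_cadjoint :: "('a::complex_inner \<Rightarrow> 'a) \<Rightarrow> ('a \<Rightarrow> 'a) \<Rightarrow> bool" where
  "is_cadjoint A B \<longleftrightarrow> (\<forall>x y. cinner (A x) y = cinner x (B y))"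

definition cadjoint :: "('a::complex_inner \<Rightarrow> 'a) \<Rightarrow> ('a \<Rightarrow> 'a)" where
  "cadjoint A = (THE B. is_cadjoint A B)"

definition unitary :: "('a::complex_inner \<Rightarrow> 'a) \<Rightarrow> bool" where
  "unitary U \<longleftrightarrow> clinear U \<and> bij U \<and> (\<forall>x y. cinner (U x) (U y) = cinner x y)"

definition antilinear :: "('a::complex_vector \<Rightarrow> 'b::complex_vector) \<Rightarrow> bool" where
  "antilinear U \<longleftrightarrow> (\<forall>x y. U (x + y) = U x + U y) \<and> (\<forall>a x. U (a *\<^sub>C x) = cnj a *\<^sub>C U x)"

definition antiunitary :: "('a::complex_inner \<Rightarrow> 'a) \<Rightarrow> bool" where
  "antiunitary U \<longleftrightarrow> antilinear U \<and> bij U \<and> (\<forall>x y. cinner (U x) (U y) = cnj (cinner x y))"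

lemma cinner_ext:
  fixes x y :: "'a::complex_inner"
  assumes "\<And>z. cinner z x = cinner z y"
  shows "x = y"
proof -
  have "cinner (x - y) x = cinner (x - y) y" by (rule assms)
  hence "cinner x (x - y) = cinner y (x - y)"
    by (simp add: cinner_commute[of x "x - y"] cinner_commute[of y "x - y"])
  moreover have "cinner x (x - y) = cinner (x - y) (x - y) + cinner y (x - y)"
    using cinner_add_left[of "x - y" y "x - y"] by simp
  ultimately have "cinner (x - y) (x - y) = 0" by simp
  hence "norm (x - y) = 0" by (simp add: norm_cinner)
  thus ?thesis by simp
qed

lemma cadjoint_eqI:
  assumes "is_cadjoint A B"
  shows "cadjoint A = B"
  unfolding cadjoint_def
proof (rule the_equality)
  show "is_cadjoint A B" by (rule assms)
next
  fix B' assume "is_cadjoint A B'"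
  with assms have "cinner z (B' y) = cinner z (B y)" for z y
    unfolding is_cadjoint_def by simp
  hence "B' y = B y" for y by (rule cinner_ext)
  thus "B' = B" by (rule ext)
qed

lemma cadjoint_unitary:
  assumes "unitary U"
  shows "cadjoint U = inv U"
proof (rule cadjoint_eqI, unfold is_cadjoint_def, intro allI)
  fix x y
  from assms have "U (inv U y) = y" by (simp add: unitary_def bij_is_surj surj_f_inv_f)
  moreover from assms have "cinner (U x) (U (inv U y)) = cinner x (inv U y)"
    by (simp only: unitary_def)
  ultimately show "cinner (U x) y = cinner x (inv U y)" by simp
qed

definition rank_op :: "('a::complex_vector \<Rightarrow> 'a) \<Rightarrow> enat" where
  "rank_op A = ecdim (range A)"

definition self_adjoint_finite_rank :: "('a::complex_inner \<Rightarrow> 'a) set" where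
  "self_adjoint_finite_rank =
     {A. bounded_clinear A \<and> is_cadjoint A A \<and> rank_op A \<noteq> \<infinity>}"

definition conjugacy_class :: "('a::complex_inner \<Rightarrow> 'a) set \<Rightarrow> bool" where
  "conjugacy_class C \<longleftrightarrow>
     (\<exists>A0 \<in> self_adjoint_finite_rank. C = {U \<circ> A0 \<circ> cadjoint U |U. unitary U})"

definition eigenvalue :: "('a::complex_vector \<Rightarrow> 'a) \<Rightarrow> complex \<Rightarrow> bool" where
  "eigenvalue A \<alpha> \<longleftrightarrow> (\<exists>x. x \<noteq> 0 \<and> A x = \<alpha> *\<^sub>C x)"

definition maximal_eigenspace :: "('a::complex_vector \<Rightarrow> 'a) \<Rightarrow> 'a set \<Rightarrow> bool" where
  "maximal_eigenspace A M \<longleftrightarrow>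
     (\<exists>\<alpha>. \<alpha> \<noteq> 0 \<and> eigenvalue A \<alpha> \<and> M = {x. A x = \<alpha> *\<^sub>C x})"

end

theory Submission
  imports Defs "HOL-Computational_Algebra.Fundamental_Theorem_Algebra"
begin

text \<open>An operator of the class is determined by its eigenvalues and an orthonormal sequence of \<open>k\<close>
  eigenvectors, taken up to phases. By simultaneous diagonalisation the maximal commuting subsets
  are the sets of operators of the class that are diagonal in a maximal orthonormal set \<open>F\<close>
  (a frame), and such operators are colourings of \<open>F\<close>. A subset of the colourings lies in
  more than one maximal commuting subset iff its members agree on some pair of points of \<open>F\<close>; hence
  \<open>f\<close> induces bijections between the pairs of two frames. These preserve triangles and therefore
  come from bijections of the frames, and since the colour classes have distinct sizes
  \<open>f\<close> acts on the colourings by transport along the bijection. The bound on the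
  dimension makes the bijections of different frames agree on common lines: a line is the
  intersection of the ranges of two operators that are otherwise orthogonal, and any two such
  pairs of operators are joined by a chain. The resulting map of lines
  preserves orthogonality in both directions, and Uhlhorn's theorem applies.\<close>

section \<open>Inner products and orthonormal sets\<close>

text \<open>Commutativity sees an operator only through the partition of a frame into colour
  classes, never through the colours. Distinct multiplicities remedy this: the zero class has more
  than \<open>k\<close> points, a nonzero class at most \<open>k\<close>, and the size of a nonzero
  class tells its eigenvalue. They also force a repeated eigenvalue as soon as
  \<open>k \<ge> 2\<close>, and this is what tells triangles from other triples of pairs. For
  \<open>k = 1\<close> it is missing and the bijection of frames is found directly, since there the
  operators are already lines. The constant 4 comes from the chains: three sequences through one
  line occupy at most \<open>3 * k\<close> vectors, and a neighbour common to all three needs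
  \<open>k\<close> more. In infinite dimension a frame need not span, so vectors are compared by
  testing against the frame, and sums run over finite subsets only.\<close>

lemma cinner_add_right: "cinner x (y + z) = cinner x y + cinner x (z::'a::complex_inner)"
  using cinner_commute[of x] by (simp add: cinner_add_left)

lemma cinner_scaleC_right: "cinner x (a *\<^sub>C y) = cnj a * cinner x (y::'a::complex_inner)"
  using cinner_commute[of x] by (simp add: cinner_scaleC_left)

lemma cinner_zero_left [simp]: "cinner 0 (x::'a::complex_inner) = 0"
  using cinner_add_left[of 0 0 x] by simp

lemma cinner_zero_right [simp]: "cinner (x::'a::complex_inner) 0 = 0"
  using cinner_add_right[of x 0 0] by simp

lemma cinner_minus_left [simp]: "cinner (- x) y = - cinner x (y::'a::complex_inner)"
  using cinner_add_left[of x "- x" y] by (simp add: eq_neg_iff_add_eq_0 add.commute)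

lemma cinner_minus_right [simp]: "cinner x (- y) = - cinner x (y::'a::complex_inner)"
  using cinner_add_right[of x y "- y"] by (simp add: eq_neg_iff_add_eq_0 add.commute)

lemma cinner_diff_left: "cinner (x - y) z = cinner x z - cinner y (z::'a::complex_inner)"
  using cinner_add_left[of x "- y" z] by simp

lemma cinner_diff_right: "cinner x (y - z) = cinner x y - cinner x (z::'a::complex_inner)"
  using cinner_add_right[of x y "- z"] by simp

lemma cinner_sum_left: "cinner (\<Sum>i\<in>I. g i) (z::'a::complex_inner) = (\<Sum>i\<in>I. cinner (g i) z)"
  by (induction I rule: infinite_finite_induct) (simp_all add: cinner_add_left)

lemma cinner_sum_right: "cinner (z::'a::complex_inner) (\<Sum>i\<in>I. g i) = (\<Sum>i\<in>I. cinner z (g i))"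
  by (induction I rule: infinite_finite_induct) (simp_all add: cinner_add_right)

lemmas cinner_simps = cinner_add_left cinner_add_right cinner_diff_left cinner_diff_right
  cinner_scaleC_left cinner_scaleC_right

lemma cinner_self_eq_0 [simp]: "cinner x x = 0 \<longleftrightarrow> x = (0::'a::complex_inner)"
  by (simp add: norm_cinner)

lemma cinner_eq_0_commute: "cinner x y = 0 \<longleftrightarrow> cinner y (x::'a::complex_inner) = 0"
  using cinner_commute[of x y] by simp

lemma cinner_self_eq_1: "cinner x x = 1 \<longleftrightarrow> norm (x::'a::complex_inner) = 1"
proof -
  have "(norm x)\<^sup>2 = 1 \<longleftrightarrow> norm x = 1" using norm_ge_zero[of x] unfolding power2_eq_1_iff by linarith
  thus ?thesis by (simp only: norm_cinner of_real_eq_1_iff)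
qed

text \<open>Since \<open>inverse 0 = 0\<close>, the zero vector is its own normalisation; so the
  rules on orthogonality and \<open>unit_vec_scale\<close> hold without a side condition.\<close>

definition unit_vec :: "'a::complex_inner \<Rightarrow> 'a" where
  "unit_vec x = complex_of_real (inverse (norm x)) *\<^sub>C x"

lemma norm_scaleC: "norm (c *\<^sub>C (x::'a::complex_inner)) = cmod c * norm x"
proof -
  have "complex_of_real ((norm (c *\<^sub>C x))\<^sup>2) = (c * cnj c) * complex_of_real ((norm x)\<^sup>2)"
    unfolding norm_cinner[symmetric] by (simp add: cinner_scaleC_left cinner_scaleC_right)
  also have "\<dots> = complex_of_real ((cmod c * norm x)\<^sup>2)"
    by (simp only: complex_norm_square[symmetric] power_mult_distrib of_real_mult)
  finally have "complex_of_real ((norm (c *\<^sub>C x))\<^sup>2) = complex_of_real ((cmod c * norm x)\<^sup>2)" .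
  hence "(norm (c *\<^sub>C x))\<^sup>2 = (cmod c * norm x)\<^sup>2" by (simp only: of_real_eq_iff)
  thus ?thesis by (simp add: power2_eq_iff_nonneg)
qed

lemma unit_vec_norm [simp]: "x \<noteq> 0 \<Longrightarrow> norm (unit_vec x) = 1"
  by (simp add: unit_vec_def norm_scaleC norm_inverse)

lemma unit_vec_eq_0 [simp]: "unit_vec x = 0 \<longleftrightarrow> x = 0"
  by (auto simp: unit_vec_def)

lemma unit_vec_perp_left [simp]: "cinner (unit_vec x) y = 0 \<longleftrightarrow> cinner x y = 0"
  by (auto simp: unit_vec_def cinner_simps)

lemma unit_vec_perp_right [simp]: "cinner y (unit_vec x) = 0 \<longleftrightarrow> cinner y x = 0"
  by (auto simp: unit_vec_def cinner_simps)

lemma unit_vec_unit [simp]: "norm x = 1 \<Longrightarrow> unit_vec x = x"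
  by (simp add: unit_vec_def)

lemma unit_vec_scale: "x = complex_of_real (norm x) *\<^sub>C unit_vec x"
  by (cases "x = 0") (simp_all add: unit_vec_def)

section \<open>Orthonormal sets, orthogonal projections and dimension\<close>

definition orthonormal :: "'a::complex_inner set \<Rightarrow> bool" where
  "orthonormal S \<longleftrightarrow> (\<forall>x\<in>S. \<forall>y\<in>S. cinner x y = (if x = y then 1 else 0))"

lemma orthonormalD: "orthonormal S \<Longrightarrow> x \<in> S \<Longrightarrow> y \<in> S \<Longrightarrow> cinner x y = (if x = y then 1 else 0)"
  by (simp add: orthonormal_def)

lemma orthonormal_norm: "orthonormal S \<Longrightarrow> x \<in> S \<Longrightarrow> norm x = 1"
  using orthonormalD[of S x x] by (simp add: cinner_self_eq_1)

lemma orthonormal_subset: "orthonormal S \<Longrightarrow> T \<subseteq> S \<Longrightarrow> orthonormal T"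
  unfolding orthonormal_def by blast

lemma orthonormal_empty [simp]: "orthonormal {}"
  by (simp add: orthonormal_def)

lemma orthonormal_insert:
  assumes "orthonormal S" "norm x = 1" "\<And>s. s \<in> S \<Longrightarrow> cinner x s = 0"
  shows "orthonormal (insert x S)"
proof -
  have "cinner s x = 0" if "s \<in> S" for s using assms(3)[OF that] by (simp add: cinner_eq_0_commute)
  moreover have "x \<notin> S" using assms(2,3) by (metis cinner_self_eq_0 norm_zero zero_neq_one)
  ultimately show ?thesis
    using assms by (auto simp: orthonormal_def cinner_self_eq_1)
qed

definition proj :: "'a::complex_inner set \<Rightarrow> 'a \<Rightarrow> 'a" where
  "proj S x = (\<Sum>s\<in>S. cinner x s *\<^sub>C s)"

lemma cinner_proj:
  assumes "finite S" "orthonormal S" "s \<in> S"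
  shows "cinner (proj S x) s = cinner x s"
proof -
  have "cinner (proj S x) s = (\<Sum>t\<in>S. cinner x t * (if t = s then 1 else 0))"
    unfolding proj_def cinner_sum_left cinner_scaleC_left
    by (rule sum.cong) (use assms in \<open>auto simp: orthonormalD\<close>)
  also have "\<dots> = (\<Sum>t\<in>S. if t = s then cinner x t else 0)"
    by (rule sum.cong) auto
  finally show ?thesis using assms by simp
qed

lemma proj_in_span: "proj S x \<in> cspan S"
  unfolding proj_def
  by (intro complex_vector.span_sum complex_vector.span_scale complex_vector.span_base)

lemma perp_span:
  assumes "y \<in> cspan S" "\<And>s. s \<in> S \<Longrightarrow> cinner x s = 0"
  shows "cinner (x::'a::complex_inner) y = 0"
proof -
  have "complex_vector.subspace {y. cinner x y = 0}"
    by (simp add: complex_vector.subspace_def cinner_add_right cinner_scaleC_right)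
  hence "cspan S \<subseteq> {y. cinner x y = 0}"
    by (intro complex_vector.span_minimal) (auto simp: assms(2))
  thus ?thesis using assms(1) by blast
qed

lemma perp_span_left:
  assumes "y \<in> cspan S" "\<And>s. s \<in> S \<Longrightarrow> cinner s x = 0"
  shows "cinner y (x::'a::complex_inner) = 0"
proof -
  have "cinner x s = 0" if "s \<in> S" for s
    using assms(2)[OF that] by (rule iffD1[OF cinner_eq_0_commute])
  from perp_span[OF assms(1) this] show ?thesis by (rule iffD1[OF cinner_eq_0_commute])
qed

lemma proj_eq:
  assumes "finite S" "orthonormal S" "x \<in> cspan S"
  shows "proj S x = x"
proof -
  have "cinner (x - proj S x) s = 0" if "s \<in> S" for s
    using cinner_proj[OF assms(1,2) that] by (simp add: cinner_simps)
  moreover have "x - proj S x \<in> cspan S"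
    using assms(3) proj_in_span by (rule complex_vector.span_diff)
  ultimately have "cinner (x - proj S x) (x - proj S x) = 0" by (blast intro: perp_span)
  thus ?thesis by simp
qed

lemma orthonormal_independent:
  assumes "orthonormal S"
  shows "\<not> complex_vector.dependent S"
  unfolding complex_vector.dependent_def
proof clarify
  fix a assume a: "a \<in> S" "a \<in> cspan (S - {a})"
  have "cinner a a = 0"
    by (rule perp_span[OF a(2)]) (use assms a in \<open>auto simp: orthonormalD\<close>)
  thus False using assms a(1) by (simp add: orthonormalD)
qed

text \<open>Each new vector contributes its normalised residual, or nothing if the residual
  vanishes; \<open>B\<close> may be dependent, hence only an inequality of cardinalities.\<close>

lemma gram_schmidt:
  fixes B :: "'a::complex_inner set"
  assumes "finite B"
  shows "\<exists>S. finite S \<and> orthonormal S \<and> card S \<le> card B \<and> cspan S = cspan B"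
  using assms
proof (induction B rule: finite_induct)
  case empty
  show ?case by (intro exI[of _ "{}"]) simp
next
  case (insert b B)
  then obtain S where S: "finite S" "orthonormal S" "card S \<le> card B" "cspan S = cspan B" by blast
  have span_eq: "cspan (insert b B) = cspan (insert b S)"
    by (simp add: complex_vector.span_insert S(4))
  define y where "y = b - proj S b"
  have y: "cinner y s = 0" if "s \<in> S" for s
    unfolding y_def using cinner_proj[OF S(1,2) that] by (simp add: cinner_simps)
  show ?case
  proof (cases "y = 0")
    case True
    hence "b \<in> cspan S" using proj_in_span[of S b] by (simp add: y_def)
    hence "cspan (insert b S) = cspan S" by (rule complex_vector.span_redundant)
    with S insert span_eq show ?thesis by (intro exI[of _ S]) simp
  next
    case False
    have eq: "cspan (insert (unit_vec y) S) = cspan (insert b S)"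
    proof
      have "unit_vec y \<in> cspan (insert b S)"
        unfolding unit_vec_def y_def
        by (intro complex_vector.span_scale complex_vector.span_diff
            complex_vector.span_base insertI1 subsetD[OF complex_vector.span_mono proj_in_span]) auto
      thus "cspan (insert (unit_vec y) S) \<subseteq> cspan (insert b S)"
        by (intro complex_vector.span_minimal) (auto simp: complex_vector.span_base)
      have "b = complex_of_real (norm y) *\<^sub>C unit_vec y + proj S b"
        unfolding unit_vec_scale[symmetric] by (simp add: y_def)
      moreover have "complex_of_real (norm y) *\<^sub>C unit_vec y + proj S b \<in> cspan (insert (unit_vec y) S)"
        by (intro complex_vector.span_add complex_vector.span_scale
            complex_vector.span_base insertI1 subsetD[OF complex_vector.span_mono proj_in_span]) auto
      ultimately have "b \<in> cspan (insert (unit_vec y) S)" by simp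
      thus "cspan (insert b S) \<subseteq> cspan (insert (unit_vec y) S)"
        by (intro complex_vector.span_minimal) (auto simp: complex_vector.span_base)
    qed
    have "orthonormal (insert (unit_vec y) S)"
      using S(2) False y by (intro orthonormal_insert) auto
    moreover have "card (insert (unit_vec y) S) \<le> card (insert b B)"
      using S(1,3) insert(1,2) by (simp add: card_insert_if)
    ultimately show ?thesis using S(1) eq span_eq by (intro exI[of _ "insert (unit_vec y) S"]) simp
  qed
qed

text \<open>Otherwise every residual \<open>x - proj T x\<close> vanishes and fewer than
  \<open>n\<close> vectors span the space. This turns a bound on \<open>ecdim\<close> into vectors,
  in finite and infinite dimension alike.\<close>

lemma exists_perp:
  fixes S :: "'a::complex_inner set"
  assumes "finite S" "enat n \<le> ecdim (UNIV :: 'a set)" "card S < n"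
  shows "\<exists>x::'a. x \<noteq> 0 \<and> (\<forall>s\<in>S. cinner x s = 0)"
proof (rule ccontr)
  assume no: "\<not> ?thesis"
  obtain T where T: "finite T" "orthonormal T" "card T \<le> card S" "cspan T = cspan S"
    using gram_schmidt[OF assms(1)] by blast
  have "x \<in> cspan T" for x
  proof -
    have "cinner (x - proj T x) s = 0" if "s \<in> S" for s
    proof (rule perp_span)
      show "s \<in> cspan T" using T(4) that complex_vector.span_base by blast
      show "cinner (x - proj T x) t = 0" if "t \<in> T" for t
        using cinner_proj[OF T(1,2) that] by (simp add: cinner_simps)
    qed
    hence "x = proj T x" using no by (metis eq_iff_diff_eq_0)
    thus ?thesis using proj_in_span[of T x] by simp
  qed
  hence sub: "UNIV \<subseteq> cspan T" by blast
  hence "ecdim (UNIV::'a set) = enat (cdim (UNIV::'a set))" using T(1) by (auto simp: ecdim_def)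
  moreover have "cdim (UNIV::'a set) \<le> card T"
    using complex_vector.dim_le_card[OF sub T(1)] .
  ultimately show False using assms T(3) by simp
qed

lemma clinear_iff:
  "clinear A \<longleftrightarrow> (\<forall>x y. A (x + y) = A x + A y) \<and> (\<forall>c x. A (c *\<^sub>C x) = c *\<^sub>C A x)"
  by (simp add: Vector_Spaces.linear_iff complex_vector.vector_space_axioms)

lemma clinear_add: "clinear A \<Longrightarrow> A (x + y) = A x + A y"
  and clinear_scaleC: "clinear A \<Longrightarrow> A (c *\<^sub>C x) = c *\<^sub>C A x"
  by (simp_all add: clinear_iff)

lemma clinear_0: "clinear A \<Longrightarrow> A 0 = 0"
  using clinear_scaleC[of A 0 0] by simp

lemma subspace_range: "clinear A \<Longrightarrow> complex_vector.subspace (range A)"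
  unfolding complex_vector.subspace_def
  by (auto simp: image_iff clinear_add[symmetric] clinear_scaleC[symmetric]
      intro: exI[of _ 0] clinear_0)

section \<open>Joint eigenvectors\<close>

text \<open>The vector p(A) v, evaluated by Horner's scheme. With \<open>v\<close> fixed,
  polynomials act without an algebra of operators.\<close>

definition op_poly :: "('a::complex_vector \<Rightarrow> 'a) \<Rightarrow> 'a \<Rightarrow> complex poly \<Rightarrow> 'a" where
  "op_poly A v p = fold_coeffs (\<lambda>c w. c *\<^sub>C v + A w) p 0"

context
  fixes A :: "'a::complex_vector \<Rightarrow> 'a" and v :: 'a
  assumes A: "clinear A"
begin

lemma op_poly_0 [simp]: "op_poly A v 0 = 0"
  by (simp add: op_poly_def)

lemma op_poly_pCons: "op_poly A v (pCons c p) = c *\<^sub>C v + A (op_poly A v p)"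
  using A by (cases "p = 0 \<and> c = 0")
    (auto simp: op_poly_def fold_coeffs_def cCons_def clinear_0)

lemma op_poly_add: "op_poly A v (p + q) = op_poly A v p + op_poly A v q"
  by (induction p q rule: poly_induct2)
    (simp_all add: op_poly_pCons scaleC_add_left clinear_add[OF A])

lemma op_poly_smult: "op_poly A v (smult c p) = c *\<^sub>C op_poly A v p"
  by (induction p) (simp_all add: op_poly_pCons scaleC_add_right scaleC_scaleC
      clinear_scaleC[OF A])

lemma op_poly_sum: "op_poly A v (\<Sum>i\<in>I. p i) = (\<Sum>i\<in>I. op_poly A v (p i))"
  by (induction I rule: infinite_finite_induct) (simp_all add: op_poly_add)

lemma op_poly_monom: "op_poly A v (monom c n) = c *\<^sub>C (A ^^ n) v"
  by (induction n) (simp_all add: monom_0 monom_Suc op_poly_pCons clinear_scaleC[OF A]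
      clinear_0[OF A])

lemma op_poly_linear_factor:
  "op_poly A v ([:- r, 1:] * q) = A (op_poly A v q) - r *\<^sub>C op_poly A v q"
proof -
  have "[:- r, 1:] * q = smult (- r) q + pCons 0 q" by simp
  thus ?thesis by (simp only: op_poly_add op_poly_smult op_poly_pCons) simp
qed

lemma op_poly_closed:
  assumes "complex_vector.subspace V" "v \<in> V" "\<And>x. x \<in> V \<Longrightarrow> A x \<in> V"
  shows "op_poly A v p \<in> V"
proof (induction p)
  case 0
  show ?case using complex_vector.subspace_0[OF assms(1)] by simp
next
  case (pCons c p)
  have "c *\<^sub>C v + A (op_poly A v p) \<in> V"
    by (intro complex_vector.subspace_add[OF assms(1)] complex_vector.subspace_scale[OF assms(1)]
        assms(2,3) pCons.IH)
  thus ?case by (simp only: op_poly_pCons)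
qed

text \<open>The first \<open>card B + 1\<close> iterates of \<open>v\<close> satisfy a linear
  relation, whose coefficients form the polynomial.\<close>

lemma op_poly_annihilated:
  assumes "finite B" "\<And>i. (A ^^ i) v \<in> cspan B"
  shows "\<exists>p. p \<noteq> 0 \<and> op_poly A v p = 0"
\<comment> \<open>Dependence is a notion for sets, so a repetition among the iterates is treated
  apart: there the polynomial is a difference of two monomials.\<close>
proof (cases "inj_on (\<lambda>i. (A ^^ i) v) {..card B}")
  case False
  then obtain i j where ij: "i \<noteq> j" "(A ^^ i) v = (A ^^ j) v" by (auto simp: inj_on_def)
  hence "coeff (monom 1 i + monom (- 1 :: complex) j) i \<noteq> coeff 0 i" by simp
  hence "monom 1 i + monom (- 1 :: complex) j \<noteq> 0" by metis
  moreover have "op_poly A v (monom 1 i + monom (- 1) j) = 0"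
    by (simp add: op_poly_add op_poly_monom ij)
  ultimately show ?thesis by blast
next
  case True
  let ?W = "(\<lambda>i. (A ^^ i) v) ` {..card B}"
  have "complex_vector.dependent ?W"
  proof (rule ccontr)
    assume "\<not> ?thesis"
    from complex_vector.independent_span_bound[OF assms(1) this] assms(2)
    have "card ?W \<le> card B" by blast
    thus False by (simp add: card_image[OF True])
  qed
  then obtain u w where u: "w \<in> ?W" "u w \<noteq> 0" "(\<Sum>x\<in>?W. u x *\<^sub>C x) = 0"
    using complex_vector.dependent_finite[of ?W] by auto
  then obtain i0 where i0: "i0 \<le> card B" "u ((A ^^ i0) v) \<noteq> 0" by auto
  let ?p = "\<Sum>i\<le>card B. monom (u ((A ^^ i) v)) i"
  have "coeff ?p i0 = u ((A ^^ i0) v)" using i0(1) by (simp add: coeff_sum)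
  hence "?p \<noteq> 0" using i0(2) by auto
  moreover have "op_poly A v ?p = 0"
    using u(3) by (simp add: op_poly_sum op_poly_monom sum.reindex[OF True])
  ultimately show ?thesis by blast
qed

end

text \<open>An annihilating polynomial of least degree factors as (X - r) q over the complex
  numbers; by minimality q(A) v is not zero, and it is an eigenvector for r.\<close>

lemma eigenvector_exists:
  fixes V :: "'a::complex_vector set"
  assumes A: "clinear A" and V: "complex_vector.subspace V" "finite B" "V \<subseteq> cspan B"
    and inv: "\<And>x. x \<in> V \<Longrightarrow> A x \<in> V" and "V \<noteq> {0}"
  shows "\<exists>x r. x \<in> V \<and> x \<noteq> 0 \<and> A x = r *\<^sub>C x"
proof -
  obtain v where v: "v \<in> V" "v \<noteq> 0"
    using \<open>V \<noteq> {0}\<close> complex_vector.subspace_0[OF V(1)] by blast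
  have "(A ^^ i) v \<in> V" for i by (induction i) (simp_all add: v inv)
  hence "(A ^^ i) v \<in> cspan B" for i using V(3) by (rule subsetD[rotated])
  from op_poly_annihilated[OF A V(2) this]
  have ex: "\<exists>p. p \<noteq> 0 \<and> op_poly A v p = 0" .
  define p where "p = (ARG_MIN degree p. p \<noteq> 0 \<and> op_poly A v p = 0)"
  have p: "p \<noteq> 0" "op_poly A v p = 0"
    unfolding p_def using ex arg_min_natI[of "\<lambda>p. p \<noteq> 0 \<and> op_poly A v p = 0"] by blast+
  have min: "degree p \<le> degree q" if "q \<noteq> 0" "op_poly A v q = 0" for q
    unfolding p_def by (rule arg_min_nat_le) (simp add: that)
  have "degree p \<noteq> 0"
  proof
    assume "degree p = 0"
    then obtain c where "p = [:c:]" by (rule degree_eq_zeroE)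
    with p v show False by (simp add: op_poly_pCons[OF A] op_poly_0[OF A] clinear_0[OF A])
  qed
  then obtain r where "poly p r = 0"
    using fundamental_theorem_of_algebra[of p] by (auto simp: constant_degree)
  then obtain q where q: "p = [:- r, 1:] * q" by (auto simp: poly_eq_0_iff_dvd)
  with p(1) have "q \<noteq> 0" by auto
  hence "degree p = Suc (degree q)" unfolding q by (subst degree_mult_eq) auto
  with min[OF \<open>q \<noteq> 0\<close>] have "op_poly A v q \<noteq> 0" by force
  moreover have "A (op_poly A v q) = r *\<^sub>C op_poly A v q"
    using p(2) unfolding q op_poly_linear_factor[OF A] by simp
  ultimately show ?thesis using op_poly_closed[OF A V(1) v(1) inv] by blast
qed

lemma dim_strict_mono:
  fixes V W :: "'a::complex_vector set"
  assumes "complex_vector.subspace W" "W \<subset> V" "finite B" "V \<subseteq> cspan B"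
  shows "cdim W < cdim V"
proof -
  obtain b where b: "b \<subseteq> W" "\<not> complex_vector.dependent b" "W \<subseteq> cspan b" "card b = cdim W"
    using complex_vector.basis_exists[of W] by blast
  obtain x where x: "x \<in> V" "x \<notin> W" using assms(2) by blast
  have "cspan b \<subseteq> W" using b(1) assms(1) by (rule complex_vector.span_minimal)
  hence "x \<notin> cspan b" using x by blast
  hence ind: "\<not> complex_vector.dependent (insert x b)"
    using b(2) by (rule complex_vector.independent_insertI)
  have "insert x b \<subseteq> V" using x b(1) assms(2) by blast
  then obtain c where c: "insert x b \<subseteq> c" "c \<subseteq> V" "\<not> complex_vector.dependent c" "V \<subseteq> cspan c"
    using complex_vector.maximal_independent_subset_extend[OF _ ind] by blast
  have "finite c"
    using complex_vector.independent_span_bound[OF assms(3) c(3)] c(2) assms(4) by blast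
  moreover have "card c = cdim V" using complex_vector.basis_card_eq_dim c by blast
  moreover have "x \<notin> b" using x b(1) by blast
  moreover have "finite b" using c(1) \<open>finite c\<close> by (auto intro: finite_subset[of b c])
  ultimately show ?thesis using b(4) card_mono[OF \<open>finite c\<close> c(1)] by simp
qed

text \<open>Induction on the dimension, since \<open>M\<close> may be infinite. If some
  \<open>A\<close> is not scalar on \<open>V\<close>, one of its eigenspaces in \<open>V\<close> is
  a proper nonzero subspace, invariant under everything that commutes with \<open>A\<close>.\<close>

lemma joint_eigenvector_exists:
  fixes V :: "'a::complex_vector set"
  assumes "\<And>A. A \<in> M \<Longrightarrow> clinear A"
    and "\<And>A B. A \<in> M \<Longrightarrow> B \<in> M \<Longrightarrow> A \<circ> B = B \<circ> A"
    and "finite S"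
    and "complex_vector.subspace V" "V \<subseteq> cspan S" "V \<noteq> {0}"
    and "\<And>A x. A \<in> M \<Longrightarrow> x \<in> V \<Longrightarrow> A x \<in> V"
  shows "\<exists>x\<in>V. x \<noteq> 0 \<and> (\<forall>A\<in>M. \<exists>r. A x = r *\<^sub>C x)"
  using assms(4-)
proof (induction "cdim V" arbitrary: V rule: less_induct)
  case less
  show ?case
  proof (cases "\<forall>A\<in>M. \<exists>r. \<forall>x\<in>V. A x = r *\<^sub>C x")
    case True
    moreover obtain x where "x \<in> V" "x \<noteq> 0"
      using less.prems(1,3) complex_vector.subspace_0 by blast
    ultimately show ?thesis by blast
  next
    case False
    then obtain A where A: "A \<in> M" "\<And>r. \<exists>x\<in>V. A x \<noteq> r *\<^sub>C x" by blast
    obtain v r where v: "v \<in> V" "v \<noteq> 0" "A v = r *\<^sub>C v"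
      using eigenvector_exists[OF assms(1)[OF A(1)] less.prems(1) assms(3) less.prems(2)
          less.prems(4)[OF A(1)] less.prems(3)] by blast
    define W where "W = {x \<in> V. A x = r *\<^sub>C x}"
    note lin = assms(1)[OF A(1)]
    have W: "complex_vector.subspace W"
      unfolding W_def using less.prems(1)
      by (auto simp: complex_vector.subspace_def clinear_0[OF lin]
          clinear_add[OF lin] clinear_scaleC[OF lin]
          scaleC_add_right scaleC_scaleC mult.commute)
    have "W \<subset> V" unfolding W_def using A(2)[of r] by blast
    have "cdim W < cdim V"
      using dim_strict_mono[OF W \<open>W \<subset> V\<close> assms(3) less.prems(2)] .
    moreover have "W \<subseteq> cspan S" "W \<noteq> {0}" using less.prems(2) v by (auto simp: W_def)
    moreover have "B x \<in> W" if "B \<in> M" "x \<in> W" for B x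
    proof -
      have "A (B x) = B (A x)" using assms(2)[OF A(1) that(1)] by (metis comp_apply)
      also have "\<dots> = r *\<^sub>C B x"
        using that(2) by (simp add: W_def clinear_scaleC[OF assms(1)[OF that(1)]])
      finally show ?thesis using that less.prems(4) by (simp add: W_def)
    qed
    ultimately have "\<exists>x\<in>W. x \<noteq> 0 \<and> (\<forall>A\<in>M. \<exists>r. A x = r *\<^sub>C x)"
      using less.hyps[of W] W by blast
    thus ?thesis by (auto simp: W_def)
  qed
qed

section \<open>Frames and simultaneous diagonalisation\<close>

definition frame :: "'a::complex_inner set \<Rightarrow> bool" where
  "frame F \<longleftrightarrow> orthonormal F \<and> (\<forall>x. (\<forall>e\<in>F. cinner x e = 0) \<longrightarrow> x = 0)"

definition diagonal :: "('a::complex_vector \<Rightarrow> 'a) \<Rightarrow> 'a set \<Rightarrow> bool" where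
  "diagonal A F \<longleftrightarrow> (\<forall>e\<in>F. \<exists>r. A e = r *\<^sub>C e)"

lemma frame_orthonormal: "frame F \<Longrightarrow> orthonormal F"
  by (simp add: frame_def)

lemma frame_zero: "frame F \<Longrightarrow> (\<And>e. e \<in> F \<Longrightarrow> cinner x e = 0) \<Longrightarrow> x = 0"
  by (simp add: frame_def)

text \<open>Zorn's lemma gives a maximal orthonormal set of joint eigenvectors. A nonzero vector
  orthogonal to it is either killed by all of \<open>M\<close>, hence itself a joint eigenvector, or
  is moved by some operator into a nonzero finite-dimensional space that contains one.\<close>

lemma simultaneous_diagonalisation:
  fixes M :: "('a::complex_inner \<Rightarrow> 'a) set"
  assumes lin: "\<And>A. A \<in> M \<Longrightarrow> clinear A"
    and sym: "\<And>A. A \<in> M \<Longrightarrow> is_cadjoint A A"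
    and fin: "\<And>A. A \<in> M \<Longrightarrow> \<exists>S. finite S \<and> range A \<subseteq> cspan S"
    and comm: "\<And>A B. A \<in> M \<Longrightarrow> B \<in> M \<Longrightarrow> A \<circ> B = B \<circ> A"
    and S: "orthonormal S" "\<And>A. A \<in> M \<Longrightarrow> diagonal A S"
  shows "\<exists>F. frame F \<and> S \<subseteq> F \<and> (\<forall>A\<in>M. diagonal A F)"
proof -
  define P where "P = {F. orthonormal F \<and> S \<subseteq> F \<and> (\<forall>A\<in>M. diagonal A F)}"
  have "\<exists>F\<in>P. \<forall>G\<in>P. F \<subseteq> G \<longrightarrow> G = F"
  proof (rule subset_Zorn_nonempty)
    show "P \<noteq> {}" using S by (auto simp: P_def)
    fix K assume K: "K \<noteq> {}" "subset.chain P K"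
    have "orthonormal (\<Union>K)" unfolding orthonormal_def
    proof (intro ballI)
      fix x y assume "x \<in> \<Union>K" "y \<in> \<Union>K"
      then obtain X Y where XY: "X \<in> K" "x \<in> X" "Y \<in> K" "y \<in> Y" by blast
      hence "X \<subseteq> Y \<or> Y \<subseteq> X" using K(2) by (auto simp: subset_chain_def)
      then obtain Z where "Z \<in> K" "x \<in> Z" "y \<in> Z" using XY by blast
      moreover have "orthonormal Z" using K(2) \<open>Z \<in> K\<close> by (auto simp: subset_chain_def P_def)
      ultimately show "cinner x y = (if x = y then 1 else 0)" by (simp add: orthonormalD)
    qed
    moreover have KP: "orthonormal G \<and> S \<subseteq> G \<and> (\<forall>A\<in>M. diagonal A G)" if "G \<in> K" for G
      using K(2) that by (auto simp: subset_chain_def P_def)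
    have "diagonal A (\<Union>K)" if "A \<in> M" for A
      unfolding diagonal_def using KP that by (metis UnionE diagonal_def)
    moreover have "S \<subseteq> \<Union>K" using K(1) KP by blast
    ultimately show "\<Union>K \<in> P" by (simp add: P_def)
  qed
  then obtain F where F: "F \<in> P" and max: "\<And>G. G \<in> P \<Longrightarrow> F \<subseteq> G \<Longrightarrow> G = F" by blast
  have onF: "orthonormal F" and dF: "\<And>A. A \<in> M \<Longrightarrow> diagonal A F" using F by (auto simp: P_def)
  have no_new: False
    if "x \<noteq> 0" "\<And>e. e \<in> F \<Longrightarrow> cinner x e = 0" "\<And>A. A \<in> M \<Longrightarrow> \<exists>r. A x = r *\<^sub>C x" for x
  proof -
    have "\<exists>r. A (unit_vec x) = r *\<^sub>C unit_vec x" if A: "A \<in> M" for A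
    proof -
      obtain r where "A x = r *\<^sub>C x" using \<open>\<And>A. A \<in> M \<Longrightarrow> \<exists>r. A x = r *\<^sub>C x\<close> A by blast
      hence "A (unit_vec x) = r *\<^sub>C unit_vec x"
        by (simp add: unit_vec_def clinear_scaleC[OF lin[OF A]] scaleC_scaleC mult.commute)
      thus ?thesis ..
    qed
    hence "insert (unit_vec x) F \<in> P"
      using F that by (auto simp: P_def diagonal_def intro!: orthonormal_insert)
    hence "unit_vec x \<in> F" using max by blast
    hence "cinner x (unit_vec x) = 0" using that(2) by blast
    thus False using that(1) by simp
  qed
  have "x = 0" if perp: "\<And>e. e \<in> F \<Longrightarrow> cinner x e = 0" for x
  proof (rule ccontr)
    assume "x \<noteq> 0"
    show False
    proof (cases "\<forall>A\<in>M. A x = 0")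
      case True
      with no_new[OF \<open>x \<noteq> 0\<close> perp] show False by (metis complex_vector.scale_zero_left)
    next
      case False
      then obtain A where A: "A \<in> M" "A x \<noteq> 0" by blast
      \<comment> \<open>Commuting with \<open>A\<close> preserves its range, and symmetry preserves
        the orthogonal complement of a set of eigenvectors; so all of \<open>M\<close> acts on this
        space.\<close>
      define V where "V = {y. y \<in> range A \<and> (\<forall>e\<in>F. cinner y e = 0)}"
      have perpB: "cinner (B y) e = 0"
        if B: "B \<in> M" and y: "\<And>e. e \<in> F \<Longrightarrow> cinner y e = 0" and e: "e \<in> F" for B y e
      proof -
        obtain r where "B e = r *\<^sub>C e" using dF[OF B] e unfolding diagonal_def by blast
        thus ?thesis using sym[OF B] y[OF e] by (simp add: is_cadjoint_def cinner_simps)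
      qed
      note linA = lin[OF A(1)]
      note sub = subspace_range[OF linA]
      have V: "complex_vector.subspace V"
        using sub by (auto simp: complex_vector.subspace_def V_def cinner_simps)
      have "A x \<in> V" using perpB[OF A(1) perp] by (auto simp: V_def)
      hence "V \<noteq> {0}" using A(2) by blast
      obtain T where T: "finite T" "range A \<subseteq> cspan T" using fin[OF A(1)] by blast
      have "V \<subseteq> cspan T" using T(2) by (auto simp: V_def)
      have inv: "B y \<in> V" if B: "B \<in> M" and y: "y \<in> V" for B y
      proof -
        obtain z where "y = A z" using y by (auto simp: V_def)
        hence "B y = A (B z)" using comm[OF A(1) B] by (metis comp_apply)
        moreover have "cinner (B y) e = 0" if "e \<in> F" for e
          using perpB[OF B _ that, of y] y by (auto simp: V_def)
        ultimately show ?thesis by (auto simp: V_def)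
      qed
      have "\<exists>y\<in>V. y \<noteq> 0 \<and> (\<forall>B\<in>M. \<exists>r. B y = r *\<^sub>C y)"
        by (rule joint_eigenvector_exists[where S = T])
          (fact lin comm T(1) V \<open>V \<subseteq> cspan T\<close> \<open>V \<noteq> {0}\<close> inv)+
      then obtain y where y: "y \<in> V" "y \<noteq> 0" "\<forall>B\<in>M. \<exists>r. B y = r *\<^sub>C y" by blast
      show False by (rule no_new[of y]) (use y in \<open>auto simp: V_def\<close>)
    qed
  qed
  thus ?thesis using F by (auto simp: P_def frame_def)
qed

corollary frame_extends:
  assumes "orthonormal S"
  shows "\<exists>F. frame F \<and> S \<subseteq> F"
proof -
  have "\<exists>F. frame F \<and> S \<subseteq> F \<and> (\<forall>A\<in>{}. diagonal A F)"
    by (rule simultaneous_diagonalisation) (use assms in auto)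
  thus ?thesis by blast
qed

section \<open>Operators diagonal in an orthonormal sequence\<close>

lemma symD: "is_cadjoint A A \<Longrightarrow> cinner (A x) y = cinner x (A y)"
  by (simp add: is_cadjoint_def)

lemma sym_eigenvalue_real:
  assumes "is_cadjoint A A" "A e = r *\<^sub>C e" "e \<noteq> 0"
  shows "cnj r = r"
  using symD[OF assms(1), of e e] assms(2,3) by (simp add: cinner_simps)

lemma sym_eigenvectors_perp:
  assumes "is_cadjoint A A" "A x = \<alpha> *\<^sub>C x" "A e = r *\<^sub>C e" "r \<noteq> \<alpha>"
  shows "cinner x e = 0"
proof (cases "e = 0")
  case False
  have "\<alpha> * cinner x e = r * cinner x e"
    using symD[OF assms(1), of x e] sym_eigenvalue_real[OF assms(1,3) False]
    by (simp add: assms cinner_simps)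
  thus ?thesis using assms(4) by simp
qed simp

text \<open>Eigenvectors of a symmetric operator for distinct eigenvalues are orthogonal, so an
  eigenvector minus its projection onto \<open>E\<close> is orthogonal to all of \<open>F\<close>.
  For \<alpha> \<noteq> 0 the eigenspace lies in the range, which makes \<open>E\<close>
  finite.\<close>

lemma eigenspace_frame:
  fixes A :: "'a::complex_inner \<Rightarrow> 'a"
  assumes A: "clinear A" "is_cadjoint A A" "finite B" "range A \<subseteq> cspan B"
    and F: "frame F" "diagonal A F" and "\<alpha> \<noteq> 0"
  defines "E \<equiv> {e \<in> F. A e = \<alpha> *\<^sub>C e}"
  shows "finite E" and "cspan E = {x. A x = \<alpha> *\<^sub>C x}"
proof -
  have onE: "orthonormal E"
    using frame_orthonormal[OF F(1)] by (rule orthonormal_subset) (auto simp: E_def)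
  have "E \<subseteq> range A"
  proof
    fix e assume "e \<in> E"
    hence "e = A (inverse \<alpha> *\<^sub>C e)"
      using \<open>\<alpha> \<noteq> 0\<close> by (simp add: E_def clinear_scaleC[OF A(1)])
    thus "e \<in> range A" by (rule range_eqI)
  qed
  hence "E \<subseteq> cspan B" using A(4) by blast
  thus fin: "finite E"
    using complex_vector.independent_span_bound[OF A(3) orthonormal_independent[OF onE]] by blast
  show "cspan E = {x. A x = \<alpha> *\<^sub>C x}"
  proof
    have "complex_vector.subspace {x. A x = \<alpha> *\<^sub>C x}"
      by (simp add: complex_vector.subspace_def clinear_0[OF A(1)] clinear_add[OF A(1)]
          clinear_scaleC[OF A(1)] scaleC_add_right mult.commute)
    thus "cspan E \<subseteq> {x. A x = \<alpha> *\<^sub>C x}"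
      by (intro complex_vector.span_minimal) (auto simp: E_def)
  next
    show "{x. A x = \<alpha> *\<^sub>C x} \<subseteq> cspan E"
    proof
      fix x assume "x \<in> {x. A x = \<alpha> *\<^sub>C x}"
      hence x: "A x = \<alpha> *\<^sub>C x" by simp
      have "x - proj E x = 0"
      proof (rule frame_zero[OF F(1)])
        fix e assume e: "e \<in> F"
        show "cinner (x - proj E x) e = 0"
        proof (cases "e \<in> E")
          case True
          thus ?thesis using cinner_proj[OF fin onE] by (simp add: cinner_simps)
        next
          case False
          obtain r where r: "A e = r *\<^sub>C e" using F(2) e unfolding diagonal_def by blast
          have "r \<noteq> \<alpha>" using False e r by (auto simp: E_def)
          with sym_eigenvectors_perp[OF A(2) x r] have "cinner x e = 0" by simp
          moreover have "cinner (proj E x) e = 0"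
          proof (rule perp_span_left[OF proj_in_span])
            fix s assume "s \<in> E"
            thus "cinner s e = 0"
              using orthonormalD[OF frame_orthonormal[OF F(1)], of s e] e False
              by (auto simp: E_def)
          qed
          ultimately show ?thesis by (simp add: cinner_simps)
        qed
      qed
      hence "x = proj E x" by simp
      thus "x \<in> cspan E" using proj_in_span[of E x] by simp
    qed
  qed
qed

text \<open>Defined for every sequence, orthonormal or not, so that linearity and symmetry hold
  unconditionally; symmetry uses that the coefficients are real.\<close>

definition diag_op :: "(nat \<Rightarrow> real) \<Rightarrow> nat \<Rightarrow> (nat \<Rightarrow> 'a::complex_inner) \<Rightarrow> 'a \<Rightarrow> 'a" where
  "diag_op a k v x = (\<Sum>j<k. (complex_of_real (a j) * cinner x (v j)) *\<^sub>C v j)"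

definition onseq :: "nat \<Rightarrow> (nat \<Rightarrow> 'a::complex_inner) \<Rightarrow> bool" where
  "onseq k v \<longleftrightarrow> (\<forall>i<k. \<forall>j<k. cinner (v i) (v j) = (if i = j then 1 else 0))"

lemma onseqD: "onseq k v \<Longrightarrow> i < k \<Longrightarrow> j < k \<Longrightarrow> cinner (v i) (v j) = (if i = j then 1 else 0)"
  by (simp add: onseq_def)

lemma onseq_inj: "onseq k v \<Longrightarrow> inj_on v {..<k}"
  by (rule inj_onI) (metis lessThan_iff onseqD zero_neq_one)

lemma onseq_norm: "onseq k v \<Longrightarrow> i < k \<Longrightarrow> norm (v i) = 1"
  using onseqD[of k v i i] by (simp add: cinner_self_eq_1)

lemma onseq_iff: "onseq k v \<longleftrightarrow> inj_on v {..<k} \<and> orthonormal (v ` {..<k})"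
proof
  assume v: "onseq k v"
  have "orthonormal (v ` {..<k})"
    using v inj_on_eq_iff[OF onseq_inj[OF v]] by (auto simp: orthonormal_def onseqD)
  thus "inj_on v {..<k} \<and> orthonormal (v ` {..<k})" using onseq_inj[OF v] by simp
next
  assume "inj_on v {..<k} \<and> orthonormal (v ` {..<k})"
  thus "onseq k v" unfolding onseq_def
    by (metis imageI inj_on_eq_iff lessThan_iff orthonormalD)
qed

lemma onseq_mono: "onseq k v \<Longrightarrow> n \<le> k \<Longrightarrow> onseq n v"
  by (auto simp: onseq_def)

lemma diag_op_clinear: "clinear (diag_op a k v)"
  unfolding clinear_iff diag_op_def
  by (auto simp: cinner_simps distrib_left scaleC_add_left sum.distrib
      complex_vector.scale_sum_right mult.left_commute intro!: sum.cong)

lemma diag_op_sym: "is_cadjoint (diag_op a k v) (diag_op a k v)"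
  unfolding is_cadjoint_def
proof (intro allI)
  fix x y
  have "cinner x (v j) * cinner (v j) y = cnj (cinner y (v j)) * cinner x (v j)" for j
    using cinner_commute[of "v j" y] by simp
  thus "cinner (diag_op a k v x) y = cinner x (diag_op a k v y)"
    unfolding diag_op_def cinner_sum_left cinner_sum_right
    by (intro sum.cong) (simp_all add: cinner_simps mult.assoc)
qed

lemma diag_op_in_span: "diag_op a k v x \<in> cspan (v ` {..<k})"
  unfolding diag_op_def
  by (intro complex_vector.span_sum complex_vector.span_scale complex_vector.span_base) auto

lemma diag_op_apply:
  assumes "onseq k v" "j < k"
  shows "diag_op a k v (v j) = complex_of_real (a j) *\<^sub>C v j"
proof -
  have "diag_op a k v (v j) = (\<Sum>i<k. if i = j then complex_of_real (a j) *\<^sub>C v j else 0)"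
    unfolding diag_op_def by (rule sum.cong) (use assms in \<open>auto simp: onseqD\<close>)
  thus ?thesis using assms(2) by simp
qed

lemma diag_op_perp: "(\<And>j. j < k \<Longrightarrow> cinner x (v j) = 0) \<Longrightarrow> diag_op a k v x = 0"
  by (simp add: diag_op_def)

lemma range_diag_op:
  assumes "onseq k v" "\<And>j. j < k \<Longrightarrow> a j \<noteq> 0"
  shows "range (diag_op a k v) = cspan (v ` {..<k})"
proof
  show "range (diag_op a k v) \<subseteq> cspan (v ` {..<k})" using diag_op_in_span by blast
  have "v j \<in> range (diag_op a k v)" if "j < k" for j
  proof -
    have "v j = diag_op a k v (complex_of_real (inverse (a j)) *\<^sub>C v j)"
      using assms(2)[OF that]
      by (simp add: clinear_scaleC[OF diag_op_clinear] diag_op_apply[OF assms(1) that])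
    thus ?thesis by (rule range_eqI)
  qed
  thus "cspan (v ` {..<k}) \<subseteq> range (diag_op a k v)"
    by (intro complex_vector.span_minimal subspace_range diag_op_clinear) auto
qed

lemma diag_op_cong: "(\<And>j. j < k \<Longrightarrow> v j = w j) \<Longrightarrow> diag_op a k v = diag_op a k w"
  by (simp add: diag_op_def fun_eq_iff)

lemma unit_mult_cnj: "cmod c = 1 \<Longrightarrow> cnj c * c = 1"
  using complex_norm_square[of c] by (simp add: mult.commute)

text \<open>Each \<open>v j\<close> occurs once in a linear and once in a conjugate-linear place, so
  its phase cancels. The operator depends on lines only, which is why a map of lines suffices in the
  end.\<close>

lemma diag_op_phases:
  assumes "\<And>j. j < k \<Longrightarrow> \<exists>c. cmod c = 1 \<and> w j = c *\<^sub>C v j"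
  shows "diag_op a k w = diag_op a k v"
proof
  fix x
  have "(complex_of_real (a j) * cinner x (w j)) *\<^sub>C w j = (complex_of_real (a j) * cinner x (v j)) *\<^sub>C v j"
    if j: "j < k" for j
  proof -
    obtain c where c: "cmod c = 1" "w j = c *\<^sub>C v j" using assms[OF j] by blast
    have "complex_of_real (a j) * (cnj c * cinner x (v j)) * c
        = (cnj c * c) * (complex_of_real (a j) * cinner x (v j))" by (simp add: algebra_simps)
    thus ?thesis using unit_mult_cnj[OF c(1)] by (simp add: c(2) cinner_simps)
  qed
  thus "diag_op a k w x = diag_op a k v x" unfolding diag_op_def by (intro sum.cong) auto
qed

lemma antilinear_sum:
  assumes "antilinear U"
  shows "U (\<Sum>i\<in>I. g i) = (\<Sum>i\<in>I. U (g i))"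
proof -
  have "U 0 = 0" using assms unfolding antilinear_def by (metis add_cancel_right_right)
  thus ?thesis using assms
    by (induction I rule: infinite_finite_induct) (simp_all add: antilinear_def)
qed

lemma clinear_sum:
  assumes "clinear U"
  shows "U (\<Sum>i\<in>I. g i) = (\<Sum>i\<in>I. U (g i))"
  by (induction I rule: infinite_finite_induct) (simp_all add: clinear_0[OF assms] clinear_add[OF assms])

lemma diag_op_unitary:
  assumes "unitary U"
  shows "U \<circ> diag_op a k v \<circ> inv U = diag_op a k (U \<circ> v)"
proof
  fix x
  have U: "clinear U" "bij U" "\<And>x y. cinner (U x) (U y) = cinner x y"
    using assms by (auto simp: unitary_def)
  define y where "y = inv U x"
  have x: "x = U y" using U(2) by (simp add: y_def bij_is_surj surj_f_inv_f)
  show "(U \<circ> diag_op a k v \<circ> inv U) x = diag_op a k (U \<circ> v) x"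
    by (simp add: y_def[symmetric])
      (simp add: x diag_op_def clinear_sum[OF U(1)] clinear_scaleC[OF U(1)] U(3))
qed

text \<open>An antilinear \<open>U\<close> conjugates the coefficients. This fixes the real
  eigenvalues and turns \<open>cinner y (v j)\<close> into the inner product of the images.\<close>

lemma diag_op_antiunitary:
  assumes "antiunitary U"
  shows "U \<circ> diag_op a k v \<circ> inv U = diag_op a k (U \<circ> v)"
proof
  fix x
  have U: "antilinear U" "bij U" "\<And>x y. cinner (U x) (U y) = cnj (cinner x y)"
    using assms by (auto simp: antiunitary_def)
  define y where "y = inv U x"
  have x: "x = U y" using U(2) by (simp add: y_def bij_is_surj surj_f_inv_f)
  have "U (c *\<^sub>C z) = cnj c *\<^sub>C U z" for c z using U(1) by (simp add: antilinear_def)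
  thus "(U \<circ> diag_op a k v \<circ> inv U) x = diag_op a k (U \<circ> v) x"
    by (simp add: y_def[symmetric]) (simp add: x diag_op_def antilinear_sum[OF U(1)] U(3))
qed

section \<open>Conjugacy classes\<close>

text \<open>The members of a diagonalising frame with nonzero eigenvalue lie in the range and, by
  testing against the frame, span it. So there are \<open>k\<close> of them, and numbering them
  gives \<open>v\<close>.\<close>

lemma spectral_theorem:
  fixes A :: "'a::complex_inner \<Rightarrow> 'a"
  assumes "A \<in> self_adjoint_finite_rank" "rank_op A = enat k"
  obtains a v where "onseq k v" "\<And>j. j < k \<Longrightarrow> a j \<noteq> 0" "A = diag_op a k v"
proof -
  have A: "clinear A" "is_cadjoint A A"
    using assms(1) by (auto simp: self_adjoint_finite_rank_def bounded_clinear_def)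
  obtain B where B: "finite B" "range A \<subseteq> cspan B" and dim: "cdim (range A) = k"
    using assms(2) by (auto simp: rank_op_def ecdim_def split: if_splits)
  obtain F where F: "frame F" "diagonal A F"
    using simultaneous_diagonalisation[of "{A}" "{}"] A B by (auto simp: diagonal_def)
  define E where "E = {e \<in> F. A e \<noteq> 0}"
  have onE: "orthonormal E"
    using frame_orthonormal[OF F(1)] by (rule orthonormal_subset) (auto simp: E_def)
  have "E \<subseteq> range A"
  proof
    fix e assume e: "e \<in> E"
    then obtain r where r: "A e = r *\<^sub>C e" using F(2) by (auto simp: E_def diagonal_def)
    hence "r \<noteq> 0" using e by (auto simp: E_def)
    hence "e = A (inverse r *\<^sub>C e)" using r by (simp add: clinear_scaleC[OF A(1)])
    thus "e \<in> range A" by (rule range_eqI)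
  qed
  hence "E \<subseteq> cspan B" using B(2) by blast
  hence fin: "finite E"
    using complex_vector.independent_span_bound[OF B(1) orthonormal_independent[OF onE]] by blast
  have rep: "A x = proj E (A x)" for x
  proof -
    have "A x - proj E (A x) = 0"
    proof (rule frame_zero[OF F(1)])
      fix e assume e: "e \<in> F"
      show "cinner (A x - proj E (A x)) e = 0"
      proof (cases "e \<in> E")
        case True
        thus ?thesis using cinner_proj[OF fin onE] by (simp add: cinner_simps)
      next
        case False
        hence "A e = 0" using e by (simp add: E_def)
        hence "cinner (A x) e = 0" using symD[OF A(2), of x e] by simp
        moreover have "cinner (proj E (A x)) e = 0"
        proof (rule perp_span_left[OF proj_in_span])
          fix s assume "s \<in> E"
          thus "cinner s e = 0"
            using orthonormalD[OF frame_orthonormal[OF F(1)], of s e] e False by (auto simp: E_def)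
        qed
        ultimately show ?thesis by (simp add: cinner_simps)
      qed
    qed
    thus ?thesis by simp
  qed
  have "range A \<subseteq> cspan E" using rep proj_in_span[of E] by (metis image_subsetI)
  with \<open>E \<subseteq> range A\<close> have "card E = k"
    using complex_vector.basis_card_eq_dim orthonormal_independent[OF onE] dim by blast
  then obtain v where v: "bij_betw v {..<k} E"
    using ex_bij_betw_nat_finite[OF fin] by (auto simp: atLeast0LessThan)
  define a where "a j = Re (cinner (A (v j)) (v j))" for j
  have eig: "A (v j) = complex_of_real (a j) *\<^sub>C v j" "a j \<noteq> 0" if "j < k" for j
  proof -
    have e: "v j \<in> E" using v that by (auto simp: bij_betw_def)
    then obtain r where r: "A (v j) = r *\<^sub>C v j" using F(2) by (auto simp: E_def diagonal_def)
    have 1: "cinner (v j) (v j) = 1" using orthonormalD[OF onE e e] by simp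
    hence "v j \<noteq> 0" by auto
    hence "cnj r = r" using sym_eigenvalue_real[OF A(2) r] by simp
    moreover have "a j = Re r" by (simp add: a_def r cinner_simps 1)
    ultimately have "complex_of_real (a j) = r" by (simp add: complex_eq_iff)
    thus "A (v j) = complex_of_real (a j) *\<^sub>C v j" using r by simp
    thus "a j \<noteq> 0" using e by (auto simp: E_def)
  qed
  have on: "onseq k v" using v onE by (auto simp: onseq_iff bij_betw_def)
  have "A x = diag_op a k v x" for x
  proof -
    have "A x = (\<Sum>j<k. cinner (A x) (v j) *\<^sub>C v j)"
      by (subst rep) (simp add: proj_def sum.reindex_bij_betw[OF v, symmetric])
    also have "\<dots> = diag_op a k v x"
      unfolding diag_op_def by (rule sum.cong) (simp_all add: symD[OF A(2)] eig(1) cinner_simps)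
    finally show ?thesis .
  qed
  hence "A = diag_op a k v" by blast
  with on eig(2) show thesis by (rule that)
qed

section \<open>Reflections, and moving one orthonormal sequence to another up to phases\<close>

lemma unitary_id [simp]: "unitary id"
  by (simp add: unitary_def clinear_iff)

lemma unitary_comp: "unitary U \<Longrightarrow> unitary V \<Longrightarrow> unitary (U \<circ> V)"
  by (auto simp: unitary_def clinear_iff bij_comp)

text \<open>For \<open>w = 0\<close> division by zero makes this the identity.\<close>

definition reflection :: "'a::complex_inner \<Rightarrow> 'a \<Rightarrow> 'a" where
  "reflection w x = x - (2 * cinner x w / cinner w w) *\<^sub>C w"

lemma reflection_perp: "cinner x w = 0 \<Longrightarrow> reflection w x = x"
  by (simp add: reflection_def)

lemma reflection_unitary: "unitary (reflection w)"
proof (cases "w = 0")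
  case True
  hence "reflection w = id" by (simp add: reflection_def fun_eq_iff)
  thus ?thesis by (metis unitary_id)
next
  case False
  hence nz: "cinner w w \<noteq> 0" by simp
  have real: "cnj (cinner w w) = cinner w w" using cinner_commute[of w w] by simp
  have lin: "clinear (reflection w)"
    unfolding clinear_iff reflection_def
    by (simp add: cinner_simps add_divide_distrib distrib_left scaleC_add_left
        complex_vector.scale_right_diff_distrib algebra_simps)
  have "reflection w (reflection w x) = x" for x
    using nz by (simp add: reflection_def cinner_simps complex_vector.scale_left_diff_distrib[symmetric]
        complex_vector.scale_left_distrib[symmetric] diff_diff_eq divide_simps)
  hence "bij (reflection w)" by (metis involuntory_imp_bij)
  moreover have "cinner (reflection w x) (reflection w y) = cinner x y" for x y
  proof -
    have "cinner w y = cnj (cinner y w)" by (rule cinner_commute)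
    thus ?thesis using nz by (simp add: reflection_def cinner_simps real field_simps)
  qed
  ultimately show ?thesis using lin by (simp add: unitary_def)
qed

lemma exists_phase: "\<exists>c. cmod c = 1 \<and> cnj c * z = complex_of_real (cmod z)"
proof (cases "z = 0")
  case False
  have "cnj (sgn z) * z = complex_of_real (cmod z)"
    using complex_norm_square[of z] False
    by (simp add: sgn_div_norm scaleR_conv_of_real field_simps power2_eq_square)
  thus ?thesis using False by (intro exI[of _ "sgn z"]) (simp add: norm_sgn)
qed (auto intro: exI[of _ 1])

text \<open>A Householder reflection along \<open>x - y\<close> takes the unit vector
  \<open>x\<close> to \<open>y\<close> only if their inner product is real; the phase
  \<open>c\<close> makes \<open>cinner x (c *\<^sub>C y)\<close> real.\<close>

lemma reflection_moves:
  assumes "norm x = 1" "norm y = 1"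
  shows "\<exists>c. cmod c = 1 \<and> reflection (x - c *\<^sub>C y) x = c *\<^sub>C y"
proof -
  obtain c where c: "cmod c = 1" "cnj c * cinner x y = complex_of_real (cmod (cinner x y))"
    using exists_phase by blast
  define w where "w = x - c *\<^sub>C y"
  define t where "t = complex_of_real (cmod (cinner x y))"
  have xy: "cinner x (c *\<^sub>C y) = t" using c(2) by (simp add: cinner_simps t_def)
  hence yx: "cinner (c *\<^sub>C y) x = t"
    using cinner_commute[of "c *\<^sub>C y" x] by (simp add: t_def)
  have x: "cinner x x = 1" "cinner (c *\<^sub>C y) (c *\<^sub>C y) = 1"
    using assms c(1) unfolding cinner_self_eq_1 by (simp_all add: norm_scaleC)
  have "reflection w x = c *\<^sub>C y"
  proof (cases "w = 0")
    case True
    thus ?thesis by (simp add: reflection_def) (simp add: w_def)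
  next
    case False
    have "cinner w w = 2 * cinner x w"
      unfolding w_def cinner_diff_left cinner_diff_right xy yx x by simp
    moreover have "cinner w w \<noteq> 0" using False by simp
    ultimately have "2 * cinner x w / cinner w w = 1" by simp
    thus ?thesis by (simp add: reflection_def w_def)
  qed
  thus ?thesis using c(1) by (auto simp: w_def)
qed

text \<open>One reflection per vector. The reflection along the difference of \<open>U (u n)\<close>
  and a multiple of \<open>v n\<close> fixes what is orthogonal to both, hence the vectors placed
  before. Phases remain, which \<open>diag_op\<close> ignores.\<close>

lemma unitary_moves_onseq:
  assumes u: "onseq k u" and v: "onseq k v"
  shows "\<exists>U. unitary U \<and> (\<forall>j<k. \<exists>c. cmod c = 1 \<and> U (u j) = c *\<^sub>C v j)"
  using assms
proof (induction k)
  case 0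
  show ?case using unitary_id by blast
next
  case (Suc n)
  obtain U where U: "unitary U" "\<And>j. j < n \<Longrightarrow> \<exists>c. cmod c = 1 \<and> U (u j) = c *\<^sub>C v j"
    using Suc.IH onseq_mono[OF Suc.prems(1)] onseq_mono[OF Suc.prems(2)] by (meson le_SucI order_refl)
  have pres: "cinner (U x) (U y) = cinner x y" for x y using U(1) by (simp add: unitary_def)
  have "cinner (U (u n)) (U (u n)) = 1" using onseqD[OF Suc.prems(1), of n n] by (simp add: pres)
  then obtain c where c: "cmod c = 1" "reflection (U (u n) - c *\<^sub>C v n) (U (u n)) = c *\<^sub>C v n"
    using reflection_moves onseq_norm[OF Suc.prems(2), of n] unfolding cinner_self_eq_1 by blast
  let ?R = "reflection (U (u n) - c *\<^sub>C v n)"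
  have "\<exists>c. cmod c = 1 \<and> ?R (U (u j)) = c *\<^sub>C v j" if "j < Suc n" for j
  proof (cases "j = n")
    case True
    thus ?thesis using c by blast
  next
    case False
    hence j: "j < n" using that by simp
    then obtain d where d: "cmod d = 1" "U (u j) = d *\<^sub>C v j" using U(2) by blast
    have "cinner (U (u j)) (U (u n)) = 0" using onseqD[OF Suc.prems(1), of j n] j by (simp add: pres)
    moreover have "cinner (U (u j)) (c *\<^sub>C v n) = 0"
      using onseqD[OF Suc.prems(2), of j n] j by (simp add: d(2) cinner_simps)
    ultimately have "?R (U (u j)) = U (u j)" by (intro reflection_perp) (simp add: cinner_diff_right)
    thus ?thesis using d by auto
  qed
  hence "\<forall>j<Suc n. \<exists>c. cmod c = 1 \<and> (?R \<circ> U) (u j) = c *\<^sub>C v j" by simp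
  thus ?case using unitary_comp[OF reflection_unitary U(1)] by blast
qed

lemma onseq_unitary: "unitary U \<Longrightarrow> onseq k v \<Longrightarrow> onseq k (U \<circ> v)"
  by (simp add: unitary_def onseq_def)

lemma conjugacy_class_diag_op:
  fixes u :: "nat \<Rightarrow> 'a::complex_inner"
  assumes u: "onseq k u"
  shows "{U \<circ> diag_op a k u \<circ> cadjoint U |U. unitary U} = {diag_op a k v |v. onseq k v}"
proof safe
  fix U :: "'a \<Rightarrow> 'a" assume U: "unitary U"
  show "\<exists>v. U \<circ> diag_op a k u \<circ> cadjoint U = diag_op a k v \<and> onseq k v"
    unfolding cadjoint_unitary[OF U] diag_op_unitary[OF U] using onseq_unitary[OF U u] by blast
next
  fix v :: "nat \<Rightarrow> 'a" assume v: "onseq k v"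
  obtain U where U: "unitary U" "\<And>j. j < k \<Longrightarrow> \<exists>c. cmod c = 1 \<and> U (u j) = c *\<^sub>C v j"
    using unitary_moves_onseq[OF u v] by blast
  have "diag_op a k (U \<circ> u) = diag_op a k v" using U(2) by (intro diag_op_phases) simp
  hence "diag_op a k v = U \<circ> diag_op a k u \<circ> cadjoint U"
    by (simp add: cadjoint_unitary[OF U(1)] diag_op_unitary[OF U(1)])
  thus "\<exists>U. diag_op a k v = U \<circ> diag_op a k u \<circ> cadjoint U \<and> unitary U" using U(1) by blast
qed

text \<open>The index set of the sum has at most one element, so a single formula covers both the
  vectors of \<open>v\<close> and the rest of \<open>F\<close>, where the sum is empty.\<close>

lemma diag_op_frame:
  assumes v: "onseq k v" and F: "orthonormal F" "v ` {..<k} \<subseteq> F" and e: "e \<in> F"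
  shows "diag_op a k v e = complex_of_real (\<Sum>j\<in>{j. j < k \<and> v j = e}. a j) *\<^sub>C e"
proof (cases "e \<in> v ` {..<k}")
  case True
  then obtain i where i: "i < k" "e = v i" by blast
  hence "{j. j < k \<and> v j = e} = {i}" using onseq_inj[OF v] by (auto simp: inj_on_def)
  thus ?thesis using diag_op_apply[OF v i(1)] i by simp
next
  case False
  have "cinner e (v j) = 0" if "j < k" for j
  proof -
    have "v j \<in> F" "e \<noteq> v j" using F(2) that False by auto
    thus ?thesis using orthonormalD[OF F(1) e] by simp
  qed
  hence "diag_op a k v e = 0" by (rule diag_op_perp)
  moreover have none: "{j. j < k \<and> v j = e} = {}" using False by auto
  ultimately show ?thesis unfolding none by simp
qed

lemma diag_op_diagonal:
  assumes "onseq k v" "orthonormal F" "v ` {..<k} \<subseteq> F"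
  shows "diagonal (diag_op a k v) F"
  unfolding diagonal_def using diag_op_frame[OF assms] by blast

lemma diag_op_eigenvectors:
  assumes v: "onseq k v" and F: "orthonormal F" "v ` {..<k} \<subseteq> F" and "\<alpha> \<noteq> 0"
  shows "{e \<in> F. diag_op a k v e = complex_of_real \<alpha> *\<^sub>C e} = v ` {j. j < k \<and> a j = \<alpha>}"
proof (intro equalityI subsetI)
  fix e assume e: "e \<in> {e \<in> F. diag_op a k v e = complex_of_real \<alpha> *\<^sub>C e}"
  hence "e \<noteq> 0" using orthonormal_norm[OF F(1)] by force
  with e diag_op_frame[OF v F, of e a] have \<alpha>: "(\<Sum>j\<in>{j. j < k \<and> v j = e}. a j) = \<alpha>"
    by (auto simp del: of_real_sum)
  hence "{j. j < k \<and> v j = e} \<noteq> {}" using \<open>\<alpha> \<noteq> 0\<close> by force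
  then obtain i where i: "i < k" "v i = e" by blast
  hence "{j. j < k \<and> v j = e} = {i}" using onseq_inj[OF v] by (auto simp: inj_on_def)
  thus "e \<in> v ` {j. j < k \<and> a j = \<alpha>}" using \<alpha> i by auto
next
  fix e assume "e \<in> v ` {j. j < k \<and> a j = \<alpha>}"
  thus "e \<in> {e \<in> F. diag_op a k v e = complex_of_real \<alpha> *\<^sub>C e}"
    using F(2) diag_op_apply[OF v] by auto
qed

lemma diag_op_eigenspace:
  fixes v :: "nat \<Rightarrow> 'a::complex_inner"
  assumes v: "onseq k v" and "\<alpha> \<noteq> 0"
  shows "{x. diag_op a k v x = complex_of_real \<alpha> *\<^sub>C x} = cspan (v ` {j. j < k \<and> a j = \<alpha>})"
proof -
  obtain F where F: "frame F" "v ` {..<k} \<subseteq> F"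
    using frame_extends[of "v ` {..<k}"] v unfolding onseq_iff by blast
  note on = frame_orthonormal[OF F(1)]
  have "range (diag_op a k v) \<subseteq> cspan (v ` {..<k})" using diag_op_in_span by blast
  from eigenspace_frame(2)[OF diag_op_clinear diag_op_sym _ this F(1) diag_op_diagonal[OF v on F(2)],
      of "complex_of_real \<alpha>"] diag_op_eigenvectors[OF v on F(2) assms(2)] assms(2)
  show ?thesis by simp
qed

lemma ecdim_span_onseq:
  assumes "onseq k v" "J \<subseteq> {..<k}"
  shows "ecdim (cspan (v ` J)) = enat (card J)"
proof -
  have "\<not> complex_vector.dependent (v ` J)"
    using assms orthonormal_subset[of "v ` {..<k}" "v ` J"]
    by (intro orthonormal_independent) (auto simp: onseq_iff)
  hence "cdim (cspan (v ` J)) = card J"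
    using complex_vector.dim_span_eq_card_independent[of "v ` J"]
      card_image[OF inj_on_subset[OF onseq_inj[OF assms(1)] assms(2)]] by simp
  moreover have "finite (v ` J)" using assms(2) finite_subset by blast
  ultimately show ?thesis by (auto simp: ecdim_def)
qed

lemma maximal_eigenspace_diag_op:
  assumes "onseq k v" "i < k" "a i \<noteq> 0"
  shows "maximal_eigenspace (diag_op a k v) (cspan (v ` {j. j < k \<and> a j = a i}))"
proof -
  have "v i \<noteq> 0" using onseq_norm[OF assms(1,2)] by auto
  hence "eigenvalue (diag_op a k v) (complex_of_real (a i))"
    unfolding eigenvalue_def using diag_op_apply[OF assms(1,2)] by blast
  thus ?thesis unfolding maximal_eigenspace_def
    using diag_op_eigenspace[OF assms(1,3), of a] assms(3) by (metis of_real_eq_0_iff)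
qed

text \<open>Sets of indices with one value count the dimension of an eigenspace. To apply
  \<open>dims\<close> the two eigenspaces must differ, which \<open>v i\<close> shows: it lies in
  only one of them.\<close>

lemma multiplicities_distinct:
  assumes v: "onseq k v" and nz: "\<And>j. j < k \<Longrightarrow> a j \<noteq> 0"
    and dims: "\<And>M N. maximal_eigenspace (diag_op a k v) M \<Longrightarrow> maximal_eigenspace (diag_op a k v) N \<Longrightarrow>
        M \<noteq> N \<Longrightarrow> ecdim M \<noteq> ecdim N"
    and ij: "i < k" "j < k" "a i \<noteq> a j"
  shows "card {l. l < k \<and> a l = a i} \<noteq> card {l. l < k \<and> a l = a j}"
proof -
  let ?E = "\<lambda>i. cspan (v ` {l. l < k \<and> a l = a i})"
  have "v i \<in> ?E i" using ij(1) by (intro complex_vector.span_base) auto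
  moreover have "v i \<notin> ?E j"
  proof
    assume "v i \<in> ?E j"
    hence "diag_op a k v (v i) = complex_of_real (a j) *\<^sub>C v i"
      using diag_op_eigenspace[OF v nz[OF ij(2)], of a] by blast
    moreover have "v i \<noteq> 0" using onseq_norm[OF v ij(1)] by auto
    ultimately show False using diag_op_apply[OF v ij(1), of a] ij(3) by simp
  qed
  ultimately have "?E i \<noteq> ?E j" by blast
  with dims[OF maximal_eigenspace_diag_op[where a = a, OF v ij(1) nz[OF ij(1)]]
      maximal_eigenspace_diag_op[where a = a, OF v ij(2) nz[OF ij(2)]]]
  have "ecdim (?E i) \<noteq> ecdim (?E j)" .
  moreover have "{l. l < k \<and> a l = a i} \<subseteq> {..<k}" "{l. l < k \<and> a l = a j} \<subseteq> {..<k}" by auto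
  ultimately show ?thesis by (simp add: ecdim_span_onseq[OF v])
qed

section \<open>Frames and colourings\<close>

text \<open>By symmetry \<open>cinner (A x) e\<close> depends on \<open>A\<close> only through
  \<open>A e\<close>, so agreement on the frame suffices although the frame need not span.\<close>

lemma sym_op_eqI:
  assumes "frame F" "is_cadjoint A A" "is_cadjoint B B" "\<And>e. e \<in> F \<Longrightarrow> A e = B e"
  shows "A = B"
proof
  fix x
  have "A x - B x = 0"
    by (rule frame_zero[OF assms(1)])
      (simp add: cinner_diff_left symD[OF assms(2)] symD[OF assms(3)] assms(4))
  thus "A x = B x" by simp
qed

lemma diag_op_commute:
  assumes "clinear A" "is_cadjoint A A" "\<And>j. j < k \<Longrightarrow> \<exists>r. A (v j) = r *\<^sub>C v j"
  shows "A \<circ> diag_op a k v = diag_op a k v \<circ> A"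
proof
  fix x
  have "A ((complex_of_real (a j) * cinner x (v j)) *\<^sub>C v j)
      = (complex_of_real (a j) * cinner (A x) (v j)) *\<^sub>C v j" if j: "j < k" for j
  proof (cases "v j = 0")
    case True
    thus ?thesis by (simp add: clinear_0[OF assms(1)])
  next
    case False
    obtain r where r: "A (v j) = r *\<^sub>C v j" using assms(3)[OF j] by blast
    have "cinner (A x) (v j) = r * cinner x (v j)"
      using sym_eigenvalue_real[OF assms(2) r False] by (simp add: symD[OF assms(2)] r cinner_simps)
    thus ?thesis by (simp add: clinear_scaleC[OF assms(1)] r mult.assoc mult.commute[of r])
  qed
  thus "(A \<circ> diag_op a k v) x = (diag_op a k v \<circ> A) x"
    by (simp add: diag_op_def clinear_sum[OF assms(1)])
qed

text \<open>The eigenvalue read off as a real number from a unit eigenvector. For \<open>A\<close>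
  diagonal in \<open>F\<close> this is the colouring of \<open>F\<close>.\<close>

definition ev :: "('a::complex_inner \<Rightarrow> 'a) \<Rightarrow> 'a \<Rightarrow> real" where
  "ev A e = Re (cinner (A e) e)"

lemma ev_eq: "A e = complex_of_real r *\<^sub>C e \<Longrightarrow> norm e = 1 \<Longrightarrow> ev A e = r"
  by (simp add: ev_def cinner_simps norm_cinner)

lemma diagonal_ev:
  assumes "is_cadjoint A A" "diagonal A F" "orthonormal F" "e \<in> F"
  shows "A e = complex_of_real (ev A e) *\<^sub>C e"
proof -
  obtain r where r: "A e = r *\<^sub>C e" using assms(2,4) unfolding diagonal_def by blast
  have e: "norm e = 1" by (rule orthonormal_norm[OF assms(3,4)])
  hence "e \<noteq> 0" by auto
  from sym_eigenvalue_real[OF assms(1) r this] have "r = complex_of_real (Re r)"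
    by (simp add: complex_eq_iff)
  with r have "A e = complex_of_real (Re r) *\<^sub>C e" by simp
  thus ?thesis using ev_eq[OF _ e] by metis
qed

text \<open>The combinatorial side of \<open>onseq\<close>: it encodes the colouring with colour
  \<open>a j\<close> at \<open>v j\<close> and 0 elsewhere. Being purely set-theoretic, it is
  transported by bijections of frames.\<close>

definition placement :: "nat \<Rightarrow> (nat \<Rightarrow> 'a) \<Rightarrow> 'a set \<Rightarrow> bool" where
  "placement k v F \<longleftrightarrow> inj_on v {..<k} \<and> v ` {..<k} \<subseteq> F"

lemma placement_onseq: "orthonormal F \<Longrightarrow> placement k v F \<Longrightarrow> onseq k v"
  unfolding placement_def onseq_iff by (blast intro: orthonormal_subset)

section \<open>The line graph of a complete graph\<close>

definition doubletons :: "'a set \<Rightarrow> 'a set set" where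
  "doubletons F = {p. p \<subseteq> F \<and> card p = 2}"

lemma doubletonsI: "i \<in> F \<Longrightarrow> j \<in> F \<Longrightarrow> i \<noteq> j \<Longrightarrow> {i, j} \<in> doubletons F"
  by (simp add: doubletons_def)

lemma doubletonsE:
  assumes "p \<in> doubletons F"
  obtains i j where "i \<in> F" "j \<in> F" "i \<noteq> j" "p = {i, j}"
  using assms unfolding doubletons_def card_2_iff by blast

text \<open>Three distinct pairs that meet pairwise may also form a star; taking the symmetric
  difference as third side excludes this.\<close>

definition triangle :: "'a set \<Rightarrow> 'a set \<Rightarrow> 'a set \<Rightarrow> bool" where
  "triangle p q r \<longleftrightarrow> p \<noteq> q \<and> p \<inter> q \<noteq> {} \<and> r = (p \<union> q) - (p \<inter> q)"

lemma triangleE: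
  assumes "triangle p q r" "p \<in> doubletons F" "q \<in> doubletons F"
  obtains i j l where "i \<in> F" "j \<in> F" "l \<in> F" "i \<noteq> j" "i \<noteq> l" "j \<noteq> l"
    "p = {i, j}" "q = {i, l}" "r = {j, l}"
proof -
  obtain x y where p: "x \<in> F" "y \<in> F" "x \<noteq> y" "p = {x, y}" using assms(2) by (rule doubletonsE)
  obtain z w where q: "z \<in> F" "w \<in> F" "z \<noteq> w" "q = {z, w}" using assms(3) by (rule doubletonsE)
  obtain i where i: "i \<in> p" "i \<in> q" using assms(1) by (auto simp: triangle_def)
  obtain j where j: "p = {i, j}" "i \<noteq> j" "j \<in> F" using p i by blast
  obtain l where l: "q = {i, l}" "i \<noteq> l" "l \<in> F" using q i by blast
  have "j \<noteq> l" using assms(1) j l by (auto simp: triangle_def)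
  moreover have "r = {j, l}" using assms(1) j l \<open>j \<noteq> l\<close> by (auto simp: triangle_def)
  ultimately show thesis using that[of i j l] i p j l by blast
qed

lemma triangleI: "i \<noteq> j \<Longrightarrow> i \<noteq> l \<Longrightarrow> j \<noteq> l \<Longrightarrow> triangle {i, j} {i, l} {j, l}"
  unfolding triangle_def by auto

text \<open>The line graph of a complete graph determines the points, provided that it is also known
  which cliques of three pairs are triangles.\<close>

lemma point_map_of_pair_map:
  assumes h: "bij_betw h (doubletons F) (doubletons F')"
    and tri: "\<And>p q r. p \<in> doubletons F \<Longrightarrow> q \<in> doubletons F \<Longrightarrow> r \<in> doubletons F \<Longrightarrow>
      triangle p q r \<longleftrightarrow> triangle (h p) (h q) (h r)"
    and large: "infinite F \<or> 4 \<le> card F"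
  shows "\<exists>g. bij_betw g F F' \<and> (\<forall>i\<in>F. \<forall>j\<in>F. i \<noteq> j \<longrightarrow> h {i, j} = {g i, g j})"
proof -
  have other: "\<exists>a\<in>F. a \<notin> Z" if "finite Z" "card Z < 4" for Z
  proof (rule ccontr)
    assume "\<not> ?thesis"
    hence "F \<subseteq> Z" by blast
    thus False using that large card_mono[of Z F] finite_subset[of F Z] by linarith
  qed
  have hF: "h p \<in> doubletons F'" if "p \<in> doubletons F" for p
    using h that by (rule bij_betw_apply)
  \<comment> \<open>Two distinct pairs meet iff a third pair completes them to a triangle, so
    \<open>h\<close> preserves meeting.\<close>
  have meet: "h p \<inter> h q \<noteq> {} \<longleftrightarrow> p \<inter> q \<noteq> {}"
    if p: "p \<in> doubletons F" and q: "q \<in> doubletons F" and "p \<noteq> q" for p q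
  proof -
    have hpq: "h p \<noteq> h q" using h that by (metis bij_betw_inv_into_left)
    show ?thesis
    proof
      assume "h p \<inter> h q \<noteq> {}"
      with hpq have t: "triangle (h p) (h q) ((h p \<union> h q) - (h p \<inter> h q))" by (simp add: triangle_def)
      hence "(h p \<union> h q) - (h p \<inter> h q) \<in> doubletons F'"
        by (rule triangleE[OF _ hF[OF p] hF[OF q]]) (auto intro: doubletonsI)
      then obtain r where r: "r \<in> doubletons F" "h r = (h p \<union> h q) - (h p \<inter> h q)"
        using h by (metis bij_betw_iff_bijections)
      have "triangle p q r" using tri[OF p q r(1)] t r(2) by simp
      thus "p \<inter> q \<noteq> {}" by (simp add: triangle_def)
    next
      assume "p \<inter> q \<noteq> {}"
      with \<open>p \<noteq> q\<close> have t: "triangle p q ((p \<union> q) - (p \<inter> q))" by (simp add: triangle_def)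
      hence "(p \<union> q) - (p \<inter> q) \<in> doubletons F"
        by (rule triangleE[OF _ p q]) (auto intro: doubletonsI)
      from tri[OF p q this] t show "h p \<inter> h q \<noteq> {}" by (simp add: triangle_def)
    qed
  qed
  \<comment> \<open>Pairs through \<open>i\<close> go to pairs through one point \<open>t\<close>:
    an image avoiding \<open>t\<close> would join the other ends of two images through
    \<open>t\<close> and form a triangle with them, whereas three pairs through \<open>i\<close>
    form a star.\<close>
  have star: "\<exists>t. \<forall>x\<in>F - {i}. t \<in> h {i, x}" if i: "i \<in> F" for i
  proof -
    obtain a where a: "a \<in> F" "a \<noteq> i" using other[of "{i}"] by auto
    obtain b where b: "b \<in> F" "b \<noteq> i" "b \<noteq> a" using other[of "{i, a}"] a by auto
    have P: "{i, a} \<in> doubletons F" "{i, b} \<in> doubletons F" "{i, a} \<noteq> {i, b}"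
      using i a b by (auto intro: doubletonsI simp: doubleton_eq_iff)
    obtain t where t: "t \<in> h {i, a}" "t \<in> h {i, b}" using meet[OF P] by blast
    have "t \<in> h {i, c}" if c: "c \<in> F" "c \<noteq> i" for c
    proof (cases "c = a \<or> c = b")
      case False
      have R: "{i, c} \<in> doubletons F" using i c by (auto intro: doubletonsI)
      have ne: "{i, a} \<noteq> {i, c}" "{i, b} \<noteq> {i, c}" using False by (auto simp: doubleton_eq_iff)
      have hne: "h {i, a} \<noteq> h {i, b}" using h P by (metis bij_betw_inv_into_left)
      show ?thesis
      proof (rule ccontr)
        assume nt: "t \<notin> h {i, c}"
        obtain x where x: "h {i, a} = {t, x}" "x \<noteq> t" using hF[OF P(1)] t(1) by (elim doubletonsE) (auto simp: insert_commute)
        obtain y where y: "h {i, b} = {t, y}" "y \<noteq> t" using hF[OF P(2)] t(2) by (elim doubletonsE) (auto simp: insert_commute)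
        have "x \<noteq> y" using hne x y by auto
        have "x \<in> h {i, c}" using meet[OF P(1) R ne(1)] x nt by auto
        moreover have "y \<in> h {i, c}" using meet[OF P(2) R ne(2)] y nt by auto
        ultimately have "h {i, c} = {x, y}" using hF[OF R] \<open>x \<noteq> y\<close> by (auto elim!: doubletonsE)
        hence "triangle (h {i, a}) (h {i, b}) (h {i, c})"
          using triangleI[of t x y] x y \<open>x \<noteq> y\<close> by simp
        hence "triangle {i, a} {i, b} {i, c}" using tri[OF P(1,2) R] by simp
        thus False unfolding triangle_def by blast
      qed
    qed (use t in auto)
    thus ?thesis by blast
  qed
  define g where "g i = (SOME t. \<forall>x\<in>F - {i}. t \<in> h {i, x})" for i
  have g: "g i \<in> h {i, x}" if "i \<in> F" "x \<in> F" "x \<noteq> i" for i x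
    using someI_ex[OF star[OF that(1)]] that unfolding g_def by blast
  \<comment> \<open>With two further points \<open>a\<close> and \<open>b\<close>, the pairs
    \<open>{i, a}\<close> and \<open>{j, b}\<close> are disjoint while their images would share
    \<open>g i\<close>; this takes four points.\<close>
  have g_inj: "g i \<noteq> g j" if ij: "i \<in> F" "j \<in> F" "i \<noteq> j" for i j
  proof
    assume eq: "g i = g j"
    obtain a where a: "a \<in> F" "a \<noteq> i" "a \<noteq> j"
      using other[of "{i, j}"] ij(3) by auto
    obtain b where b: "b \<in> F" "b \<noteq> i" "b \<noteq> j" "b \<noteq> a"
      using other[of "{i, j, a}"] ij(3) a by auto
    have "{i, a} \<inter> {j, b} \<noteq> {}"
      using meet[of "{i, a}" "{j, b}"] ij a b g[of i a] g[of j b] eq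
      by (auto intro: doubletonsI simp: doubleton_eq_iff)
    thus False using ij a b by auto
  qed
  have hg: "h {i, j} = {g i, g j}" if ij: "i \<in> F" "j \<in> F" "i \<noteq> j" for i j
  proof -
    have "g i \<in> h {i, j}" "g j \<in> h {i, j}"
      using g[of i j] g[of j i] ij by (auto simp: insert_commute)
    thus ?thesis using hF[OF doubletonsI[OF ij]] g_inj[OF ij] by (auto elim!: doubletonsE)
  qed
  have "bij_betw g F F'"
  proof (rule bij_betw_imageI)
    show "inj_on g F" using g_inj by (meson inj_onI)
    show "g ` F = F'"
    proof
      show "g ` F \<subseteq> F'"
      proof
        fix t assume "t \<in> g ` F"
        then obtain i where i: "i \<in> F" "t = g i" by blast
        obtain a where a: "a \<in> F" "a \<noteq> i" using other[of "{i}"] by auto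
        have "t \<in> h {i, a}" using g[of i a] i a by simp
        moreover have "h {i, a} \<subseteq> F'"
          using hF[OF doubletonsI[of i F a]] i a by (auto simp: doubletons_def)
        ultimately show "t \<in> F'" by blast
      qed
      show "F' \<subseteq> g ` F"
      proof
        fix t assume t: "t \<in> F'"
        obtain i where i: "i \<in> F" using other[of "{}"] by auto
        obtain a where a: "a \<in> F" "a \<noteq> i" using other[of "{i}"] by auto
        obtain u where u: "u \<in> F'" "u \<noteq> t"
          using hF[OF doubletonsI[of i F a]] i a by (metis doubletonsE)
        obtain p where p: "p \<in> doubletons F" "h p = {t, u}"
          using h doubletonsI[OF t u(1)] u(2) by (metis bij_betw_iff_bijections)
        obtain x y where xy: "x \<in> F" "y \<in> F" "x \<noteq> y" "p = {x, y}" using p(1) by (rule doubletonsE)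
        have "t \<in> {g x, g y}" using hg[OF xy(1-3)] p(2) xy(4) by auto
        thus "t \<in> g ` F" using xy by auto
      qed
    qed
  qed
  thus ?thesis using hg by blast
qed

section \<open>The class in coordinates: operators as colourings\<close>

locale distinct_multiplicities =
  fixes a :: "nat \<Rightarrow> real" and k :: nat and C :: "('a::complex_inner \<Rightarrow> 'a) set"
  assumes C_eq: "C = {diag_op a k v |v. onseq k v}"
    and nonzero: "\<And>j. j < k \<Longrightarrow> a j \<noteq> 0"
    and k_pos: "0 < k"
    and multiplicities: "\<And>i j. i < k \<Longrightarrow> j < k \<Longrightarrow> a i \<noteq> a j \<Longrightarrow>
      card {l. l < k \<and> a l = a i} \<noteq> card {l. l < k \<and> a l = a j}"
    and dim: "enat (4 * k) \<le> ecdim (UNIV :: 'a set)"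
begin

abbreviation "T \<equiv> diag_op a k"

definition CF :: "'a set \<Rightarrow> ('a \<Rightarrow> 'a) set" where
  "CF F = {A \<in> C. diagonal A F}"

text \<open>For pairs \<open>p\<close> and \<open>k \<ge> 2\<close> these turn out to be the maximal
  subsets of \<open>CF F\<close> that commute with some operator of \<open>C\<close> outside
  \<open>CF F\<close>.\<close>

definition level :: "'a set \<Rightarrow> 'a set \<Rightarrow> ('a \<Rightarrow> 'a) set" where
  "level F p = {A \<in> CF F. \<forall>i\<in>p. \<forall>j\<in>p. ev A i = ev A j}"

lemma level_pair: "A \<in> level F {i, j} \<longleftrightarrow> A \<in> CF F \<and> ev A i = ev A j"
  unfolding level_def by auto

lemma T_in_C: "onseq k v \<Longrightarrow> T v \<in> C"
  using C_eq by blast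

lemma C_linear: "A \<in> C \<Longrightarrow> clinear A"
  and C_sym: "A \<in> C \<Longrightarrow> is_cadjoint A A"
  using C_eq diag_op_clinear diag_op_sym by auto

lemma C_finite_rank: "A \<in> C \<Longrightarrow> \<exists>B. finite B \<and> range A \<subseteq> cspan B"
proof -
  assume "A \<in> C"
  then obtain v where "A = T v" using C_eq by blast
  hence "range A \<subseteq> cspan (v ` {..<k})" using diag_op_in_span by blast
  thus ?thesis by (intro exI[of _ "v ` {..<k}"]) simp
qed

lemma CF_C: "A \<in> CF F \<Longrightarrow> A \<in> C"
  by (simp add: CF_def)

lemma CF_apply: "frame F \<Longrightarrow> A \<in> CF F \<Longrightarrow> e \<in> F \<Longrightarrow> A e = complex_of_real (ev A e) *\<^sub>C e"
  unfolding CF_def using diagonal_ev[OF C_sym _ frame_orthonormal, of A F e] by blast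

lemma CF_eqI:
  assumes "frame F" "A \<in> CF F" "B \<in> CF F" "\<And>e. e \<in> F \<Longrightarrow> ev A e = ev B e"
  shows "A = B"
proof (rule sym_op_eqI[OF assms(1)])
  show "is_cadjoint A A" "is_cadjoint B B" using C_sym CF_C assms(2,3) by blast+
  show "A e = B e" if "e \<in> F" for e
    using CF_apply[OF assms(1,2) that] CF_apply[OF assms(1,3) that] assms(4)[OF that] by simp
qed

lemma T_in_CF: "frame F \<Longrightarrow> placement k v F \<Longrightarrow> T v \<in> CF F"
proof -
  assume F: "frame F" and v: "placement k v F"
  have on: "onseq k v" by (rule placement_onseq[OF frame_orthonormal[OF F] v])
  have "v ` {..<k} \<subseteq> F" using v by (simp add: placement_def)
  from diag_op_diagonal[OF on frame_orthonormal[OF F] this] T_in_C[OF on]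
  show ?thesis by (simp add: CF_def)
qed

lemma frame_norm: "frame F \<Longrightarrow> e \<in> F \<Longrightarrow> norm e = 1"
  by (rule orthonormal_norm[OF frame_orthonormal])

lemma ev_T_index:
  assumes "frame F" "placement k v F" "j < k"
  shows "ev (T v) (v j) = a j"
  using diag_op_apply[OF placement_onseq[OF frame_orthonormal[OF assms(1)] assms(2)] assms(3)]
    frame_norm[OF assms(1)] assms by (intro ev_eq) (auto simp: placement_def)

lemma ev_T_outside:
  assumes "frame F" "placement k v F" "e \<in> F" "e \<notin> v ` {..<k}"
  shows "ev (T v) e = 0"
proof -
  have "cinner e (v j) = 0" if "j < k" for j
  proof -
    have "v j \<in> F" "e \<noteq> v j" using assms that by (auto simp: placement_def)
    thus ?thesis using orthonormalD[OF frame_orthonormal[OF assms(1)] assms(3)] by simp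
  qed
  hence "T v e = 0" by (rule diag_op_perp)
  thus ?thesis by (simp add: ev_def)
qed

lemma ev_T_class:
  assumes "frame F" "placement k v F" "\<alpha> \<noteq> 0"
  shows "{e \<in> F. ev (T v) e = \<alpha>} = v ` {j. j < k \<and> a j = \<alpha>}"
proof (intro equalityI subsetI)
  fix e assume e: "e \<in> {e \<in> F. ev (T v) e = \<alpha>}"
  hence "e \<in> v ` {..<k}" using ev_T_outside[OF assms(1,2)] assms(3) by auto
  thus "e \<in> v ` {j. j < k \<and> a j = \<alpha>}" using e ev_T_index[OF assms(1,2)] by auto
next
  fix e assume "e \<in> v ` {j. j < k \<and> a j = \<alpha>}"
  thus "e \<in> {e \<in> F. ev (T v) e = \<alpha>}"
    using assms(2) ev_T_index[OF assms(1,2)] by (auto simp: placement_def)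
qed

lemma ev_T_zero_class:
  assumes "frame F" "placement k v F"
  shows "{e \<in> F. ev (T v) e = 0} = F - v ` {..<k}"
  using ev_T_index[OF assms] ev_T_outside[OF assms] nonzero by auto

text \<open>The sequence \<open>u\<close> given by membership in \<open>C\<close> need not lie in
  \<open>F\<close>, as repeated eigenvalues leave freedom inside eigenspaces. But \<open>F\<close>
  contains a basis of each nonzero eigenspace, of the right size, and the bijections
  \<open>b \<alpha>\<close> are glued to \<open>v\<close>.\<close>

lemma CF_placement:
  assumes F: "frame F" and A: "A \<in> CF F"
  obtains v where "placement k v F" "A = T v"
proof -
  obtain u where u: "onseq k u" "A = T u" using CF_C[OF A] C_eq by blast
  have dA: "diagonal A F" using A by (simp add: CF_def)
  define J where "J \<alpha> = {j. j < k \<and> a j = \<alpha>}" for \<alpha>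
  define E where "E \<alpha> = {e \<in> F. A e = complex_of_real \<alpha> *\<^sub>C e}" for \<alpha>
  have "\<exists>b. bij_betw b (J \<alpha>) (E \<alpha>)" if "\<alpha> \<noteq> 0" for \<alpha>
  proof -
    obtain B where B: "finite B" "range A \<subseteq> cspan B" using C_finite_rank[OF CF_C[OF A]] by blast
    have \<alpha>: "complex_of_real \<alpha> \<noteq> 0" using that by simp
    note E = eigenspace_frame[OF C_linear[OF CF_C[OF A]] C_sym[OF CF_C[OF A]] B F dA \<alpha>, folded E_def]
    have sp: "cspan (E \<alpha>) = cspan (u ` J \<alpha>)"
      using E(2) diag_op_eigenspace[OF u(1) that, of a] by (simp add: u(2) J_def)
    have "\<not> complex_vector.dependent (E \<alpha>)"
      using orthonormal_subset[OF frame_orthonormal[OF F]]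
      by (intro orthonormal_independent) (auto simp: E_def)
    hence "card (E \<alpha>) = cdim (cspan (E \<alpha>))"
      by (simp add: complex_vector.dim_eq_card_independent)
    moreover have Jk: "J \<alpha> \<subseteq> {..<k}" by (auto simp: J_def)
    ultimately have "enat (card (E \<alpha>)) = enat (card (J \<alpha>))"
      using ecdim_span_onseq[OF u(1) Jk] sp E(1) by (auto simp: ecdim_def split: if_splits)
    moreover have "finite (J \<alpha>)" using finite_subset[OF Jk] by simp
    ultimately show ?thesis using E(1) by (intro finite_same_card_bij) auto
  qed
  then obtain b where b: "\<And>\<alpha>. \<alpha> \<noteq> 0 \<Longrightarrow> bij_betw (b \<alpha>) (J \<alpha>) (E \<alpha>)" by metis
  define v where "v j = b (a j) j" for j
  have vE: "v j \<in> E (a j)" if "j < k" for j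
    unfolding v_def using that by (intro bij_betw_apply[OF b[OF nonzero[OF that]]]) (simp add: J_def)
  hence vA: "v j \<in> F" "A (v j) = complex_of_real (a j) *\<^sub>C v j" if "j < k" for j
    using that by (auto simp: E_def)
  have pv: "placement k v F"
  proof -
    have "inj_on v {..<k}"
    proof (rule inj_onI)
      fix i j assume ij: "i \<in> {..<k}" "j \<in> {..<k}" "v i = v j"
      have "v i \<noteq> 0" using frame_norm[OF F vA(1)] ij(1) by force
      hence eq: "a i = a j" using vA(2)[of i] vA(2)[of j] ij by simp
      have "b (a i) i = b (a i) j" using ij(3) eq by (simp add: v_def)
      moreover have "i \<in> J (a i)" "j \<in> J (a i)" using ij eq by (auto simp: J_def)
      ultimately show "i = j" using b[of "a i"] nonzero[of i] ij(1) by (auto simp: bij_betw_def inj_on_def)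
    qed
    thus ?thesis using vA(1) by (auto simp: placement_def)
  qed
  have "A = T v"
  proof (rule CF_eqI[OF F A T_in_CF[OF F pv]])
    fix e assume e: "e \<in> F"
    show "ev A e = ev (T v) e"
    proof (cases "e \<in> v ` {..<k}")
      case True
      then obtain j where j: "j < k" "e = v j" by blast
      have "ev A e = a j" using vA[OF j(1)] j frame_norm[OF F] by (intro ev_eq) auto
      thus ?thesis using ev_T_index[OF F pv j(1)] j by simp
    next
      case False
      have "ev A e = 0"
      proof (rule ccontr)
        assume nz: "ev A e \<noteq> 0"
        have eE: "e \<in> E (ev A e)" using e CF_apply[OF F A e] by (simp add: E_def)
        then obtain j where j: "j \<in> J (ev A e)" "b (ev A e) j = e"
          using bij_betw_imp_surj_on[OF b[OF nz]] by (metis imageE)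
        hence "j < k" "v j = e" by (auto simp: J_def v_def)
        thus False using False by blast
      qed
      thus ?thesis using ev_T_outside[OF F pv e False] by simp
    qed
  qed
  with pv show thesis by (rule that)
qed

lemma frame_large:
  fixes F :: "'a set"
  assumes "frame F" "finite F"
  shows "4 * k \<le> card F"
proof (rule ccontr)
  assume "\<not> ?thesis"
  then obtain x :: 'a where "x \<noteq> 0" "\<forall>s\<in>F. cinner x s = 0"
    using exists_perp[OF assms(2) dim] by auto
  thus False using frame_zero[OF assms(1)] by blast
qed

lemma frame_choose:
  fixes F :: "'a set"
  assumes "frame F" "finite Z" "card Z + n \<le> 4 * k"
  obtains v where "placement n v (F - Z)"
proof -
  have "\<exists>S. S \<subseteq> F - Z \<and> finite S \<and> card S = n"
  proof (cases "finite F")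
    case True
    have "card F - card Z \<le> card (F - Z)" using assms(2) by (rule diff_card_le_card_Diff)
    hence "n \<le> card (F - Z)" using frame_large[OF assms(1) True] assms(3) by linarith
    then obtain S where "S \<subseteq> F - Z" "card S = n" "finite S" by (rule obtain_subset_with_card_n)
    thus ?thesis by blast
  next
    case False
    hence "infinite (F - Z)" using assms(2) by simp
    thus ?thesis using infinite_arbitrarily_large by blast
  qed
  then obtain S where S: "S \<subseteq> F - Z" "finite S" "card S = n" by blast
  then obtain v where "bij_betw v {..<n} S"
    using ex_bij_betw_nat_finite by (metis atLeast0LessThan)
  hence "placement n v (F - Z)" using S(1) by (auto simp: placement_def bij_betw_def)
  thus thesis by (rule that)
qed

lemma colour_one:
  assumes F: "frame F" and x: "x \<in> F" "x \<notin> Z" and Z: "Z \<subseteq> F" "finite Z" "card Z + 1 + k \<le> 4 * k"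
  shows "\<exists>A\<in>CF F. ev A x \<noteq> 0 \<and> (\<forall>z\<in>Z. ev A z = 0)"
proof -
  obtain v where v: "placement k v (F - insert x Z)"
    using frame_choose[OF F, of "insert x Z" k] Z x by auto
  let ?v = "v(0 := x)"
  have p: "placement k ?v F"
    using v x(1) unfolding placement_def by (auto intro!: inj_on_fun_updI)
  have "ev (T ?v) x \<noteq> 0" using ev_T_index[OF F p k_pos] nonzero[OF k_pos] by simp
  moreover have "ev (T ?v) z = 0" if "z \<in> Z" for z
    using v x that Z by (intro ev_T_outside[OF F p]) (auto simp: placement_def)
  ultimately show ?thesis using T_in_CF[OF F p] by blast
qed

section \<open>Sets of operators that do not determine their frame\<close>

lemma CF_separates:
  assumes "frame F" "e \<in> F" "e' \<in> F" "e \<noteq> e'"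
  shows "\<exists>A\<in>CF F. ev A e \<noteq> ev A e'"
  using colour_one[OF assms(1,2), of "{e'}"] assms k_pos by force

text \<open>\<open>B\<close> preserves the eigenspaces of each \<open>A\<close>, so
  \<open>B e\<close> is orthogonal to every frame vector that some \<open>A\<close> separates from
  \<open>e\<close>. If all others are separated, only the direction of \<open>e\<close> is
  left.\<close>

lemma commutant_of_separating:
  assumes F: "frame F" and S: "S \<subseteq> CF F"
    and sep: "\<And>e e'. e \<in> F \<Longrightarrow> e' \<in> F \<Longrightarrow> e \<noteq> e' \<Longrightarrow> \<exists>A\<in>S. ev A e \<noteq> ev A e'"
    and B: "B \<in> C" "\<And>A. A \<in> S \<Longrightarrow> A \<circ> B = B \<circ> A"
  shows "B \<in> CF F"
proof -
  have "\<exists>r. B e = r *\<^sub>C e" if e: "e \<in> F" for e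
  proof -
    have perp: "cinner (B e) e' = 0" if e': "e' \<in> F" "e' \<noteq> e" for e'
    proof -
      obtain A where A: "A \<in> S" "ev A e \<noteq> ev A e'" using sep[OF e e'(1)] e'(2) by blast
      hence AF: "A \<in> CF F" using S by blast
      have "A (B e) = B (A e)" using B(2)[OF A(1)] by (metis comp_apply)
      also have "\<dots> = complex_of_real (ev A e) *\<^sub>C B e"
        by (subst CF_apply[OF F AF e]) (rule clinear_scaleC[OF C_linear[OF B(1)]])
      finally have "A (B e) = complex_of_real (ev A e) *\<^sub>C B e" .
      thus ?thesis
        using sym_eigenvectors_perp[OF C_sym[OF CF_C[OF AF]] _ CF_apply[OF F AF e'(1)]] A(2) by force
    qed
    have "B e - cinner (B e) e *\<^sub>C e = 0"
    proof (rule frame_zero[OF F])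
      fix e' assume e': "e' \<in> F"
      show "cinner (B e - cinner (B e) e *\<^sub>C e) e' = 0"
        using perp[OF e'] orthonormalD[OF frame_orthonormal[OF F] e e']
        by (cases "e' = e") (auto simp: cinner_simps)
    qed
    thus ?thesis by auto
  qed
  thus ?thesis using B(1) by (simp add: CF_def diagonal_def)
qed

text \<open>The witness has the unit vector along \<open>e + e'\<close> as eigenvector for
  \<open>a 0\<close>, which is not 0, and its other vectors in \<open>F\<close> away from the pair.
  Each \<open>A\<close> of the level is scalar on the span of the pair, hence commutes with it; yet
  the witness sends \<open>e\<close> to a vector with a component along \<open>e'\<close>.\<close>

lemma level_inexact:
  assumes F: "frame F" and e: "e \<in> F" "e' \<in> F" "e \<noteq> e'"
  shows "\<exists>B\<in>C - CF F. \<forall>A\<in>level F {e, e'}. A \<circ> B = B \<circ> A"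
proof -
  have "card {e, e'} + k \<le> 4 * k" using k_pos e(3) by simp
  then obtain v where v: "placement k v (F - {e, e'})"
    using frame_choose[OF F, of "{e, e'}" k] by auto
  note on = orthonormalD[OF frame_orthonormal[OF F]]
  define x where "x = unit_vec (e + e')"
  have ee': "cinner e e' = 0" "cinner e' e = 0" "cinner e e = 1" "cinner e' e' = 1"
    using on e by auto
  hence "cinner e (e + e') = 1" by (simp add: cinner_simps)
  hence "e + e' \<noteq> 0" by (metis cinner_zero_right zero_neq_one)
  hence nx: "norm x = 1" by (simp add: x_def)
  have perp_v: "cinner y (v j) = 0" if "j < k" "y \<in> {e, e'}" for y j
  proof -
    have "v j \<in> F" "y \<noteq> v j" "y \<in> F" using v that e by (auto simp: placement_def)
    thus ?thesis using on[of y "v j"] by simp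
  qed
  hence xv: "cinner x (v j) = 0" if "j < k" for j
    using that by (simp add: x_def cinner_add_left)
  hence vx: "cinner (v j) x = 0" if "j < k" for j using that by (subst cinner_eq_0_commute) blast
  have "onseq k v"
    using v orthonormal_subset[OF frame_orthonormal[OF F], of "v ` {..<k}"]
    by (auto simp: onseq_iff placement_def)
  hence w: "onseq k (v(0 := x))"
    using xv vx nx by (auto simp: onseq_def cinner_self_eq_1)
  let ?B = "T (v(0 := x))"
  have "A \<circ> ?B = ?B \<circ> A" if A: "A \<in> level F {e, e'}" for A
  proof (rule diag_op_commute)
    have AF: "A \<in> CF F" and eq: "ev A e = ev A e'" using A by (simp_all add: level_pair)
    show lin: "clinear A" and "is_cadjoint A A" using C_linear[OF CF_C[OF AF]] C_sym[OF CF_C[OF AF]] by blast+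
    fix j assume j: "j < k"
    show "\<exists>r. A ((v(0 := x)) j) = r *\<^sub>C (v(0 := x)) j"
    proof (cases "j = 0")
      case True
      have "A x = complex_of_real (ev A e) *\<^sub>C x"
        unfolding x_def unit_vec_def clinear_scaleC[OF lin] clinear_add[OF lin]
        by (subst CF_apply[OF F AF e(1)], subst CF_apply[OF F AF e(2)])
          (simp add: eq scaleC_add_right mult.commute)
      thus ?thesis using True by auto
    next
      case False
      thus ?thesis using CF_apply[OF F AF, of "v j"] v j by (auto simp: placement_def)
    qed
  qed
  moreover have "?B \<notin> CF F"
  proof
    assume "?B \<in> CF F"
    from CF_apply[OF F this e(1)] have "cinner (?B e) e' = 0" using ee' by (simp add: cinner_simps)
    moreover have "?B e = (complex_of_real (a 0) * cinner e x) *\<^sub>C x"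
    proof -
      have "?B e = (\<Sum>j<k. if j = 0 then (complex_of_real (a 0) * cinner e x) *\<^sub>C x else 0)"
        unfolding diag_op_def by (rule sum.cong) (use perp_v in auto)
      thus ?thesis using k_pos by simp
    qed
    moreover have "cinner e x \<noteq> 0" "cinner x e' \<noteq> 0" using ee' by (simp_all add: x_def cinner_simps)
    ultimately show False using nonzero[OF k_pos] by (simp add: cinner_simps)
  qed
  ultimately show ?thesis using T_in_C[OF w] by blast
qed

text \<open>The bridge to \<open>f\<close>: the left-hand side is expressed by commutation, the
  right-hand side by colours. A set with no common pair separates the points of \<open>F\<close> and
  so leaves no such \<open>B\<close>.\<close>

lemma inexact_iff:
  assumes F: "frame F" and S: "S \<subseteq> CF F"
  shows "(\<exists>B\<in>C - CF F. \<forall>A\<in>S. A \<circ> B = B \<circ> A) \<longleftrightarrow> (\<exists>p\<in>doubletons F. S \<subseteq> level F p)"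
proof
  assume "\<exists>B\<in>C - CF F. \<forall>A\<in>S. A \<circ> B = B \<circ> A"
  then obtain B where B: "B \<in> C" "B \<notin> CF F" "\<And>A. A \<in> S \<Longrightarrow> A \<circ> B = B \<circ> A" by blast
  then obtain e e' where e: "e \<in> F" "e' \<in> F" "e \<noteq> e'" "\<And>A. A \<in> S \<Longrightarrow> ev A e = ev A e'"
    using commutant_of_separating[OF F S _ B(1)] by blast
  have "S \<subseteq> level F {e, e'}" using S e(4) by (auto simp: level_pair)
  thus "\<exists>p\<in>doubletons F. S \<subseteq> level F p" using doubletonsI[OF e(1-3)] by blast
next
  assume "\<exists>p\<in>doubletons F. S \<subseteq> level F p"
  then obtain e e' where e: "e \<in> F" "e' \<in> F" "e \<noteq> e'" "S \<subseteq> level F {e, e'}"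
    by (metis doubletonsE)
  show "\<exists>B\<in>C - CF F. \<forall>A\<in>S. A \<circ> B = B \<circ> A" using level_inexact[OF F e(1-3)] e(4) by blast
qed

text \<open>A point of \<open>q\<close> outside \<open>p\<close> can be given a nonzero colour while
  \<open>p\<close> and the other point of \<open>q\<close> get 0. For \<open>k \<ge> 2\<close> there
  is room, since \<open>3 + 1 + k \<le> 4 * k\<close>.\<close>

lemma level_incomparable:
  assumes F: "frame F" and "2 \<le> k" and p: "p \<in> doubletons F" and q: "q \<in> doubletons F"
    and sub: "level F p \<subseteq> level F q"
  shows "p = q"
proof -
  have "s \<in> p" if q: "q = {s, t}" "s \<in> F" "t \<in> F" "s \<noteq> t" for s t
  proof (rule ccontr)
    assume s: "s \<notin> p"
    have p': "finite p" "card p = 2" "p \<subseteq> F" using p card.infinite by (force simp: doubletons_def)+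
    hence "card (insert t p) \<le> 3" by (simp add: card_insert_if)
    then obtain A where A: "A \<in> CF F" "ev A s \<noteq> 0" "\<forall>z\<in>insert t p. ev A z = 0"
      using colour_one[OF F q(2), of "insert t p"] q s p' \<open>2 \<le> k\<close> by auto
    hence "A \<in> level F p" by (simp add: level_def)
    hence "A \<in> level F q" using sub by blast
    thus False using A by (simp add: q level_pair)
  qed
  moreover obtain s t where "s \<in> F" "t \<in> F" "s \<noteq> t" "q = {s, t}" using q by (rule doubletonsE)
  ultimately have "q \<subseteq> p" by (metis doubleton_eq_iff insert_subset empty_subsetI)
  moreover have "card q = card p" "finite p" using p q card.infinite by (force simp: doubletons_def)+
  ultimately show ?thesis using card_subset_eq by metis
qed

text \<open>If all values were distinct, every multiplicity would be one, against
  \<open>multiplicities\<close> for the indices 0 and 1.\<close>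

lemma repeated_value:
  assumes "2 \<le> k"
  obtains i j where "i < k" "j < k" "i \<noteq> j" "a i = a j"
proof (rule ccontr)
  assume *: "\<not> thesis"
  hence no: "a i \<noteq> a j" if "i < k" "j < k" "i \<noteq> j" for i j
    using \<open>\<And>j i. \<lbrakk>i < k; j < k; i \<noteq> j; a i = a j\<rbrakk> \<Longrightarrow> thesis\<close> * that by blast
  have "l = i" if "l < k" "a l = a i" "i < k" for l i using no[of l i] that by blast
  hence "{l. l < k \<and> a l = a 0} = {0}" "{l. l < k \<and> a l = a 1} = {1}" using assms by force+
  thus False using multiplicities[of 0 1] no[of 0 1] assms by simp
qed

text \<open>For a triangle the inclusion is transitivity of equality. Conversely, a point of
  \<open>r\<close> outside \<open>p\<close> and \<open>q\<close> could be coloured alone; and if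
  \<open>p\<close> and \<open>q\<close> were disjoint, a repeated nonzero value on \<open>p\<close>
  and 0 on \<open>q\<close> would separate the ends of \<open>r\<close>.\<close>

lemma triangle_iff_level:
  assumes F: "frame F" and k: "2 \<le> k"
    and p: "p \<in> doubletons F" and q: "q \<in> doubletons F" and r: "r \<in> doubletons F"
  shows "triangle p q r \<longleftrightarrow>
    p \<noteq> q \<and> r \<noteq> p \<and> r \<noteq> q \<and> level F p \<inter> level F q \<subseteq> level F r"
proof
  assume t: "triangle p q r"
  obtain i j l where "i \<in> F" "j \<in> F" "l \<in> F" and
    ijl: "i \<noteq> j" "i \<noteq> l" "j \<noteq> l" "p = {i, j}" "q = {i, l}" "r = {j, l}"
    by (rule triangleE[OF t p q])
  have "i \<notin> r" "l \<notin> p" "j \<notin> q" using ijl by simp_all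
  hence "p \<noteq> q \<and> r \<noteq> p \<and> r \<noteq> q" using ijl by blast
  moreover have "level F p \<inter> level F q \<subseteq> level F r"
    unfolding ijl by (auto simp: level_pair)
  ultimately show "p \<noteq> q \<and> r \<noteq> p \<and> r \<noteq> q \<and> level F p \<inter> level F q \<subseteq> level F r" by blast
next
  assume as: "p \<noteq> q \<and> r \<noteq> p \<and> r \<noteq> q \<and> level F p \<inter> level F q \<subseteq> level F r"
  obtain x y where xy: "x \<in> F" "y \<in> F" "x \<noteq> y" "p = {x, y}" using p by (rule doubletonsE)
  obtain z w where zw: "z \<in> F" "w \<in> F" "z \<noteq> w" "q = {z, w}" using q by (rule doubletonsE)
  obtain s t where st: "s \<in> F" "t \<in> F" "s \<noteq> t" "r = {s, t}" using r by (rule doubletonsE)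
  have card4: "card {x, y, z, w} \<le> 4" by (simp add: card_insert_if)
  have card5: "card {c, x, y, z, w} \<le> 5" for c using card4 by (simp add: card_insert_if)
  have inside: "c \<in> p \<union> q" if c: "c \<in> F" "d \<in> F" "c \<noteq> d" "r = {c, d}" for c d
  proof (rule ccontr)
    assume no: "c \<notin> p \<union> q"
    have "card {d, x, y, z, w} + 1 + k \<le> 4 * k" using card5[of d] k by linarith
    then obtain A where A: "A \<in> CF F" "ev A c \<noteq> 0" "\<forall>z\<in>{d, x, y, z, w}. ev A z = 0"
      using colour_one[OF F c(1), of "{d, x, y, z, w}"] no c xy zw by auto
    hence "A \<in> level F p \<inter> level F q" using xy zw by (simp add: level_pair)
    hence "A \<in> level F r" using as by blast
    thus False using A c by (simp add: level_pair)
  qed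
  have sub: "r \<subseteq> p \<union> q" using inside[OF st] inside[of t s] st by (auto simp: insert_commute)
  have "p \<inter> q \<noteq> {}"
  proof
    assume disj: "p \<inter> q = {}"
    obtain i j where ij: "i < k" "j < k" "i \<noteq> j" "a i = a j" using repeated_value[OF k] by metis
    obtain v where v: "placement k v (F - {x, y, z, w})"
      using frame_choose[OF F, of "{x, y, z, w}" k] card4 k by auto
    let ?v = "v(i := x, j := y)"
    have pl: "placement k ?v F"
    proof -
      have inj: "inj_on (v(i := x)) {..<k}" and im: "(v(i := x)) ` {..<k} \<subseteq> F - {y}"
        using v xy unfolding placement_def by (auto intro: inj_on_fun_updI)
      from im have "y \<notin> (v(i := x)) ` {..<k}" by blast
      with inj have "inj_on ?v {..<k}" by (rule inj_on_fun_updI)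
      moreover have "?v ` {..<k} \<subseteq> F"
        using im xy(2) by (simp add: image_subset_iff)
      ultimately show ?thesis unfolding placement_def by blast
    qed
    have "ev (T ?v) x = a i" "ev (T ?v) y = a i"
      using ev_T_index[OF F pl ij(1)] ev_T_index[OF F pl ij(2)] ij by simp_all
    moreover have zwv: "ev (T ?v) c = 0" if "c \<in> {z, w}" for c
    proof (rule ev_T_outside[OF F pl])
      show "c \<in> F" using that zw by blast
      have "c \<noteq> x" "c \<noteq> y" using disj that xy zw by auto
      thus "c \<notin> ?v ` {..<k}" using v that by (auto simp: placement_def)
    qed
    moreover have "T ?v \<in> CF F" by (rule T_in_CF[OF F pl])
    ultimately have "T ?v \<in> level F p \<inter> level F q" using xy zw by (simp add: level_pair)
    hence "T ?v \<in> level F r" using as by blast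
    hence "ev (T ?v) s = ev (T ?v) t" using st by (simp add: level_pair)
    \<comment> \<open>Being contained in the union but different from \<open>p\<close> and
      \<open>q\<close>, the pair \<open>r\<close> has one point in each.\<close>
    moreover have "s \<in> p \<and> t \<in> q \<or> s \<in> q \<and> t \<in> p"
      using sub as st xy zw by (auto simp: doubleton_eq_iff)
    ultimately show False
      using \<open>ev (T ?v) x = a i\<close> \<open>ev (T ?v) y = a i\<close> zwv nonzero[OF ij(1)] xy zw by auto
  qed
  moreover have "r = (p \<union> q) - (p \<inter> q)"
  proof -
    from \<open>p \<inter> q \<noteq> {}\<close> obtain c where c: "c \<in> p" "c \<in> q" by blast
    obtain m n where mn: "p = {c, m}" "q = {c, n}" "c \<noteq> m" "c \<noteq> n" using c xy zw by blast
    have "m \<noteq> n" using mn as by auto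
    have "r = {m, n}" using sub as st mn by (auto simp: doubleton_eq_iff)
    thus ?thesis using mn \<open>m \<noteq> n\<close> by auto
  qed
  ultimately show "triangle p q r" using as by (simp add: triangle_def)
qed

end

section \<open>Bijections preserving commutativity\<close>

lemma orthonormal_Un:
  assumes "orthonormal A" "orthonormal B"
    "\<And>x y. x \<in> A \<Longrightarrow> y \<in> B \<Longrightarrow> cinner x y = (if x = y then 1 else 0)"
  shows "orthonormal (A \<union> B)"
  unfolding orthonormal_def
proof (intro ballI)
  fix x y assume "x \<in> A \<union> B" "y \<in> A \<union> B"
  then consider "x \<in> A" "y \<in> A" | "x \<in> B" "y \<in> B" | "x \<in> A" "y \<in> B" | "x \<in> B" "y \<in> A" by blast
  thus "cinner x y = (if x = y then 1 else 0)"
  proof cases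
    case 4
    thus ?thesis using assms(3)[of y x] cinner_commute[of x y] by (auto split: if_splits)
  qed (use assms in \<open>simp_all add: orthonormalD\<close>)
qed

lemma span_Int_orthonormal:
  assumes "finite S" "orthonormal (S \<union> U)"
  shows "cspan S \<inter> cspan U = cspan (S \<inter> U)"
proof
  show "cspan (S \<inter> U) \<subseteq> cspan S \<inter> cspan U" by (simp add: complex_vector.span_mono)
  show "cspan S \<inter> cspan U \<subseteq> cspan (S \<inter> U)"
  proof
    fix x assume x: "x \<in> cspan S \<inter> cspan U"
    have onS: "orthonormal S" using assms(2) by (rule orthonormal_subset) simp
    have perp: "cinner x s = 0" if "s \<in> S - U" for s
      by (rule perp_span_left[of x U]) (use x that orthonormalD[OF assms(2)] in auto)
    have "x = proj S x" using proj_eq[OF assms(1) onS] x by simp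
    also have "\<dots> = (\<Sum>s\<in>S \<inter> U. cinner x s *\<^sub>C s)"
      unfolding proj_def using assms(1) perp by (intro sum.mono_neutral_right) auto
    also have "\<dots> \<in> cspan (S \<inter> U)"
      by (intro complex_vector.span_sum complex_vector.span_scale complex_vector.span_base)
    finally show "x \<in> cspan (S \<inter> U)" .
  qed
qed

lemma span_singleton_eqD:
  assumes "cspan {x} = cspan {y}" "norm x = 1" "norm (y::'a::complex_inner) = 1"
  shows "\<exists>c. cmod c = 1 \<and> x = c *\<^sub>C y"
proof -
  have "x \<in> cspan {y}" using assms(1) complex_vector.span_base[of x "{x}"] by simp
  then obtain c where c: "x = c *\<^sub>C y" by (auto simp: complex_vector.span_singleton)
  hence "cmod c = 1" using assms(2,3) by (simp add: norm_scaleC)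
  with c show ?thesis by blast
qed

text \<open>Two sequences that isolate the line of \<open>v 0\<close>: for \<open>k > 0\<close> and
  nonzero \<open>a j\<close> it is the intersection of the ranges of the two operators. The name
  refers to the graph on sequences with a given first vector, in which chains are formed.\<close>

definition edge :: "nat \<Rightarrow> (nat \<Rightarrow> 'a::complex_inner) \<Rightarrow> (nat \<Rightarrow> 'a) \<Rightarrow> bool" where
  "edge k v w \<longleftrightarrow> onseq k v \<and> onseq k w \<and> v 0 = w 0 \<and>
    (\<forall>i<k. \<forall>j<k. cinner (v i) (w j) = (if i = 0 \<and> j = 0 then 1 else 0))"

lemma edgeD:
  assumes "edge k v w"
  shows "onseq k v" "onseq k w" "v 0 = w 0"
  using assms by (simp_all add: edge_def)

lemma edge_sym: "edge k v w \<Longrightarrow> edge k w v"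
  unfolding edge_def
proof safe
  fix i j assume "\<forall>i<k. \<forall>j<k. cinner (v i) (w j) = (if i = 0 \<and> j = 0 then 1 else 0)" "i < k" "j < k"
  thus "cinner (w i) (v j) = (if i = 0 \<and> j = 0 then 1 else 0)"
    using cinner_commute[of "w i" "v j"] by auto
qed simp_all

lemma edge_cross:
  assumes e: "edge k v w" and x: "x \<in> v ` {..<k}" and y: "y \<in> w ` {..<k}"
  shows "cinner x y = (if x = y then 1 else 0)"
proof -
  obtain i j where ij: "i < k" "x = v i" "j < k" "y = w j" using x y by blast
  have xx: "cinner x x = 1" using e ij by (simp add: edge_def onseq_def)
  show ?thesis
  proof (cases "i = 0 \<and> j = 0")
    case True
    hence "x = y" using e ij by (simp add: edge_def)
    thus ?thesis using xx by simp
  next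
    case False
    hence "cinner x y = 0" using e ij by (simp add: edge_def)
    thus ?thesis using xx by auto
  qed
qed

lemma edge_orthonormal:
  assumes "edge k v w"
  shows "orthonormal (v ` {..<k} \<union> w ` {..<k})"
  using assms edge_cross[OF assms] by (intro orthonormal_Un) (auto simp: edge_def onseq_iff)

lemma edge_orthonormal3:
  assumes "edge k u v" "edge k v w" "edge k u w"
  shows "orthonormal (u ` {..<k} \<union> v ` {..<k} \<union> w ` {..<k})"
proof (rule orthonormal_Un[OF edge_orthonormal[OF assms(1)]])
  show "orthonormal (w ` {..<k})" using assms(2) by (simp add: edge_def onseq_iff)
  show "cinner x y = (if x = y then 1 else 0)"
    if "x \<in> u ` {..<k} \<union> v ` {..<k}" "y \<in> w ` {..<k}" for x y
    using that edge_cross[OF assms(2)] edge_cross[OF assms(3)] by blast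
qed

lemma edge_Int:
  assumes e: "edge k v w" and "0 < k"
  shows "v ` {..<k} \<inter> w ` {..<k} = {v 0}"
proof
  have "v 0 \<in> v ` {..<k}" "w 0 \<in> w ` {..<k}" using \<open>0 < k\<close> by blast+
  thus "{v 0} \<subseteq> v ` {..<k} \<inter> w ` {..<k}" using e by (simp add: edge_def)
  show "v ` {..<k} \<inter> w ` {..<k} \<subseteq> {v 0}"
  proof
    fix x assume "x \<in> v ` {..<k} \<inter> w ` {..<k}"
    then obtain i j where ij: "i < k" "x = v i" "j < k" "x = w j" by blast
    have "cinner (v i) (w j) = 1" using e ij by (simp add: edge_def onseq_def)
    hence "i = 0" using e ij(1,3) by (auto simp: edge_def split: if_splits)
    thus "x \<in> {v 0}" using ij by simp
  qed
qed

locale commutativity_preserver = distinct_multiplicities a k C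
  for a :: "nat \<Rightarrow> real" and k :: nat and C :: "('a::complex_inner \<Rightarrow> 'a) set" +
  fixes f :: "('a \<Rightarrow> 'a) \<Rightarrow> ('a \<Rightarrow> 'a)"
  assumes bij: "bij_betw f C C"
    and comm: "\<And>A B. A \<in> C \<Longrightarrow> B \<in> C \<Longrightarrow> A \<circ> B = B \<circ> A \<longleftrightarrow> f A \<circ> f B = f B \<circ> f A"
begin

section \<open>Images of frames, levels and points\<close>

lemma f_C: "A \<in> C \<Longrightarrow> f A \<in> C"
  using bij by (rule bij_betw_apply)

lemma f_inj: "inj_on f C"
  using bij by (rule bij_betw_imp_inj_on)

lemma f_eq_iff: "A \<in> C \<Longrightarrow> B \<in> C \<Longrightarrow> f A = f B \<longleftrightarrow> A = B"
  by (rule inj_on_eq_iff[OF f_inj])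

lemma inv_f: "A \<in> C \<Longrightarrow> inv_into C f (f A) = A"
  by (rule inv_into_f_f[OF f_inj])

lemma f_inv: "A \<in> C \<Longrightarrow> f (inv_into C f A) = A"
  using bij by (rule bij_betw_inv_into_right)

text \<open>The hypotheses are symmetric in \<open>f\<close> and its inverse, so inclusions proved
  for \<open>f\<close> become equalities when they are applied to both.\<close>

lemma inverse_preserver: "commutativity_preserver a k C (inv_into C f)"
proof
  show b: "bij_betw (inv_into C f) C C" using bij by (rule bij_betw_inv_into)
  fix A B assume AB: "A \<in> C" "B \<in> C"
  have "inv_into C f A \<in> C" "inv_into C f B \<in> C" using bij_betw_apply[OF b] AB by blast+
  from comm[OF this] show "A \<circ> B = B \<circ> A \<longleftrightarrow>
      inv_into C f A \<circ> inv_into C f B = inv_into C f B \<circ> inv_into C f A"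
    by (simp add: f_inv AB)
qed

lemma CF_commute:
  assumes F: "frame F" and A: "A \<in> CF F" and B: "B \<in> CF F"
  shows "A \<circ> B = B \<circ> A"
proof -
  obtain v where v: "placement k v F" "B = T v" using CF_placement[OF F B] .
  show ?thesis unfolding v(2)
  proof (rule diag_op_commute)
    fix j assume "j < k"
    hence "v j \<in> F" using v(1) by (auto simp: placement_def)
    thus "\<exists>r. A (v j) = r *\<^sub>C v j" using CF_apply[OF F A] by blast
  qed (use C_linear C_sym CF_C[OF A] in blast)+
qed

text \<open>The image of \<open>CF F\<close> commutes, hence is diagonal in some frame
  \<open>F'\<close>. It fills \<open>CF F'\<close>, because the preimage of a member commutes with
  all of \<open>CF F\<close>, which separates the points of \<open>F\<close>.\<close>

lemma frame_image:
  assumes F: "frame F"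
  shows "\<exists>F'. frame F' \<and> f ` CF F = CF F'"
proof -
  have sub: "f ` CF F \<subseteq> C" using f_C CF_C by blast
  have "\<exists>F'. frame F' \<and> {} \<subseteq> F' \<and> (\<forall>A\<in>f ` CF F. diagonal A F')"
  proof (rule simultaneous_diagonalisation)
    fix A B assume "A \<in> f ` CF F" "B \<in> f ` CF F"
    then obtain A' B' where AB: "A = f A'" "B = f B'" "A' \<in> CF F" "B' \<in> CF F" by blast
    show "A \<circ> B = B \<circ> A"
      using comm[OF CF_C[OF AB(3)] CF_C[OF AB(4)]] CF_commute[OF F AB(3,4)] AB(1,2) by simp
  next
    fix A assume "A \<in> f ` CF F"
    hence A: "A \<in> C" using sub by blast
    show "clinear A" "is_cadjoint A A" "\<exists>S. finite S \<and> range A \<subseteq> cspan S"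
      using C_linear[OF A] C_sym[OF A] C_finite_rank[OF A] by blast+
    show "diagonal A {}" by (simp add: diagonal_def)
  qed simp
  then obtain F' where F': "frame F'" "f ` CF F \<subseteq> CF F'" using sub unfolding CF_def by blast
  have "CF F' \<subseteq> f ` CF F"
  proof
    fix B assume B: "B \<in> CF F'"
    define A where "A = inv_into C f B"
    have A: "A \<in> C" "f A = B"
      using bij_betw_apply[OF bij_betw_inv_into[OF bij] CF_C[OF B]] f_inv[OF CF_C[OF B]]
      by (simp_all add: A_def)
    have "A \<in> CF F"
    proof (rule commutant_of_separating[OF F subset_refl CF_separates[OF F] A(1)])
      fix D assume D: "D \<in> CF F"
      have "f D \<circ> f A = f A \<circ> f D" using CF_commute[OF F'(1)] F'(2) D B A(2) by blast
      thus "D \<circ> A = A \<circ> D" using comm[OF CF_C[OF D] A(1)] by blast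
    qed
    thus "B \<in> f ` CF F" using A(2) by blast
  qed
  thus ?thesis using F' by blast
qed

lemma level_image_subset:
  assumes F: "frame F" "frame F'" "f ` CF F = CF F'" and p: "p \<in> doubletons F"
  shows "\<exists>q\<in>doubletons F'. f ` level F p \<subseteq> level F' q"
proof -
  have sub: "level F p \<subseteq> CF F" by (auto simp: level_def)
  then obtain B where B: "B \<in> C" "B \<notin> CF F" "\<And>A. A \<in> level F p \<Longrightarrow> A \<circ> B = B \<circ> A"
    using inexact_iff[OF F(1) sub] p by blast
  have "f B \<notin> CF F'"
  proof
    assume "f B \<in> CF F'"
    then obtain D where "D \<in> CF F" "f B = f D" using F(3) by blast
    thus False using f_eq_iff[OF B(1) CF_C] B(2) by blast
  qed
  moreover have "A \<circ> f B = f B \<circ> A" if A: "A \<in> f ` level F p" for A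
  proof -
    obtain D where D: "D \<in> level F p" "A = f D" using A by blast
    hence "D \<in> C" using sub CF_C by blast
    thus ?thesis using comm[OF _ B(1)] B(3)[OF D(1)] D(2) by simp
  qed
  moreover have "f ` level F p \<subseteq> CF F'" using sub F(3) by blast
  ultimately show ?thesis using inexact_iff[OF F(2), of "f ` level F p"] f_C[OF B(1)] by blast
qed

lemma inv_image_CF:
  assumes "f ` CF F = CF F'"
  shows "inv_into C f ` CF F' = CF F"
proof -
  have "inv_into C f (f A) = A" if "A \<in> CF F" for A by (rule inv_f[OF CF_C[OF that]])
  hence "inv_into C f ` f ` CF F = CF F" unfolding image_image by simp
  thus ?thesis by (simp add: assms)
qed

text \<open>\<open>f\<close> sends a level into a level and its inverse sends that one into a level
  again; incomparability forces the round trip to end at \<open>p\<close>.\<close>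

lemma level_image:
  assumes F: "frame F" "frame F'" "f ` CF F = CF F'" and p: "p \<in> doubletons F" and k: "2 \<le> k"
  shows "\<exists>q\<in>doubletons F'. f ` level F p = level F' q"
proof -
  interpret i: commutativity_preserver a k C "inv_into C f" by (rule inverse_preserver)
  obtain q where q: "q \<in> doubletons F'" "f ` level F p \<subseteq> level F' q"
    using level_image_subset[OF F p] by blast
  obtain p' where p': "p' \<in> doubletons F" "inv_into C f ` level F' q \<subseteq> level F p'"
    using i.level_image_subset[OF F(2,1) inv_image_CF[OF F(3)] q(1)] by blast
  have "level F p \<subseteq> level F p'"
  proof
    fix A assume A: "A \<in> level F p"
    hence "A \<in> C" using CF_C by (auto simp: level_def)
    moreover have "inv_into C f (f A) \<in> level F p'" using A q(2) p'(2) by blast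
    ultimately show "A \<in> level F p'" by (simp add: inv_f)
  qed
  hence "p = p'" using level_incomparable[OF F(1) k p p'(1)] by simp
  have "level F' q \<subseteq> f ` level F p"
  proof
    fix B assume B: "B \<in> level F' q"
    hence "B \<in> C" using CF_C by (auto simp: level_def)
    hence "B = f (inv_into C f B)" by (simp add: f_inv)
    moreover have "inv_into C f B \<in> level F p" using B p'(2) \<open>p = p'\<close> by blast
    ultimately show "B \<in> f ` level F p" by blast
  qed
  thus ?thesis using q by blast
qed

text \<open>The bijection \<open>h\<close> of pairs comes from levels and respects triangles, as
  these are expressed by inclusions of levels. Only the partition into colour classes is carried
  over at this stage, not the colours.\<close>

lemma point_map:
  assumes F: "frame F" "frame F'" "f ` CF F = CF F'" and k: "2 \<le> k"
  shows "\<exists>g. bij_betw g F F' \<and> (\<forall>A\<in>CF F. \<forall>i\<in>F. \<forall>j\<in>F. ev A i = ev A j \<longleftrightarrow> ev (f A) (g i) = ev (f A) (g j))"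
proof -
  interpret i: commutativity_preserver a k C "inv_into C f" by (rule inverse_preserver)
  have lC: "level F p \<subseteq> C" for p using CF_C by (auto simp: level_def)
  from level_image[OF F _ k] obtain h
    where h: "\<And>p. p \<in> doubletons F \<Longrightarrow> h p \<in> doubletons F'"
      "\<And>p. p \<in> doubletons F \<Longrightarrow> f ` level F p = level F' (h p)" by metis
  have sub_iff: "f ` X \<subseteq> f ` Y \<longleftrightarrow> X \<subseteq> Y" if "X \<subseteq> C" "Y \<subseteq> C" for X Y
    using inj_on_image_subset_iff[OF f_inj that] .
  have h_inj: "p = q" if pq: "p \<in> doubletons F" "q \<in> doubletons F" "h p = h q" for p q
  proof -
    have "f ` level F p \<subseteq> f ` level F q" using h(2) pq by simp
    hence "level F p \<subseteq> level F q" using sub_iff lC by blast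
    thus ?thesis by (rule level_incomparable[OF F(1) k pq(1,2)])
  qed
  have h_bij: "bij_betw h (doubletons F) (doubletons F')"
  proof (rule bij_betw_imageI)
    show "inj_on h (doubletons F)" using h_inj by (meson inj_onI)
    show "h ` doubletons F = doubletons F'"
    proof
      show "h ` doubletons F \<subseteq> doubletons F'" using h(1) by blast
      show "doubletons F' \<subseteq> h ` doubletons F"
      proof
        fix q assume q: "q \<in> doubletons F'"
        obtain p where p: "p \<in> doubletons F" "inv_into C f ` level F' q = level F p"
          using i.level_image[OF F(2,1) inv_image_CF[OF F(3)] q k] by blast
        have lC': "level F' q \<subseteq> C" using CF_C by (auto simp: level_def)
        have "level F' q = f ` inv_into C f ` level F' q"
          unfolding image_image using f_inv lC' by (force simp: subset_iff)
        also have "\<dots> = level F' (h p)" using h(2)[OF p(1)] p(2) by simp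
        finally have "q = h p" using level_incomparable[OF F(2) k q h(1)[OF p(1)]] by simp
        thus "q \<in> h ` doubletons F" using p(1) by blast
      qed
    qed
  qed
  have tri: "triangle p q r \<longleftrightarrow> triangle (h p) (h q) (h r)"
    if pqr: "p \<in> doubletons F" "q \<in> doubletons F" "r \<in> doubletons F" for p q r
  proof -
    have "level F p \<inter> level F q \<subseteq> level F r \<longleftrightarrow> f ` (level F p \<inter> level F q) \<subseteq> f ` level F r"
      using sub_iff[of "level F p \<inter> level F q" "level F r"] lC by blast
    also have "f ` (level F p \<inter> level F q) = f ` level F p \<inter> f ` level F q"
      by (rule inj_on_image_Int[OF f_inj lC lC])
    finally have "level F p \<inter> level F q \<subseteq> level F r \<longleftrightarrow>
        level F' (h p) \<inter> level F' (h q) \<subseteq> level F' (h r)" using h(2) pqr by simp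
    moreover have "p = q \<longleftrightarrow> h p = h q" "r = p \<longleftrightarrow> h r = h p" "r = q \<longleftrightarrow> h r = h q"
      using h_inj pqr by blast+
    ultimately show ?thesis
      unfolding triangle_iff_level[OF F(1) k pqr]
        triangle_iff_level[OF F(2) k h(1)[OF pqr(1)] h(1)[OF pqr(2)] h(1)[OF pqr(3)]] by blast
  qed
  have "infinite F \<or> 4 \<le> card F" using frame_large[OF F(1)] k by fastforce
  from point_map_of_pair_map[OF h_bij tri this] obtain g
    where g: "bij_betw g F F'" "\<And>i j. i \<in> F \<Longrightarrow> j \<in> F \<Longrightarrow> i \<noteq> j \<Longrightarrow> h {i, j} = {g i, g j}" by blast
  have "ev A i = ev A j \<longleftrightarrow> ev (f A) (g i) = ev (f A) (g j)"
    if A: "A \<in> CF F" and ij: "i \<in> F" "j \<in> F" for A i j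
  proof (cases "i = j")
    case False
    have "A \<in> level F {i, j} \<longleftrightarrow> f A \<in> f ` level F {i, j}"
      using inj_on_image_mem_iff[OF f_inj CF_C[OF A] lC] by simp
    also have "f ` level F {i, j} = level F' {g i, g j}"
      using h(2)[OF doubletonsI[OF ij False]] g(2)[OF ij False] by simp
    finally show ?thesis using A F(3) by (auto simp: level_pair)
  qed simp
  with g(1) show ?thesis by blast
qed

section \<open>Recovering the colours from the sizes of their classes\<close>

definition frame_map :: "'a set \<Rightarrow> 'a set \<Rightarrow> ('a \<Rightarrow> 'a) \<Rightarrow> bool" where
  "frame_map F F' g \<longleftrightarrow> frame F \<and> frame F' \<and> bij_betw g F F' \<and>
    (\<forall>v. placement k v F \<longrightarrow> f (T v) = T (g \<circ> v))"

text \<open>At least \<open>4 * k - k\<close> points carry the colour 0, so this class cannot be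
  mistaken for a nonzero one, which has at most \<open>k\<close> points.\<close>

lemma zero_class_large:
  assumes F: "frame F" and A: "A \<in> CF F" and "finite {e \<in> F. ev A e = 0}"
  shows "k < card {e \<in> F. ev A e = 0}"
proof -
  obtain v where v: "placement k v F" "A = T v" using CF_placement[OF F A] .
  have eq: "{e \<in> F. ev A e = 0} = F - v ` {..<k}" using ev_T_zero_class[OF F v(1)] v(2) by simp
  have card: "card (v ` {..<k}) = k" using v(1) by (simp add: placement_def card_image)
  have "finite F" using assms(3) unfolding eq by simp
  moreover have "card F - card (v ` {..<k}) \<le> card (F - v ` {..<k})"
    by (rule diff_card_le_card_Diff) simp
  ultimately show ?thesis using frame_large[OF F] k_pos unfolding eq card by linarith
qed

lemma nonzero_class:
  assumes F: "frame F" and A: "A \<in> CF F" and e: "e \<in> F" "ev A e \<noteq> 0"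
  shows "finite {e' \<in> F. ev A e' = ev A e}"
    and "card {e' \<in> F. ev A e' = ev A e} = card {l. l < k \<and> a l = ev A e}"
    and "card {e' \<in> F. ev A e' = ev A e} \<le> k"
    and "\<exists>i<k. a i = ev A e"
proof -
  obtain v where v: "placement k v F" "A = T v" using CF_placement[OF F A] .
  have eq: "{e' \<in> F. ev A e' = ev A e} = v ` {l. l < k \<and> a l = ev A e}"
    using ev_T_class[OF F v(1) e(2)] by (simp add: v(2))
  have sub: "{l. l < k \<and> a l = ev A e} \<subseteq> {..<k}" by blast
  show "finite {e' \<in> F. ev A e' = ev A e}" unfolding eq using finite_subset[OF sub] by simp
  show card: "card {e' \<in> F. ev A e' = ev A e} = card {l. l < k \<and> a l = ev A e}"
    unfolding eq using v(1) inj_on_subset[OF _ sub] by (auto simp: placement_def intro!: card_image)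
  show "card {e' \<in> F. ev A e' = ev A e} \<le> k" unfolding card using card_mono[OF _ sub] by simp
  have "e \<in> v ` {l. l < k \<and> a l = ev A e}" unfolding eq[symmetric] using e(1) by simp
  thus "\<exists>i<k. a i = ev A e" by auto
qed

text \<open>\<open>g\<close> carries the class of \<open>e\<close> for \<open>A\<close> onto that of
  \<open>g e\<close> for \<open>f A\<close>, so their sizes agree. Size separates zero from nonzero
  colours and, by \<open>multiplicities\<close>, the nonzero colours from each other.\<close>

lemma frame_map_of_point_map:
  assumes F: "frame F" "frame F'" "f ` CF F = CF F'" and g: "bij_betw g F F'"
    and classes: "\<And>A i j. A \<in> CF F \<Longrightarrow> i \<in> F \<Longrightarrow> j \<in> F \<Longrightarrow>
      ev A i = ev A j \<longleftrightarrow> ev (f A) (g i) = ev (f A) (g j)"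
  shows "frame_map F F' g"
  unfolding frame_map_def
proof (intro conjI allI impI F g)
  fix v assume v: "placement k v F"
  define A where "A = T v"
  have A: "A \<in> CF F" unfolding A_def by (rule T_in_CF[OF F(1) v])
  have fA: "f A \<in> CF F'" using F(3) A by blast
  have gv: "placement k (g \<circ> v) F'"
    using v g by (auto simp: placement_def bij_betw_def intro!: comp_inj_on intro: inj_on_subset)
  have same: "ev (f A) (g e) = ev A e" if e: "e \<in> F" for e
  proof -
    let ?K = "{e' \<in> F. ev A e' = ev A e}" and ?K' = "{e' \<in> F'. ev (f A) e' = ev (f A) (g e)}"
    have ge: "g e \<in> F'" using g e by (rule bij_betw_apply)
    have "g ` ?K = ?K'"
      using classes[OF A _ e] g by (auto simp: bij_betw_def)
    hence bK: "bij_betw g ?K ?K'"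
      using g by (auto simp: bij_betw_def intro: inj_on_subset)
    note card = bij_betw_same_card[OF bK] and fin = bij_betw_finite[OF bK]
    show ?thesis
    proof (cases "ev A e = 0")
      case True
      show ?thesis
      proof (rule ccontr)
        assume "\<not> ?thesis"
        hence nz: "ev (f A) (g e) \<noteq> 0" using True by simp
        note K' = nonzero_class[OF F(2) fA ge nz]
        have "finite {e' \<in> F. ev A e' = 0}" using fin K'(1) True by simp
        from zero_class_large[OF F(1) A this] show False using K'(3) card True by simp
      qed
    next
      case False
      note K = nonzero_class[OF F(1) A e False]
      have nz: "ev (f A) (g e) \<noteq> 0"
      proof
        assume z: "ev (f A) (g e) = 0"
        have "finite {e' \<in> F'. ev (f A) e' = 0}" using fin K(1) z by simp
        from zero_class_large[OF F(2) fA this] show False using K(3) card z by simp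
      qed
      note K' = nonzero_class[OF F(2) fA ge nz]
      obtain i j where "i < k" "a i = ev A e" "j < k" "a j = ev (f A) (g e)"
        using K(4) K'(4) by blast
      moreover have "card {l. l < k \<and> a l = ev A e} = card {l. l < k \<and> a l = ev (f A) (g e)}"
        using card K(2) K'(2) by simp
      ultimately have "ev A e = ev (f A) (g e)" using multiplicities[of i j] by auto
      thus ?thesis by simp
    qed
  qed
  have "f A = T (g \<circ> v)"
  proof (rule CF_eqI[OF F(2) fA T_in_CF[OF F(2) gv]])
    fix e' assume "e' \<in> F'"
    then obtain e where e: "e \<in> F" "e' = g e" using g by (auto simp: bij_betw_def)
    have "ev (T (g \<circ> v)) (g e) = ev A e"
    proof (cases "e \<in> v ` {..<k}")
      case True
      then obtain j where "j < k" "e = v j" by blast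
      thus ?thesis using ev_T_index[OF F(2) gv] ev_T_index[OF F(1) v] by (simp add: A_def)
    next
      case False
      have "g e \<notin> (g \<circ> v) ` {..<k}"
      proof
        assume "g e \<in> (g \<circ> v) ` {..<k}"
        then obtain j where j: "j < k" "g e = g (v j)" by auto
        have "v j \<in> F" using v j(1) by (auto simp: placement_def)
        hence "e = v j" using inj_onD[OF bij_betw_imp_inj_on[OF g] j(2) e(1)] by blast
        thus False using False j(1) by blast
      qed
      moreover have "g e \<in> F'" using g e(1) by (rule bij_betw_apply)
      ultimately show ?thesis
        using ev_T_outside[OF F(2) gv] ev_T_outside[OF F(1) v e(1) False] by (simp add: A_def)
    qed
    thus "ev (f A) e' = ev (T (g \<circ> v)) e'" using same[OF e(1)] e(2) by simp
  qed
  thus "f (T v) = T (g \<circ> v)" by (simp add: A_def)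
qed

text \<open>With a single index no two points share a nonzero colour, so levels do not detect
  triangles. Instead \<open>T v\<close> depends on \<open>v 0\<close> alone, and \<open>CF F\<close>
  is itself indexed by \<open>F\<close>.\<close>

lemma frame_map_rank_one:
  assumes F: "frame F" "frame F'" "f ` CF F = CF F'" and k: "k = 1"
  shows "\<exists>g. frame_map F F' g"
proof -
  have const: "T v = T (\<lambda>_. v 0)" for v by (rule diag_op_cong) (simp add: k)
  have pl: "placement k (\<lambda>_. e) X" if "e \<in> X" for e and X :: "'a set"
    using that by (auto simp: placement_def k inj_on_def image_subset_iff)
  have T_inj: "e = e'" if X: "frame X" and e: "e \<in> X" "e' \<in> X" and eq: "T (\<lambda>_. e) = T (\<lambda>_. e')"
    for X :: "'a set" and e e'
  proof (rule ccontr)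
    assume "e \<noteq> e'"
    hence "ev (T (\<lambda>_. e')) e = 0" by (intro ev_T_outside[OF X pl[OF e(2)] e(1)]) auto
    thus False using ev_T_index[OF X pl[OF e(1)] k_pos] eq nonzero[OF k_pos] by simp
  qed
  have CF1: "\<exists>e\<in>X. A = T (\<lambda>_. e)" if X: "frame X" "A \<in> CF X" for A X
  proof -
    obtain v where v: "placement k v X" "A = T v" using CF_placement[OF X] .
    hence "v 0 \<in> X" using k_pos by (auto simp: placement_def)
    thus ?thesis using v(2) const by blast
  qed
  have "\<exists>e'\<in>F'. f (T (\<lambda>_. e)) = T (\<lambda>_. e')" if "e \<in> F" for e
  proof (rule CF1[OF F(2)])
    show "f (T (\<lambda>_. e)) \<in> CF F'" using T_in_CF[OF F(1) pl[OF that]] F(3) by blast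
  qed
  then obtain g where g: "\<And>e. e \<in> F \<Longrightarrow> g e \<in> F'" "\<And>e. e \<in> F \<Longrightarrow> f (T (\<lambda>_. e)) = T (\<lambda>_. g e)"
    by metis
  have TC: "T (\<lambda>_. e) \<in> C" if "e \<in> F" for e by (rule CF_C[OF T_in_CF[OF F(1) pl[OF that]]])
  have "inj_on g F"
  proof (rule inj_onI)
    fix x y assume xy: "x \<in> F" "y \<in> F" "g x = g y"
    hence "f (T (\<lambda>_. x)) = f (T (\<lambda>_. y))" using g(2) by simp
    hence "T (\<lambda>_. x) = T (\<lambda>_. y)" using f_eq_iff[OF TC TC] xy by blast
    thus "x = y" by (rule T_inj[OF F(1) xy(1,2)])
  qed
  moreover have "F' \<subseteq> g ` F"
  proof
    fix e' assume e': "e' \<in> F'"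
    have "T (\<lambda>_. e') \<in> f ` CF F" unfolding F(3) by (rule T_in_CF[OF F(2) pl[OF e']])
    then obtain A where A: "A \<in> CF F" "T (\<lambda>_. e') = f A" by blast
    then obtain e where e: "e \<in> F" "A = T (\<lambda>_. e)" using CF1[OF F(1)] by blast
    have "T (\<lambda>_. e') = T (\<lambda>_. g e)" using A(2) e g(2) by simp
    hence "e' = g e" by (rule T_inj[OF F(2) e' g(1)[OF e(1)]])
    thus "e' \<in> g ` F" using e(1) by blast
  qed
  ultimately have "bij_betw g F F'" using g(1) by (auto simp: bij_betw_def)
  moreover have "f (T v) = T (g \<circ> v)" if "placement k v F" for v
  proof -
    have "v 0 \<in> F" using that k_pos by (auto simp: placement_def)
    hence "f (T v) = T (\<lambda>_. g (v 0))" using g(2) const[of v] by simp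
    thus ?thesis using const[of "g \<circ> v"] by simp
  qed
  ultimately have "frame_map F F' g" using F by (simp add: frame_map_def)
  thus ?thesis by blast
qed

lemma frame_map_exists:
  assumes F: "frame F"
  shows "\<exists>F' g. frame_map F F' g"
proof -
  obtain F' where F': "frame F'" "f ` CF F = CF F'" using frame_image[OF F] by blast
  show ?thesis
  proof (cases "k = 1")
    case True
    thus ?thesis using frame_map_rank_one[OF F F'] by blast
  next
    case False
    hence "2 \<le> k" using k_pos by simp
    then obtain g where g: "bij_betw g F F'"
      "\<forall>A\<in>CF F. \<forall>i\<in>F. \<forall>j\<in>F. ev A i = ev A j \<longleftrightarrow> ev (f A) (g i) = ev (f A) (g j)"
      using point_map[OF F F'] by blast
    from g(2) have "frame_map F F' g" by (intro frame_map_of_point_map[OF F F' g(1)]) blast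
    thus ?thesis by blast
  qed
qed

section \<open>The induced map of lines\<close>

definition meet :: "(nat \<Rightarrow> 'a) \<Rightarrow> (nat \<Rightarrow> 'a) \<Rightarrow> 'a set" where
  "meet v w = range (f (T v)) \<inter> range (f (T w))"

lemma meet_commute: "meet v w = meet w v"
  by (auto simp: meet_def)

text \<open>Inside one frame \<open>f\<close> is transport along the injective map \<open>g\<close>,
  so the supports of the images share exactly the image of the common vector.\<close>

lemma meet_frame_map:
  assumes fm: "frame_map F F' g" and e: "edge k v w" and sub: "v ` {..<k} \<union> w ` {..<k} \<subseteq> F"
  shows "meet v w = cspan {g (v 0)}"
proof -
  have F: "frame F" "frame F'" and g: "bij_betw g F F'" using fm by (auto simp: frame_map_def)
  have pl: "placement k v F" "placement k w F"
    using e sub onseq_inj by (auto simp: placement_def edge_def)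
  have gpl: "placement k (g \<circ> u) F'" if "placement k u F" for u
    using that g by (auto simp: placement_def bij_betw_def intro!: comp_inj_on intro: inj_on_subset)
  have range: "range (f (T u)) = cspan (g ` u ` {..<k})" if "placement k u F" for u
    using fm that range_diag_op[OF placement_onseq[OF frame_orthonormal[OF F(2)] gpl[OF that]], of a] nonzero
    by (simp add: frame_map_def image_comp)
  have "meet v w = cspan (g ` v ` {..<k}) \<inter> cspan (g ` w ` {..<k})"
    unfolding meet_def using range pl by simp
  also have "\<dots> = cspan (g ` v ` {..<k} \<inter> g ` w ` {..<k})"
  proof (rule span_Int_orthonormal)
    have "g ` v ` {..<k} \<union> g ` w ` {..<k} \<subseteq> F'" using sub g by (auto simp: bij_betw_def)
    thus "orthonormal (g ` v ` {..<k} \<union> g ` w ` {..<k})"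
      by (rule orthonormal_subset[OF frame_orthonormal[OF F(2)]])
  qed simp
  also have "g ` v ` {..<k} \<inter> g ` w ` {..<k} = g ` (v ` {..<k} \<inter> w ` {..<k})"
    using sub by (intro inj_on_image_Int[OF bij_betw_imp_inj_on[OF g], symmetric]) auto
  also have "\<dots> = {g (v 0)}" using edge_Int[OF e k_pos] by simp
  finally show ?thesis .
qed

text \<open>Three mutually adjacent sequences lie in one frame, and a single frame map computes both
  intersections.\<close>

lemma meet_triangle:
  assumes e: "edge k u v" "edge k v w" "edge k u w"
  shows "meet u v = meet v w"
proof -
  obtain F where F: "frame F" "u ` {..<k} \<union> v ` {..<k} \<union> w ` {..<k} \<subseteq> F"
    using frame_extends[OF edge_orthonormal3[OF e]] by blast
  obtain F' g where g: "frame_map F F' g" using frame_map_exists[OF F(1)] by blast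
  have "u 0 = v 0" using e(1) by (simp add: edge_def)
  moreover have "meet u v = cspan {g (u 0)}" by (rule meet_frame_map[OF g e(1)]) (use F(2) in blast)
  moreover have "meet v w = cspan {g (v 0)}" by (rule meet_frame_map[OF g e(2)]) (use F(2) in blast)
  ultimately show ?thesis by simp
qed

lemma onseq_perp_exists:
  fixes Z :: "'a set"
  assumes "finite Z" "card Z + n \<le> 4 * k"
  shows "\<exists>t. onseq n t \<and> (\<forall>j<n. \<forall>z\<in>Z. cinner (t j) z = 0)"
  using assms(2)
proof (induction n)
  case 0
  show ?case by (simp add: onseq_def)
next
  case (Suc n)
  then obtain t where t: "onseq n t" "\<forall>j<n. \<forall>z\<in>Z. cinner (t j) z = 0" by auto
  have "card (Z \<union> t ` {..<n}) \<le> card Z + n"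
    using card_Un_le[of Z "t ` {..<n}"] card_image_le[of "{..<n}" t] by simp
  hence "card (Z \<union> t ` {..<n}) < 4 * k" using Suc.prems by simp
  moreover have "finite (Z \<union> t ` {..<n})" using assms(1) by simp
  ultimately obtain x where x: "x \<noteq> 0" "\<forall>s\<in>Z \<union> t ` {..<n}. cinner x s = 0"
    using exists_perp[OF _ dim] by blast
  let ?t = "t(n := unit_vec x)"
  have xt: "cinner x (t j) = 0" "cinner (t j) x = 0" if "j < n" for j
    using x(2) that iffD1[OF cinner_eq_0_commute, of x "t j"] by auto
  have "onseq (Suc n) ?t"
    using t(1) x(1) xt by (auto simp: onseq_def less_Suc_eq cinner_self_eq_1)
  moreover have "\<forall>j<Suc n. \<forall>z\<in>Z. cinner (?t j) z = 0" using t(2) x(2) by (auto simp: less_Suc_eq)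
  ultimately show ?case by blast
qed

text \<open>At most \<open>3 * k\<close> vectors are to be avoided and \<open>k\<close> are to be
  chosen, which the dimension just allows. Index 0 of the new sequence is overwritten by
  \<open>x\<close>, orthogonal to the rest because \<open>x\<close> is among the avoided
  vectors.\<close>

lemma common_edge:
  fixes x :: 'a
  assumes on: "onseq k u" "onseq k v" "onseq k w" and eq: "u 0 = x" "v 0 = x" "w 0 = x"
  shows "\<exists>t. t 0 = x \<and> edge k t u \<and> edge k t v \<and> edge k t w"
proof -
  let ?Z = "u ` {..<k} \<union> v ` {..<k} \<union> w ` {..<k}"
  have "card ?Z \<le> k + k + k"
    by (intro order.trans[OF card_Un_le] add_mono) (metis card_image_le card_lessThan finite_lessThan)+
  then obtain t where t: "onseq k t" "\<And>j z. j < k \<Longrightarrow> z \<in> ?Z \<Longrightarrow> cinner (t j) z = 0"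
    using onseq_perp_exists[of ?Z k] by auto
  let ?t = "t(0 := x)"
  have xx: "cinner x x = 1" using on(1) eq(1) k_pos by (auto simp: onseq_def)
  have xZ: "x \<in> ?Z" using eq(1) k_pos by force
  have tx: "cinner (t j) x = 0" "cinner x (t j) = 0" if "j < k" for j
    using t(2)[OF that xZ] iffD1[OF cinner_eq_0_commute, of "t j" x] by auto
  have ont: "onseq k ?t" using t(1) tx xx by (auto simp: onseq_def)
  have "edge k ?t s" if "s = u \<or> s = v \<or> s = w" for s
  proof -
    have s: "onseq k s" "s 0 = x" "s ` {..<k} \<subseteq> ?Z" using that on eq by auto
    have "cinner x (s j) = (if j = 0 then 1 else 0)" if "j < k" for j
      using onseqD[OF s(1) k_pos that] s(2) by auto
    moreover have "cinner (t i) (s j) = 0" if "i < k" "j < k" for i j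
      using t(2)[OF that(1)] s(3) that(2) by blast
    ultimately show ?thesis using ont s by (auto simp: edge_def)
  qed
  thus ?thesis by (intro exI[of _ ?t]) simp
qed

text \<open>Here \<open>u\<close> and \<open>w\<close> need not be adjacent. A common neighbour
  \<open>t\<close> of all three closes the triangles \<open>u\<close>, \<open>v\<close>,
  \<open>t\<close> and \<open>t\<close>, \<open>v\<close>, \<open>w\<close>.\<close>

lemma meet_path:
  assumes e: "edge k u v" "edge k v w"
  shows "meet u v = meet v w"
proof -
  obtain t where t: "edge k t u" "edge k t v" "edge k t w"
    using common_edge[OF edgeD(1)[OF e(1)] edgeD(1)[OF e(2)] edgeD(2)[OF e(2)]]
      edgeD(3)[OF e(1)] edgeD(3)[OF e(2)] by metis
  have "meet u v = meet v t" using meet_triangle[OF e(1) edge_sym[OF t(2)] edge_sym[OF t(1)]] .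
  also have "\<dots> = meet t v" by (rule meet_commute)
  also have "\<dots> = meet v w" using meet_triangle[OF t(2) e(2) t(3)] .
  finally show ?thesis .
qed

text \<open>Consecutive intersections agree along the chain \<open>v\<close>, \<open>u\<close>,
  \<open>t\<close>, \<open>u'\<close>, \<open>v'\<close>, where \<open>t\<close> is a common
  neighbour of \<open>u\<close> and \<open>u'\<close>.\<close>

lemma meet_const:
  assumes e: "edge k u v" "edge k u' v'" "u 0 = u' 0"
  shows "meet u v = meet u' v'"
proof -
  obtain t where t: "edge k t u" "edge k t u'"
    using common_edge[OF edgeD(1)[OF e(1)] edgeD(1)[OF e(2)] edgeD(1)[OF e(2)]] e(3) by metis
  have "meet v u = meet u t" by (rule meet_path[OF edge_sym[OF e(1)] edge_sym[OF t(1)]])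
  also have "\<dots> = meet t u'" by (rule meet_path[OF edge_sym[OF t(1)] t(2)])
  also have "\<dots> = meet u' v'" by (rule meet_path[OF t(2) e(2)])
  finally show ?thesis by (simp add: meet_commute)
qed

lemma edge_in_frame:
  fixes F :: "'a set"
  assumes F: "frame F" and x: "x \<in> F"
  shows "\<exists>v w. edge k v w \<and> v 0 = x \<and> v ` {..<k} \<union> w ` {..<k} \<subseteq> F"
proof -
  obtain v where v: "placement k v (F - {x})" using frame_choose[OF F, of "{x}" k] k_pos by auto
  have "card (insert x (v ` {..<k})) \<le> Suc k"
    using card_image_le[of "{..<k}" v] by (simp add: card_insert_if)
  then obtain w where w: "placement k w (F - insert x (v ` {..<k}))"
    using frame_choose[OF F, of "insert x (v ` {..<k})" k] k_pos by auto
  let ?v = "v(0 := x)" and ?w = "w(0 := x)"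
  have "placement k ?v F" "placement k ?w F"
    using v w x unfolding placement_def by (auto intro!: inj_on_fun_updI)
  hence on: "onseq k ?v" "onseq k ?w" using placement_onseq[OF frame_orthonormal[OF F]] by blast+
  have "cinner (?v i) (?w j) = (if i = 0 \<and> j = 0 then 1 else 0)" if ij: "i < k" "j < k" for i j
  proof -
    have "?v i \<in> F" "?w j \<in> F" "?v i = ?w j \<longleftrightarrow> i = 0 \<and> j = 0"
      using v w x ij by (auto simp: placement_def)
    thus ?thesis using orthonormalD[OF frame_orthonormal[OF F]] by simp
  qed
  hence "edge k ?v ?w" using on by (simp add: edge_def)
  moreover have "?v ` {..<k} \<union> ?w ` {..<k} \<subseteq> F" using v w x by (auto simp: placement_def)
  ultimately show ?thesis by (intro exI[of _ ?v] exI[of _ ?w]) simp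
qed

text \<open>\<open>meet_const\<close> makes the line canonical, but the unit vector on it is a
  choice; so values are comparable only up to phases.\<close>

definition line_map :: "'a \<Rightarrow> 'a" where
  "line_map x = (SOME y. norm y = 1 \<and> (\<forall>v w. edge k v w \<and> v 0 = x \<longrightarrow> meet v w = cspan {y}))"

lemma frame_of_unit: "norm (x::'a) = 1 \<Longrightarrow> \<exists>F. frame F \<and> x \<in> F"
  using frame_extends[of "{x}"] orthonormal_insert[of "{}" x] by auto

lemma line_map:
  assumes "norm x = 1"
  shows "norm (line_map x) = 1" and "\<And>v w. edge k v w \<Longrightarrow> v 0 = x \<Longrightarrow> meet v w = cspan {line_map x}"
proof -
  obtain F where F: "frame F" "x \<in> F" using frame_of_unit[OF assms] by blast
  obtain F' g where g: "frame_map F F' g" using frame_map_exists[OF F(1)] by blast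
  have "g x \<in> F'" "frame F'" using g F(2) by (auto simp: frame_map_def bij_betw_def)
  hence norm: "norm (g x) = 1" using frame_norm by blast
  obtain v w where vw: "edge k v w" "v 0 = x" "v ` {..<k} \<union> w ` {..<k} \<subseteq> F"
    using edge_in_frame[OF F] by blast
  have "meet v w = cspan {g x}" using meet_frame_map[OF g vw(1,3)] vw(2) by simp
  hence "\<forall>v w. edge k v w \<and> v 0 = x \<longrightarrow> meet v w = cspan {g x}"
    using meet_const[OF _ vw(1)] vw(2) by metis
  with norm have "\<exists>y. norm y = 1 \<and> (\<forall>v w. edge k v w \<and> v 0 = x \<longrightarrow> meet v w = cspan {y})" by blast
  from someI_ex[OF this] show "norm (line_map x) = 1"
    and "\<And>v w. edge k v w \<Longrightarrow> v 0 = x \<Longrightarrow> meet v w = cspan {line_map x}"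
    unfolding line_map_def by blast+
qed

text \<open>This is the gluing: frame maps are found for each frame separately, yet up to phases all
  of them are restrictions of one map of lines.\<close>

lemma frame_map_line_map:
  assumes g: "frame_map F F' g" and x: "x \<in> F"
  shows "\<exists>c. cmod c = 1 \<and> line_map x = c *\<^sub>C g x"
proof -
  have F: "frame F" using g by (simp add: frame_map_def)
  obtain v w where vw: "edge k v w" "v 0 = x" "v ` {..<k} \<union> w ` {..<k} \<subseteq> F"
    using edge_in_frame[OF F x] by blast
  have nx: "norm x = 1" by (rule frame_norm[OF F x])
  have "g x \<in> F'" "frame F'" using g x by (auto simp: frame_map_def bij_betw_def)
  hence norm: "norm (g x) = 1" using frame_norm by blast
  have "cspan {line_map x} = meet v w" using line_map(2)[OF nx vw(1,2)] by simp
  also have "\<dots> = cspan {g x}" using meet_frame_map[OF g vw(1,3)] vw(2) by simp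
  finally show ?thesis using span_singleton_eqD line_map(1)[OF nx] norm by blast
qed

lemma f_line_map:
  assumes v: "onseq k v"
  shows "f (T v) = T (line_map \<circ> v)"
proof -
  obtain F where F: "frame F" "v ` {..<k} \<subseteq> F"
    using frame_extends[of "v ` {..<k}"] v unfolding onseq_iff by blast
  obtain F' g where g: "frame_map F F' g" using frame_map_exists[OF F(1)] by blast
  have pl: "placement k v F" using F(2) onseq_inj[OF v] by (simp add: placement_def)
  have "T (line_map \<circ> v) = T (g \<circ> v)"
  proof (rule diag_op_phases)
    fix j assume "j < k"
    hence "v j \<in> F" using F(2) by blast
    thus "\<exists>c. cmod c = 1 \<and> (line_map \<circ> v) j = c *\<^sub>C (g \<circ> v) j" using frame_map_line_map[OF g] by simp
  qed
  thus ?thesis using g pl by (simp add: frame_map_def)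
qed

lemma line_map_perp:
  assumes "norm x = 1" "norm y = 1" "cinner x y = 0"
  shows "cinner (line_map x) (line_map y) = 0"
proof -
  have "orthonormal {x, y}"
    using assms orthonormal_insert[of "{y}" x] orthonormal_insert[of "{}" y] by simp
  then obtain F where F: "frame F" "x \<in> F" "y \<in> F" using frame_extends by blast
  obtain F' g where g: "frame_map F F' g" using frame_map_exists[OF F(1)] by blast
  have F': "frame F'" "g x \<in> F'" "g y \<in> F'" using g F by (auto simp: frame_map_def bij_betw_def)
  have "x \<noteq> y" using assms by (metis cinner_self_eq_0 norm_zero zero_neq_one)
  hence "g x \<noteq> g y" using g F by (auto simp: frame_map_def bij_betw_def inj_on_def)
  hence "cinner (g x) (g y) = 0" using orthonormalD[OF frame_orthonormal[OF F'(1)] F'(2,3)] by simp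
  thus ?thesis using frame_map_line_map[OF g F(2)] frame_map_line_map[OF g F(3)]
    by (auto simp: cinner_simps)
qed

lemma onseq_line_map:
  assumes "onseq k v"
  shows "onseq k (line_map \<circ> v)"
  unfolding onseq_def
proof (intro allI impI)
  fix i j assume "i < k" "j < k"
  thus "cinner ((line_map \<circ> v) i) ((line_map \<circ> v) j) = (if i = j then 1 else 0)"
    using line_map_perp[of "v i" "v j"] line_map(1)[of "v i"] onseq_norm[OF assms] onseqD[OF assms, of i j]
    by (auto simp: cinner_self_eq_1)
qed

lemma edge_line_map:
  assumes "edge k v w"
  shows "edge k (line_map \<circ> v) (line_map \<circ> w)"
proof -
  have on: "onseq k v" "onseq k w" and eq: "v 0 = w 0"
    and perp: "\<And>i j. i < k \<Longrightarrow> j < k \<Longrightarrow> \<not> (i = 0 \<and> j = 0) \<Longrightarrow> cinner (v i) (w j) = 0"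
    using assms by (auto simp: edge_def)
  have "cinner (line_map (v i)) (line_map (w j)) = (if i = 0 \<and> j = 0 then 1 else 0)"
    if ij: "i < k" "j < k" for i j
  proof (cases "i = 0 \<and> j = 0")
    case True
    thus ?thesis using eq line_map(1)[OF onseq_norm[OF on(2) k_pos]] by (simp add: cinner_self_eq_1)
  next
    case False
    thus ?thesis
      using line_map_perp[OF onseq_norm[OF on(1) ij(1)] onseq_norm[OF on(2) ij(2)] perp[OF ij False]] by auto
  qed
  thus ?thesis using onseq_line_map[OF on(1)] onseq_line_map[OF on(2)] eq by (simp add: edge_def)
qed

text \<open>\<open>line_map\<close> sends an edge to an edge, and the inverse of \<open>f\<close>
  takes the operators of the image back to \<open>T v\<close> and \<open>T w\<close>, whose ranges
  meet in the line of \<open>x\<close>.\<close>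

lemma line_map_inverse:
  assumes "norm x = 1"
  shows "\<exists>c. cmod c = 1 \<and> x = c *\<^sub>C commutativity_preserver.line_map a k (inv_into C f) (line_map x)"
proof -
  interpret i: commutativity_preserver a k C "inv_into C f" by (rule inverse_preserver)
  obtain F where F: "frame F" "x \<in> F" using frame_of_unit[OF assms] by blast
  obtain v w where vw: "edge k v w" "v 0 = x" using edge_in_frame[OF F] by blast
  have on: "onseq k v" "onseq k w" using vw(1) by (auto simp: edge_def)
  have f_back: "inv_into C f (T (line_map \<circ> u)) = T u" if "onseq k u" for u
    using f_line_map[OF that] inv_f[OF T_in_C[OF that]] by simp
  have "cspan {i.line_map (line_map x)} = i.meet (line_map \<circ> v) (line_map \<circ> w)"
    using i.line_map(2)[OF line_map(1)[OF assms] edge_line_map[OF vw(1)]] vw(2) by simp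
  also have "\<dots> = range (T v) \<inter> range (T w)" by (simp add: i.meet_def f_back on)
  also have "\<dots> = cspan (v ` {..<k}) \<inter> cspan (w ` {..<k})"
    using range_diag_op[OF on(1)] range_diag_op[OF on(2)] nonzero by simp
  also have "\<dots> = cspan (v ` {..<k} \<inter> w ` {..<k})"
    by (rule span_Int_orthonormal[OF _ edge_orthonormal[OF vw(1)]]) simp
  also have "\<dots> = cspan {x}" using edge_Int[OF vw(1) k_pos] vw(2) by simp
  finally have "cspan {x} = cspan {i.line_map (line_map x)}" by simp
  thus ?thesis using span_singleton_eqD assms i.line_map(1)[OF line_map(1)[OF assms]] by blast
qed

lemma line_map_surj:
  assumes "norm y = 1"
  shows "\<exists>x c. norm x = 1 \<and> cmod c = 1 \<and> y = c *\<^sub>C line_map x"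
proof -
  interpret i: commutativity_preserver a k C "inv_into C f" by (rule inverse_preserver)
  obtain c where c: "cmod c = 1"
    "y = c *\<^sub>C commutativity_preserver.line_map a k (inv_into C (inv_into C f)) (i.line_map y)"
    using i.line_map_inverse[OF assms] by blast
  have nz: "norm (i.line_map y) = 1" by (rule i.line_map(1)[OF assms])
  interpret j: commutativity_preserver a k C "inv_into C (inv_into C f)" by (rule i.inverse_preserver)
  have "\<exists>d. cmod d = 1 \<and> j.line_map (i.line_map y) = d *\<^sub>C line_map (i.line_map y)"
  proof -
    obtain F where F: "frame F" "i.line_map y \<in> F" using frame_of_unit[OF nz] by blast
    obtain v w where vw: "edge k v w" "v 0 = i.line_map y" using edge_in_frame[OF F] by blast
    \<comment> \<open>The inverse of the inverse agrees with \<open>f\<close> on \<open>C\<close>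
      but need not be the same function, so the two line maps are compared through the lines they
      span.\<close>
    have "inv_into C (inv_into C f) A = f A" if "A \<in> C" for A
      using i.inv_f[OF f_C[OF that]] by (simp add: inv_f that)
    hence "j.meet v w = meet v w"
      using T_in_C vw(1) by (simp add: j.meet_def meet_def edge_def)
    hence "cspan {j.line_map (i.line_map y)} = cspan {line_map (i.line_map y)}"
      using line_map(2)[OF nz vw] j.line_map(2)[OF nz vw] by simp
    thus ?thesis using span_singleton_eqD line_map(1)[OF nz] j.line_map(1)[OF nz] by blast
  qed
  then obtain d where d: "cmod d = 1" "j.line_map (i.line_map y) = d *\<^sub>C line_map (i.line_map y)" by blast
  have "y = (c * d) *\<^sub>C line_map (i.line_map y)" using c(2) d(2) by (simp add: scaleC_scaleC)
  moreover have "cmod (c * d) = 1" using c(1) d(1) by (simp add: norm_mult)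
  ultimately show ?thesis using nz by blast
qed

lemma line_map_perp_iff:
  assumes "norm x = 1" "norm y = 1"
  shows "cinner (line_map x) (line_map y) = 0 \<longleftrightarrow> cinner x y = 0"
proof
  interpret i: commutativity_preserver a k C "inv_into C f" by (rule inverse_preserver)
  assume "cinner (line_map x) (line_map y) = 0"
  hence "cinner (i.line_map (line_map x)) (i.line_map (line_map y)) = 0"
    using i.line_map_perp line_map(1) assms by blast
  moreover obtain c where "x = c *\<^sub>C i.line_map (line_map x)" using line_map_inverse[OF assms(1)] by blast
  moreover obtain d where "y = d *\<^sub>C i.line_map (line_map y)" using line_map_inverse[OF assms(2)] by blast
  ultimately show "cinner x y = 0" by (metis cinner_scaleC_left cinner_scaleC_right mult_zero_right)
qed (rule line_map_perp[OF assms])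

end

section \<open>Line maps preserving orthogonality\<close>

text \<open>Nonnegative reals are squares, so \<open>r\<close> is monotone; and it fixes the
  integers. Squeezing \<open>real n * t\<close> between consecutive integers bounds the error at
  \<open>t\<close> by 1/n for every positive n.\<close>

lemma ring_hom_real_eq:
  fixes r :: "real \<Rightarrow> real"
  assumes add: "\<And>x y. r (x + y) = r x + r y" and mult: "\<And>x y. r (x * y) = r x * r y" and one: "r 1 = 1"
  shows "r t = t"
proof -
  have zero: "r 0 = 0" using add[of 0 0] by simp
  have minus: "r (- x) = - r x" for x using add[of x "- x"] zero by simp
  have nat: "r (real n) = real n" for n by (induction n) (simp_all add: zero add one)
  have int: "r (of_int m) = of_int m" for m
    by (cases m rule: int_cases2) (simp_all add: nat minus)
  have nonneg: "0 \<le> r x" if "0 \<le> x" for x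
    using mult[of "sqrt x" "sqrt x"] that by simp
  have mono: "r x \<le> r y" if "x \<le> y" for x y
    using nonneg[of "y - x"] add[of x "y - x"] that by simp
  have bound: "real n * \<bar>r t - t\<bar> \<le> 1" for n
  proof -
    let ?m = "\<lfloor>real n * t\<rfloor>"
    have "of_int ?m \<le> real n * t" "real n * t \<le> of_int (?m + 1)" by linarith+
    hence "r (of_int ?m) \<le> r (real n * t)" "r (real n * t) \<le> r (of_int (?m + 1))" by (blast intro: mono)+
    hence "of_int ?m \<le> real n * r t" "real n * r t \<le> of_int (?m + 1)" by (simp_all only: int mult nat)
    hence "\<bar>real n * r t - real n * t\<bar> \<le> 1" by linarith
    thus ?thesis by (simp add: right_diff_distrib[symmetric] abs_mult)
  qed
  show ?thesis
  proof (rule ccontr)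
    assume "r t \<noteq> t"
    then obtain n where "1 < real n * \<bar>r t - t\<bar>" using reals_Archimedean3[of "\<bar>r t - t\<bar>"] by auto
    thus False using bound[of n] by simp
  qed
qed

text \<open>Compatibility with \<open>cnj\<close> sends reals to reals, which excludes the wild
  automorphisms of the complex field. Then \<sigma> is the identity on the reals and sends \<i> to a
  square root of -1.\<close>

lemma ring_hom_complex_cases:
  fixes \<sigma> :: "complex \<Rightarrow> complex"
  assumes add: "\<And>x y. \<sigma> (x + y) = \<sigma> x + \<sigma> y" and mult: "\<And>x y. \<sigma> (x * y) = \<sigma> x * \<sigma> y"
    and one: "\<sigma> 1 = 1" and cnj: "\<And>x. \<sigma> (cnj x) = cnj (\<sigma> x)"
  shows "(\<forall>z. \<sigma> z = z) \<or> (\<forall>z. \<sigma> z = cnj z)"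
proof -
  have im: "Im (\<sigma> (complex_of_real t)) = 0" for t
    using cnj[of "complex_of_real t"] by (simp add: complex_eq_iff)
  have "Re (\<sigma> (complex_of_real t)) = t" for t
    by (rule ring_hom_real_eq[where r = "\<lambda>t. Re (\<sigma> (complex_of_real t))"])
      (simp_all add: add mult one im)
  hence real: "\<sigma> (complex_of_real t) = complex_of_real t" for t
    using im by (simp add: complex_eq_iff)
  have "(\<sigma> \<i>)\<^sup>2 = - 1"
    using mult[of \<i> \<i>] real[of "- 1"] by (simp add: power2_eq_square)
  hence "\<sigma> \<i> = \<i> \<or> \<sigma> \<i> = - \<i>" by (metis power2_eq_iff power2_i)
  moreover have "\<sigma> z = complex_of_real (Re z) + \<sigma> \<i> * complex_of_real (Im z)" for z
  proof -
    have "\<sigma> (complex_of_real (Re z) + \<i> * complex_of_real (Im z)) =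
        complex_of_real (Re z) + \<sigma> \<i> * complex_of_real (Im z)" by (simp only: add mult real)
    thus ?thesis by (simp only: complex_eq[symmetric])
  qed
  moreover have "complex_of_real (Re z) + \<i> * complex_of_real (Im z) = z"
    "complex_of_real (Re z) + - \<i> * complex_of_real (Im z) = cnj z" for z
    by (simp_all add: complex_eq_iff)
  ultimately show ?thesis by metis
qed

text \<open>The residual of \<open>z\<close> after projection is orthogonal to \<open>B\<close>,
  hence to \<open>z\<close>, hence to itself. Membership in a span is thus expressed by
  orthogonality, which maps of lines can preserve.\<close>

lemma double_perp:
  fixes B :: "'a::complex_inner set"
  assumes "finite B" "\<And>w. w \<noteq> 0 \<Longrightarrow> (\<And>b. b \<in> B \<Longrightarrow> cinner w b = 0) \<Longrightarrow> cinner w z = 0"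
  shows "z \<in> cspan B"
proof -
  obtain S where S: "finite S" "orthonormal S" "cspan S = cspan B" using gram_schmidt[OF assms(1)] by blast
  define w where "w = z - proj S z"
  have wS: "cinner w s = 0" if "s \<in> S" for s
    unfolding w_def using cinner_proj[OF S(1,2) that] by (simp add: cinner_simps)
  have "cinner w b = 0" if "b \<in> B" for b
    by (rule perp_span[OF _ wS]) (use S(3) that complex_vector.span_base in auto)
  hence "cinner w z = 0" using assms(2)[of w] by (cases "w = 0") auto
  moreover have "cinner w (proj S z) = 0" by (rule perp_span[OF proj_in_span wS])
  ultimately have "cinner w w = 0" by (subst (2) w_def) (simp add: cinner_simps)
  hence "z = proj S z" by (simp add: w_def)
  thus ?thesis using proj_in_span[of S z] S(3) by simp
qed

lemma in_span_pair: "z \<in> cspan {x, y} \<Longrightarrow> \<exists>a b. z = a *\<^sub>C x + b *\<^sub>C (y::'a::complex_vector)"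
  by (auto simp: complex_vector.span_insert complex_vector.span_singleton) (metis diff_eq_eq add.commute)

lemma pair_in_span: "a *\<^sub>C x + b *\<^sub>C y \<in> cspan {x, y::'a::complex_vector}"
  by (intro complex_vector.span_add complex_vector.span_scale complex_vector.span_base) auto

text \<open>Real polarisation from additivity alone, so that it serves the linear and the antilinear
  case alike.\<close>

lemma isometry_cinner:
  fixes V :: "'a::complex_inner \<Rightarrow> 'a"
  assumes add: "\<And>x y. V (x + y) = V x + V y" and norm: "\<And>x. norm (V x) = norm x"
  shows "Re (cinner (V x) (V y)) = Re (cinner x y)"
proof -
  have expand: "complex_of_real ((norm (u + w))\<^sup>2) =
      complex_of_real ((norm u)\<^sup>2 + (norm w)\<^sup>2 + 2 * Re (cinner u w))" for u w :: 'a
  proof -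
    have "cinner u w + cinner w u = complex_of_real (2 * Re (cinner u w))"
      using cinner_commute[of w u] by (simp add: complex_eq_iff)
    moreover have "cinner (u + w) (u + w) = cinner u u + cinner w w + (cinner u w + cinner w u)"
      by (simp add: cinner_add_left cinner_add_right)
    ultimately show ?thesis by (simp only: norm_cinner of_real_add)
  qed
  have *: "2 * Re (cinner u w) = (norm (u + w))\<^sup>2 - (norm u)\<^sup>2 - (norm w)\<^sup>2" for u w :: 'a
    using expand[of u w] unfolding of_real_eq_iff by simp
  show ?thesis using *[of "V x" "V y"] *[of x y] by (simp add: add[symmetric] norm)
qed

text \<open>\<open>G\<close> chooses a vector on the image of each line, so surjectivity is stated
  up to scalars. The condition \<open>room\<close> says that the dimension is at least 3.\<close>

locale line_preserver =
  fixes G :: "'a::complex_inner \<Rightarrow> 'a"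
  assumes nonzero: "\<And>x. x \<noteq> 0 \<Longrightarrow> G x \<noteq> 0"
    and perp_iff: "\<And>x y. x \<noteq> 0 \<Longrightarrow> y \<noteq> 0 \<Longrightarrow> cinner (G x) (G y) = 0 \<longleftrightarrow> cinner x y = 0"
    and surj: "\<And>y. y \<noteq> 0 \<Longrightarrow> \<exists>x c. x \<noteq> 0 \<and> y = c *\<^sub>C G x"
    and room: "\<And>S :: 'a set. finite S \<Longrightarrow> card S < 3 \<Longrightarrow> \<exists>x. x \<noteq> 0 \<and> (\<forall>s\<in>S. cinner x s = 0)"
begin

text \<open>A plane is its double orthogonal complement, and by \<open>surj\<close> every vector
  orthogonal to the images is, up to a scalar, itself an image.\<close>

lemma G_span_pair:
  assumes nz: "x \<noteq> 0" "y \<noteq> 0" "z \<noteq> 0" and z: "z \<in> cspan {x, y}"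
  shows "G z \<in> cspan {G x, G y}"
proof (rule double_perp)
  fix w assume w: "w \<noteq> 0" "\<And>b. b \<in> {G x, G y} \<Longrightarrow> cinner w b = 0"
  obtain w' c where w': "w' \<noteq> 0" "w = c *\<^sub>C G w'" using surj[OF w(1)] by blast
  have "c \<noteq> 0" using w(1) w'(2) by auto
  hence "cinner (G w') (G x) = 0" "cinner (G w') (G y) = 0"
    using w(2)[of "G x"] w(2)[of "G y"] w'(2) by (simp_all add: cinner_simps)
  hence "cinner w' x = 0" "cinner w' y = 0" using perp_iff w'(1) nz by blast+
  hence "cinner w' z = 0" by (intro perp_span[OF z]) auto
  hence "cinner (G w') (G z) = 0" using perp_iff w'(1) nz by blast
  thus "cinner w (G z) = 0" by (simp add: w'(2) cinner_simps)
qed simp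

lemma G_scale:
  assumes "x \<noteq> 0" "c \<noteq> 0"
  shows "\<exists>d. G (c *\<^sub>C x) = d *\<^sub>C G x"
proof -
  have "c *\<^sub>C x \<in> cspan {x, x}" by (intro complex_vector.span_scale complex_vector.span_base) simp
  with G_span_pair[of x x "c *\<^sub>C x"] assms show ?thesis by (auto simp: complex_vector.span_singleton)
qed

section \<open>The affine chart at \<open>e\<close> and the additivity of \<open>U\<close>\<close>

definition e :: 'a where "e = (SOME x. norm x = 1)"

definition e' :: 'a where "e' = unit_vec (G e)"

text \<open>On the orthogonal complement of \<open>e\<close>, the vector \<open>e' + U y\<close> spans the image of the line of
  \<open>e + y\<close>. The fundamental theorem of projective geometry is proved in this affine chart.\<close>

definition U :: "'a \<Rightarrow> 'a" where
  "U y = inverse (cinner (G (e + y)) e') *\<^sub>C G (e + y) - e'"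

abbreviation E :: "'a set" where "E \<equiv> {y. cinner y e = 0}"

lemma e_norm: "norm e = 1"
proof -
  obtain x :: 'a where "x \<noteq> 0" using room[of "{}"] by auto
  hence "norm (unit_vec x) = 1" by simp
  thus ?thesis unfolding e_def by (rule someI)
qed

lemma e_nz: "e \<noteq> 0"
  using e_norm by auto

lemma cinner_e: "cinner e e = 1"
  using e_norm by (simp add: cinner_self_eq_1)

lemma e'_norm: "norm e' = 1"
  by (simp add: e'_def nonzero[OF e_nz])

lemma cinner_e': "cinner e' e' = 1"
  using e'_norm by (simp add: cinner_self_eq_1)

lemma E_swap: "y \<in> E \<Longrightarrow> cinner e y = 0"
  by simp (rule iffD1[OF cinner_eq_0_commute])

lemma E_closed: "x \<in> E \<Longrightarrow> y \<in> E \<Longrightarrow> x + y \<in> E" "x \<in> E \<Longrightarrow> c *\<^sub>C x \<in> E" "0 \<in> E"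
  by (simp_all add: cinner_simps)

lemma e_plus: "y \<in> E \<Longrightarrow> cinner (e + y) e = 1"
  by (simp add: cinner_simps cinner_e)

lemma e_plus_nz: "y \<in> E \<Longrightarrow> e + y \<noteq> 0"
  using e_plus by (metis cinner_zero_left zero_neq_one)

text \<open>As \<open>e + y\<close> is not orthogonal to \<open>e\<close>, its image has a nonzero
  component along \<open>e'\<close>, which the definition of \<open>U\<close> normalises to
  1.\<close>

lemma U_props:
  assumes y: "y \<in> E"
  shows "cinner (U y) e' = 0" and "\<exists>c. c \<noteq> 0 \<and> e' + U y = c *\<^sub>C G (e + y)"
proof -
  have "cinner (G (e + y)) (G e) \<noteq> 0" using perp_iff[OF e_plus_nz[OF y] e_nz] e_plus[OF y] by simp
  hence nz: "cinner (G (e + y)) e' \<noteq> 0" by (simp add: e'_def)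
  thus "cinner (U y) e' = 0" by (simp add: U_def cinner_simps cinner_e')
  show "\<exists>c. c \<noteq> 0 \<and> e' + U y = c *\<^sub>C G (e + y)"
    by (rule exI[of _ "inverse (cinner (G (e + y)) e')"]) (simp add: U_def nz)
qed

lemma U_perp': "y \<in> E \<Longrightarrow> cinner e' (U y) = 0"
  by (rule iffD1[OF cinner_eq_0_commute]) (rule U_props(1))

text \<open>Orthogonality of \<open>e + x\<close> and \<open>e + y\<close> means that the inner product of \<open>x\<close> and \<open>y\<close> is \<open>-1\<close>;
  this makes \<open>U\<close> isometric and the field homomorphism below compatible with conjugation.\<close>

lemma U_minus_one:
  assumes x: "x \<in> E" and y: "y \<in> E"
  shows "cinner (U x) (U y) = - 1 \<longleftrightarrow> cinner x y = - 1"
proof -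
  obtain c where c: "c \<noteq> 0" "e' + U x = c *\<^sub>C G (e + x)" using U_props(2)[OF x] by blast
  obtain d where d: "d \<noteq> 0" "e' + U y = d *\<^sub>C G (e + y)" using U_props(2)[OF y] by blast
  have "cinner (e' + U x) (e' + U y) = 1 + cinner (U x) (U y)"
    using U_props(1)[OF x] U_perp'[OF y] by (simp add: cinner_add_left cinner_add_right cinner_e')
  hence "1 + cinner (U x) (U y) = 0 \<longleftrightarrow> cinner (c *\<^sub>C G (e + x)) (d *\<^sub>C G (e + y)) = 0"
    by (simp only: c d)
  also have "\<dots> \<longleftrightarrow> cinner (e + x) (e + y) = 0"
    using c(1) d(1) perp_iff[OF e_plus_nz[OF x] e_plus_nz[OF y]] by (simp add: cinner_simps)
  also have "cinner (e + x) (e + y) = 1 + cinner x y"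
    using x E_swap[OF y] by (simp add: cinner_add_left cinner_add_right cinner_e)
  finally show ?thesis by (simp add: add_eq_0_iff)
qed

lemma G_e: "\<exists>c. G e = c *\<^sub>C e'"
  unfolding e'_def by (subst unit_vec_scale[of "G e"]) blast

lemma U_0: "U 0 = 0"
proof -
  obtain c where "e' + U 0 = c *\<^sub>C G e" using U_props(2)[OF E_closed(3)] by auto
  moreover obtain d where "G e = d *\<^sub>C e'" using G_e by blast
  ultimately have eq: "e' + U 0 = (c * d) *\<^sub>C e'" by (simp add: scaleC_scaleC)
  hence "cinner (e' + U 0) e' = (c * d) * cinner e' e'" by (simp only: cinner_scaleC_left)
  hence "c * d = 1" using U_props(1)[OF E_closed(3)] by (simp add: cinner_add_left cinner_e')
  thus ?thesis using eq by simp
qed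

text \<open>The line of \<open>y\<close> is the point at infinity on the chart line through
  \<open>e\<close> and \<open>e + y\<close>. Its image lies in the span of \<open>e'\<close> and
  \<open>U y\<close> and, being orthogonal to \<open>e'\<close>, is the line of
  \<open>U y\<close>.\<close>

lemma U_line:
  assumes y: "y \<in> E" "y \<noteq> 0"
  shows "\<exists>c. c \<noteq> 0 \<and> G y = c *\<^sub>C U y"
proof -
  obtain c where c: "c \<noteq> 0" "e' + U y = c *\<^sub>C G (e + y)" using U_props(2)[OF y(1)] by blast
  have "y = (- 1) *\<^sub>C e + 1 *\<^sub>C (e + y)" by simp
  hence "y \<in> cspan {e, e + y}" using pair_in_span[of "- 1" e 1 "e + y"] by simp
  from in_span_pair[OF G_span_pair[OF e_nz e_plus_nz[OF y(1)] y(2) this]]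
  obtain a b where ab: "G y = a *\<^sub>C G e + b *\<^sub>C G (e + y)" by blast
  obtain d where d: "G e = d *\<^sub>C e'" using G_e by blast
  have "G (e + y) = inverse c *\<^sub>C (e' + U y)" using c by (simp add: scaleC_scaleC)
  hence eq: "G y = (a * d + b * inverse c) *\<^sub>C e' + (b * inverse c) *\<^sub>C U y"
    using ab d by (simp add: scaleC_scaleC scaleC_add_right scaleC_add_left)
  have "cinner (G y) (G e) = 0" using perp_iff[OF y(2) e_nz] y(1) by simp
  hence "cinner (G y) e' = 0" by (simp add: e'_def)
  hence "a * d + b * inverse c = 0"
    unfolding eq using U_props(1)[OF y(1)] by (simp add: cinner_add_left cinner_scaleC_left cinner_e')
  hence "G y = (b * inverse c) *\<^sub>C U y" using eq by simp
  thus ?thesis using nonzero[OF y(2)] by (metis complex_vector.scale_zero_left)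
qed

lemma U_nz: "y \<in> E \<Longrightarrow> y \<noteq> 0 \<Longrightarrow> U y \<noteq> 0"
  using U_line[of y] nonzero[of y] by auto

text \<open>The vector \<open>e + (x + y)\<close> lies in the plane of \<open>e + x\<close> and
  \<open>y\<close>; comparing components along \<open>e'\<close> of the images makes the coefficient
  of \<open>U x\<close> equal to 1.\<close>

lemma U_add_multiple:
  assumes x: "x \<in> E" and y: "y \<in> E"
  shows "\<exists>b. U (x + y) = U x + b *\<^sub>C U y"
proof (cases "y = 0")
  case True
  thus ?thesis by (intro exI[of _ 0]) simp
next
  case False
  have xy: "x + y \<in> E" using x y by (rule E_closed)
  obtain c where c: "c \<noteq> 0" "e' + U x = c *\<^sub>C G (e + x)" using U_props(2)[OF x] by blast
  obtain d where d: "d \<noteq> 0" "e' + U (x + y) = d *\<^sub>C G (e + (x + y))" using U_props(2)[OF xy] by blast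
  obtain m where m: "G y = m *\<^sub>C U y" using U_line[OF y False] by blast
  have "e + (x + y) \<in> cspan {e + x, y}"
    using pair_in_span[of 1 "e + x" 1 y] by (simp add: add.assoc)
  from in_span_pair[OF G_span_pair[OF e_plus_nz[OF x] False e_plus_nz[OF xy] this]]
  obtain a b where ab: "G (e + (x + y)) = a *\<^sub>C G (e + x) + b *\<^sub>C G y" by blast
  have "G (e + x) = inverse c *\<^sub>C (e' + U x)" using c by (simp add: scaleC_scaleC)
  hence eq: "e' + U (x + y) = (d * a * inverse c) *\<^sub>C (e' + U x) + (d * b * m) *\<^sub>C U y"
    unfolding d(2) ab by (simp add: m scaleC_scaleC scaleC_add_right mult.assoc)
  hence "cinner (e' + U (x + y)) e' = cinner ((d * a * inverse c) *\<^sub>C (e' + U x) + (d * b * m) *\<^sub>C U y) e'"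
    by simp
  hence "d * a * inverse c = 1"
    using U_props(1)[OF x] U_props(1)[OF y] U_props(1)[OF xy]
    by (simp add: cinner_add_left cinner_scaleC_left cinner_e')
  hence "U (x + y) = U x + (d * b * m) *\<^sub>C U y" using eq by (simp add: add.assoc)
  thus ?thesis by blast
qed

text \<open>Injectivity on directions: the image of a vector orthogonal to \<open>y\<close> is
  orthogonal to \<open>U y\<close>, hence to \<open>U x\<close>, so the vector is orthogonal to
  \<open>x\<close>.\<close>

lemma U_collinear:
  assumes x: "x \<in> E" and y: "y \<in> E" "y \<noteq> 0" and eq: "U x = c *\<^sub>C U y"
  shows "x \<in> cspan {y}"
proof (cases "x = 0")
  case True
  thus ?thesis by (simp add: complex_vector.span_zero)
next
  case False
  obtain a where a: "G x = a *\<^sub>C U x" using U_line[OF x False] by blast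
  obtain b where b: "b \<noteq> 0" "G y = b *\<^sub>C U y" using U_line[OF y] by blast
  show ?thesis
  proof (rule double_perp)
    fix w assume w: "w \<noteq> 0" "\<And>z. z \<in> {y} \<Longrightarrow> cinner w z = 0"
    hence "cinner (G w) (G y) = 0" using perp_iff[OF w(1) y(2)] by simp
    hence "cinner (G w) (U y) = 0" using b by (simp add: cinner_simps)
    hence "cinner (G w) (G x) = 0" by (simp add: a eq cinner_simps)
    thus "cinner w x = 0" using perp_iff[OF w(1) False] by simp
  qed simp
qed

text \<open>The parallelogram argument: \<open>U (x + y)\<close> is \<open>U x\<close> plus a
  multiple of \<open>U y\<close> and also \<open>U y\<close> plus a multiple of \<open>U x\<close>,
  where \<open>U x\<close> is no multiple of \<open>U y\<close> by
  \<open>U_collinear\<close>.\<close>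

lemma U_add_independent:
  assumes x: "x \<in> E" and y: "y \<in> E" "y \<noteq> 0" and ind: "x \<notin> cspan {y}"
  shows "U (x + y) = U x + U y"
proof -
  obtain b where b: "U (x + y) = U x + b *\<^sub>C U y" using U_add_multiple[OF x y(1)] by blast
  obtain c where c: "U (y + x) = U y + c *\<^sub>C U x" using U_add_multiple[OF y(1) x] by blast
  have "U x - c *\<^sub>C U x = U y - b *\<^sub>C U y"
    using b c by (simp add: add.commute algebra_simps)
  hence eq: "(1 - c) *\<^sub>C U x = (1 - b) *\<^sub>C U y" by (simp add: complex_vector.scale_left_diff_distrib)
  have "c = 1"
  proof (rule ccontr)
    assume c1: "c \<noteq> 1"
    have "U x = inverse (1 - c) *\<^sub>C ((1 - c) *\<^sub>C U x)" using c1 by (simp add: scaleC_scaleC)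
    also have "\<dots> = (inverse (1 - c) * (1 - b)) *\<^sub>C U y" unfolding eq by (simp add: scaleC_scaleC)
    finally show False using U_collinear[OF x y] ind by blast
  qed
  thus ?thesis using c by (simp add: add.commute)
qed

lemma perp_not_in_span:
  assumes "x \<noteq> 0" "cinner x z = 0"
  shows "x \<notin> cspan {z}"
proof
  assume "x \<in> cspan {z}"
  hence "cinner x x = 0" by (rule perp_span) (use assms(2) in auto)
  thus False using assms(1) by simp
qed

lemma exists_perp_E:
  obtains z where "z \<in> E" "z \<noteq> 0" "cinner z y = 0" "cinner y z = 0"
proof -
  have "card {e, y} < 3" by (simp add: card_insert_if)
  then obtain z where "z \<noteq> 0" "\<forall>s\<in>{e, y}. cinner z s = 0" using room[of "{e, y}"] by auto
  thus thesis using that[of z] iffD1[OF cinner_eq_0_commute, of z y] by auto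
qed

text \<open>For collinear \<open>x\<close> and \<open>y\<close> the value at
  \<open>x + y + z\<close>, with \<open>z\<close> orthogonal to both, is computed in two ways by the
  independent case. Such a \<open>z\<close> in \<open>E\<close> exists because the dimension is at
  least 3.\<close>

lemma U_add:
  assumes x: "x \<in> E" and y: "y \<in> E"
  shows "U (x + y) = U x + U y"
proof (cases "x = 0 \<or> y = 0")
  case True
  thus ?thesis by (auto simp: U_0)
next
  case False
  hence nz: "x \<noteq> 0" "y \<noteq> 0" by auto
  show ?thesis
  proof (cases "x \<in> cspan {y}")
    case True
    then obtain c where c: "x = c *\<^sub>C y" by (auto simp: complex_vector.span_singleton)
    obtain z where z: "z \<in> E" "z \<noteq> 0" "cinner z y = 0" "cinner y z = 0" by (rule exists_perp_E)
    have yz: "y + z \<in> E" by (rule E_closed(1)[OF y z(1)])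
    have "cinner (y + z) z \<noteq> 0" using z by (simp add: cinner_add_left)
    hence yz0: "y + z \<noteq> 0" by auto
    have "x \<notin> cspan {y + z}"
    proof
      assume "x \<in> cspan {y + z}"
      then obtain d where d: "x = d *\<^sub>C (y + z)" by (auto simp: complex_vector.span_singleton)
      have "cinner x z = 0" using z(4) by (simp add: c cinner_simps)
      hence "d = 0" using z(2,4) by (simp add: d cinner_simps)
      thus False using d nz by simp
    qed
    hence "U (x + (y + z)) = U x + U (y + z)" by (rule U_add_independent[OF x yz yz0])
    also have "U (y + z) = U y + U z"
      by (rule U_add_independent[OF y z(1,2) perp_not_in_span[OF nz(2) z(4)]])
    finally have 1: "U (x + (y + z)) = U x + (U y + U z)" .
    have "U ((x + y) + z) = U (x + y) + U z"
    proof (cases "x + y = 0")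
      case True
      thus ?thesis by (simp add: U_0)
    next
      case False
      have "cinner (x + y) z = 0" using z(4) by (simp add: c cinner_simps)
      from U_add_independent[OF E_closed(1)[OF x y] z(1,2) perp_not_in_span[OF False this]]
      show ?thesis .
    qed
    thus ?thesis using 1 by (simp add: add.assoc[symmetric])
  next
    case False
    thus ?thesis by (rule U_add_independent[OF x y nz(2)])
  qed
qed

section \<open>The homomorphism of scalars\<close>

lemma U_scale_exists:
  assumes x: "x \<in> E"
  shows "\<exists>s. U (c *\<^sub>C x) = s *\<^sub>C U x"
proof (cases "x = 0 \<or> c = 0")
  case True
  thus ?thesis by (intro exI[of _ 0]) (auto simp: U_0)
next
  case False
  hence nz: "x \<noteq> 0" "c \<noteq> 0" by auto
  have cx: "c *\<^sub>C x \<in> E" "c *\<^sub>C x \<noteq> 0" using x nz by (simp_all add: cinner_simps)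
  obtain a where a: "G x = a *\<^sub>C U x" using U_line[OF x nz(1)] by blast
  obtain b where b: "b \<noteq> 0" "G (c *\<^sub>C x) = b *\<^sub>C U (c *\<^sub>C x)" using U_line[OF cx] by blast
  obtain d where d: "G (c *\<^sub>C x) = d *\<^sub>C G x" using G_scale[OF nz] by blast
  have "U (c *\<^sub>C x) = inverse b *\<^sub>C (b *\<^sub>C U (c *\<^sub>C x))" using b(1) by (simp add: scaleC_scaleC)
  also have "\<dots> = inverse b *\<^sub>C (d *\<^sub>C (a *\<^sub>C U x))" by (simp only: b(2)[symmetric] d a)
  finally have "U (c *\<^sub>C x) = (inverse b * d * a) *\<^sub>C U x" by (simp add: scaleC_scaleC mult.assoc)
  thus ?thesis by blast
qed

text \<open>The factor at \<open>x + y\<close> must serve both summands, whose images are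
  independent; so it equals the factors at \<open>x\<close> and at \<open>y\<close>.\<close>

lemma U_scale_unique:
  assumes x: "x \<in> E" "x \<noteq> 0" and y: "y \<in> E" "y \<noteq> 0" and ind: "x \<notin> cspan {y}"
    and s: "U (c *\<^sub>C x) = s *\<^sub>C U x" and t: "U (c *\<^sub>C y) = t *\<^sub>C U y"
  shows "s = t"
proof -
  obtain r where r: "U (c *\<^sub>C (x + y)) = r *\<^sub>C U (x + y)"
    using U_scale_exists[OF E_closed(1)[OF x(1) y(1)]] by blast
  have "U (c *\<^sub>C (x + y)) = U (c *\<^sub>C x) + U (c *\<^sub>C y)"
    unfolding scaleC_add_right by (intro U_add E_closed x y)
  hence "r *\<^sub>C (U x + U y) = s *\<^sub>C U x + t *\<^sub>C U y" using r s t U_add[OF x(1) y(1)] by simp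
  moreover have "(s - r) *\<^sub>C U x - (r - t) *\<^sub>C U y = (s *\<^sub>C U x + t *\<^sub>C U y) - r *\<^sub>C (U x + U y)"
    by (simp add: complex_vector.scale_left_diff_distrib scaleC_add_right)
  ultimately have eq: "(s - r) *\<^sub>C U x = (r - t) *\<^sub>C U y" by simp
  have "s - r = 0"
  proof (rule ccontr)
    assume nz: "s - r \<noteq> 0"
    have "U x = inverse (s - r) *\<^sub>C ((s - r) *\<^sub>C U x)" using nz by (simp add: scaleC_scaleC)
    also have "\<dots> = (inverse (s - r) * (r - t)) *\<^sub>C U y" unfolding eq by (simp add: scaleC_scaleC)
    finally show False using U_collinear[OF x(1) y] ind by blast
  qed
  moreover from this have "r - t = 0" using eq U_nz[OF y] by simp
  ultimately show ?thesis by simp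
qed

definition x0 :: 'a where "x0 = (SOME x. norm x = 1 \<and> x \<in> E)"

definition \<sigma> :: "complex \<Rightarrow> complex" where "\<sigma> c = (SOME s. U (c *\<^sub>C x0) = s *\<^sub>C U x0)"

lemma x0: "norm x0 = 1" "x0 \<in> E"
proof -
  obtain z where z: "z \<in> E" "z \<noteq> 0" by (rule exists_perp_E)
  hence "norm (unit_vec z) = 1 \<and> unit_vec z \<in> E" by simp
  from someI[of "\<lambda>x. norm x = 1 \<and> x \<in> E", OF this] show "norm x0 = 1" "x0 \<in> E"
    unfolding x0_def by blast+
qed

lemma x0_nz: "x0 \<noteq> 0"
  using x0(1) by auto

lemma U_x0_scale: "U (c *\<^sub>C x0) = \<sigma> c *\<^sub>C U x0"
  unfolding \<sigma>_def by (rule someI_ex[OF U_scale_exists[OF x0(2)]])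

lemma U_scale:
  assumes x: "x \<in> E"
  shows "U (c *\<^sub>C x) = \<sigma> c *\<^sub>C U x"
proof (cases "x = 0")
  case True
  thus ?thesis by (simp add: U_0)
next
  case False
  have indep_case: "U (c *\<^sub>C y) = \<sigma> c *\<^sub>C U y" if y: "y \<in> E" "y \<noteq> 0" "y \<notin> cspan {x0}" for y
  proof -
    obtain s where "U (c *\<^sub>C y) = s *\<^sub>C U y" using U_scale_exists[OF y(1)] by blast
    thus ?thesis using U_scale_unique[OF y(1,2) x0(2) x0_nz y(3) _ U_x0_scale] by metis
  qed
  show ?thesis
  proof (cases "x \<in> cspan {x0}")
    case True
    then obtain d where d: "x = d *\<^sub>C x0" by (auto simp: complex_vector.span_singleton)
    \<comment> \<open>A multiple of \<open>x0\<close> is not independent of it, so the comparison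
      passes through an orthogonal \<open>z\<close>.\<close>
    obtain z where z: "z \<in> E" "z \<noteq> 0" "cinner z x0 = 0" "cinner x0 z = 0" by (rule exists_perp_E)
    have "x \<notin> cspan {z}" by (rule perp_not_in_span[OF False]) (simp add: d z(4) cinner_simps)
    moreover have "U (c *\<^sub>C z) = \<sigma> c *\<^sub>C U z"
      by (rule indep_case[OF z(1,2) perp_not_in_span[OF z(2,3)]])
    moreover obtain s where "U (c *\<^sub>C x) = s *\<^sub>C U x" using U_scale_exists[OF x] by blast
    ultimately show ?thesis using U_scale_unique[OF x False z(1,2)] by metis
  qed (rule indep_case[OF x False])
qed

lemma Ux0_nz: "U x0 \<noteq> 0"
  by (rule U_nz[OF x0(2) x0_nz])

lemma \<sigma>_add: "\<sigma> (a + b) = \<sigma> a + \<sigma> b"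
proof -
  have "\<sigma> (a + b) *\<^sub>C U x0 = U (a *\<^sub>C x0 + b *\<^sub>C x0)"
    by (simp add: U_x0_scale[symmetric] scaleC_add_left)
  also have "\<dots> = (\<sigma> a + \<sigma> b) *\<^sub>C U x0"
    by (subst U_add[OF E_closed(2)[OF x0(2)] E_closed(2)[OF x0(2)]]) (simp add: U_x0_scale scaleC_add_left)
  finally show ?thesis using Ux0_nz by simp
qed

lemma \<sigma>_mult: "\<sigma> (a * b) = \<sigma> a * \<sigma> b"
proof -
  have "\<sigma> (a * b) *\<^sub>C U x0 = U (a *\<^sub>C (b *\<^sub>C x0))"
    by (simp add: U_x0_scale[symmetric] scaleC_scaleC)
  also have "\<dots> = (\<sigma> a * \<sigma> b) *\<^sub>C U x0"
    by (subst U_scale[OF E_closed(2)[OF x0(2)]]) (simp add: U_x0_scale scaleC_scaleC)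
  finally show ?thesis using Ux0_nz by simp
qed

lemma \<sigma>_1: "\<sigma> 1 = 1"
proof -
  have "\<sigma> 1 *\<^sub>C U x0 = 1 *\<^sub>C U x0" by (simp add: U_x0_scale[symmetric])
  thus ?thesis using Ux0_nz unfolding complex_vector.scale_cancel_right by simp
qed

lemma \<sigma>_0: "\<sigma> 0 = 0"
  using \<sigma>_add[of 0 0] by simp

lemma \<sigma>_minus: "\<sigma> (- a) = - \<sigma> a"
  using \<sigma>_add[of a "- a"] by (simp add: \<sigma>_0 add_eq_0_iff)

text \<open>The vectors \<open>x\<close> and \<open>- x\<close> have inner product -1, so
  \<open>U_minus_one\<close> determines the norm of \<open>U x\<close>.\<close>

lemma U_unit:
  assumes "x \<in> E" "norm x = 1"
  shows "cinner (U x) (U x) = 1"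
proof -
  have m: "- x \<in> E" using assms(1) by simp
  have "U (- x) = - U x" using U_scale[OF assms(1), of "- 1"] by (simp add: \<sigma>_minus \<sigma>_1)
  moreover have "cinner x (- x) = - 1" using assms(2) by (simp add: cinner_self_eq_1)
  ultimately have "cinner (U x) (- U x) = - 1" using U_minus_one[OF assms(1) m] by simp
  thus ?thesis by simp
qed

lemma \<sigma>_cnj: "\<sigma> (cnj a) = cnj (\<sigma> a)"
proof (cases "a = 0")
  case True
  thus ?thesis by (simp add: \<sigma>_0)
next
  case False
  have inv: "\<sigma> a * \<sigma> (inverse a) = 1" using \<sigma>_mult[of a "inverse a"] False by (simp add: \<sigma>_1)
  \<comment> \<open>The scalars are chosen to make the inner product -1: it is the conjugate of
    \<open>- (a * inverse a)\<close>.\<close>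
  have "cinner (cnj a *\<^sub>C x0) ((- inverse a) *\<^sub>C x0) = - 1"
    using iffD2[OF cinner_self_eq_1 x0(1)] False by (simp add: cinner_scaleC_left cinner_scaleC_right)
  hence "cinner (U (cnj a *\<^sub>C x0)) (U ((- inverse a) *\<^sub>C x0)) = - 1"
    using U_minus_one[OF E_closed(2)[OF x0(2)] E_closed(2)[OF x0(2)]] by blast
  hence "\<sigma> (cnj a) * cnj (\<sigma> (inverse a)) = 1"
    unfolding U_x0_scale using U_unit[OF x0(2,1)]
    by (simp add: cinner_scaleC_left cinner_scaleC_right \<sigma>_minus mult.commute)
  hence "\<sigma> (cnj a) * cnj (\<sigma> a * \<sigma> (inverse a)) = cnj (\<sigma> a)" by (simp add: ac_simps)
  thus ?thesis by (simp add: inv)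
qed

lemma \<sigma>_cases: "(\<forall>c. \<sigma> c = c) \<or> (\<forall>c. \<sigma> c = cnj c)"
  by (rule ring_hom_complex_cases[OF \<sigma>_add \<sigma>_mult \<sigma>_1 \<sigma>_cnj])

lemma \<sigma>_cmod: "cmod (\<sigma> c) = cmod c"
  using \<sigma>_cases by auto

lemma \<sigma>_surj: "\<exists>b. \<sigma> b = c"
  using \<sigma>_cases by (metis complex_cnj_cnj)

lemma U_norm:
  assumes "x \<in> E"
  shows "norm (U x) = norm x"
proof (cases "x = 0")
  case False
  have u: "unit_vec x \<in> E" "norm (unit_vec x) = 1" using assms False by simp_all
  have "U x = \<sigma> (complex_of_real (norm x)) *\<^sub>C U (unit_vec x)"
    using U_scale[OF u(1), of "complex_of_real (norm x)"] by (simp add: unit_vec_scale[symmetric])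
  moreover have "norm (U (unit_vec x)) = 1" using U_unit[OF u] by (simp add: cinner_self_eq_1)
  ultimately show ?thesis by (simp add: norm_scaleC \<sigma>_cmod)
qed (simp add: U_0)

section \<open>Extension of \<open>U\<close> to a semilinear isometry of the whole space\<close>

definition V :: "'a \<Rightarrow> 'a" where
  "V z = \<sigma> (cinner z e) *\<^sub>C e' + U (z - cinner z e *\<^sub>C e)"

lemma rest_E: "z - cinner z e *\<^sub>C e \<in> E"
  by (simp add: cinner_simps cinner_e)

lemma V_add: "V (x + y) = V x + V y"
proof -
  have "x + y - cinner (x + y) e *\<^sub>C e = (x - cinner x e *\<^sub>C e) + (y - cinner y e *\<^sub>C e)"
    by (simp add: cinner_add_left scaleC_add_left)
  thus ?thesis unfolding V_def
    by (simp only: U_add[OF rest_E rest_E] cinner_add_left \<sigma>_add scaleC_add_left) simp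
qed

lemma V_scale: "V (c *\<^sub>C x) = \<sigma> c *\<^sub>C V x"
proof -
  have "c *\<^sub>C x - cinner (c *\<^sub>C x) e *\<^sub>C e = c *\<^sub>C (x - cinner x e *\<^sub>C e)"
    by (simp add: cinner_scaleC_left complex_vector.scale_right_diff_distrib scaleC_scaleC)
  thus ?thesis unfolding V_def
    by (simp only: U_scale[OF rest_E] cinner_scaleC_left \<sigma>_mult)
      (simp add: scaleC_add_right scaleC_scaleC)
qed

lemma pythagoras:
  assumes "norm u = 1" "cinner y u = 0"
  shows "(norm (c *\<^sub>C u + y))\<^sup>2 = (cmod c)\<^sup>2 + (norm (y::'a))\<^sup>2"
proof -
  have uy: "cinner u y = 0" using assms(2) by (rule iffD1[OF cinner_eq_0_commute])
  have uu: "cinner u u = 1" using assms(1) by (simp add: cinner_self_eq_1)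
  have "cinner (c *\<^sub>C u + y) (c *\<^sub>C u + y) = c * cnj c + cinner y y"
    using uy uu assms(2) by (simp add: cinner_add_left cinner_add_right cinner_scaleC_left cinner_scaleC_right)
  hence "complex_of_real ((norm (c *\<^sub>C u + y))\<^sup>2) = complex_of_real ((cmod c)\<^sup>2 + (norm y)\<^sup>2)"
    by (simp only: norm_cinner of_real_add complex_norm_square[of c])
  thus ?thesis by (simp only: of_real_eq_iff)
qed

lemma V_norm: "norm (V x) = norm x"
proof -
  have "(norm (V x))\<^sup>2 = (cmod (cinner x e))\<^sup>2 + (norm (x - cinner x e *\<^sub>C e))\<^sup>2"
    unfolding V_def by (subst pythagoras[OF e'_norm U_props(1)[OF rest_E]])
      (simp only: \<sigma>_cmod U_norm[OF rest_E])
  also have "\<dots> = (norm (cinner x e *\<^sub>C e + (x - cinner x e *\<^sub>C e)))\<^sup>2"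
    by (rule pythagoras[OF e_norm, symmetric]) (use rest_E in simp)
  finally show ?thesis by simp
qed

text \<open>For \<open>x\<close> in \<open>E\<close> this is \<open>U_line\<close>. Otherwise
  \<open>x\<close> is a multiple of some \<open>e + y\<close>, where the construction of
  \<open>U\<close> applies and \<sigma> takes care of the factor.\<close>

lemma V_line:
  assumes "x \<noteq> 0"
  shows "\<exists>c. V x = c *\<^sub>C G x"
proof (cases "cinner x e = 0")
  case True
  hence xE: "x \<in> E" by simp
  obtain c where c: "c \<noteq> 0" "G x = c *\<^sub>C U x" using U_line[OF xE assms] by blast
  have "V x = inverse c *\<^sub>C G x" using c by (simp add: V_def True \<sigma>_0 scaleC_scaleC)
  thus ?thesis by blast
next
  case False
  define y where "y = inverse (cinner x e) *\<^sub>C (x - cinner x e *\<^sub>C e)"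
  have yE: "y \<in> E" unfolding y_def by (rule E_closed(2)[OF rest_E])
  have y: "cinner x e *\<^sub>C y = x - cinner x e *\<^sub>C e" using False by (simp add: y_def scaleC_scaleC)
  have "e + y = inverse (cinner x e) *\<^sub>C x"
    using False by (simp add: y_def complex_vector.scale_right_diff_distrib scaleC_scaleC)
  then obtain d where d: "G (e + y) = d *\<^sub>C G x" using G_scale[OF assms, of "inverse (cinner x e)"] False by auto
  obtain c where c: "e' + U y = c *\<^sub>C G (e + y)" using U_props(2)[OF yE] by blast
  have "V x = \<sigma> (cinner x e) *\<^sub>C e' + U (cinner x e *\<^sub>C y)" by (simp add: V_def y)
  also have "\<dots> = \<sigma> (cinner x e) *\<^sub>C (e' + U y)" by (simp add: U_scale[OF yE] scaleC_add_right)
  also have "\<dots> = (\<sigma> (cinner x e) * c * d) *\<^sub>C G x" by (simp add: c d scaleC_scaleC mult.assoc)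
  finally show ?thesis by blast
qed

lemma V_bij: "bij V"
proof (rule bijI)
  have diff: "V (x - y) = V x - V y" for x y using V_add[of "x - y" y] by simp
  show "inj V"
  proof (rule injI)
    fix x y assume "V x = V y"
    hence "norm (V (x - y)) = 0" by (simp add: diff)
    thus "x = y" by (simp add: V_norm)
  qed
  show "surj V"
    unfolding surj_def
  proof
    fix y :: 'a
    show "\<exists>x. y = V x"
    proof (cases "y = 0")
      case True
      have "norm (V 0) = 0" by (simp only: V_norm norm_zero)
      thus ?thesis using True by auto
    next
      case False
      obtain x c where x: "x \<noteq> 0" "y = c *\<^sub>C G x" using surj[OF False] by blast
      obtain d where d: "V x = d *\<^sub>C G x" using V_line[OF x(1)] by blast
      have "d \<noteq> 0" using d V_norm[of x] x(1) by auto
      \<comment> \<open>\<open>G\<close> reaches \<open>y\<close> only up to a scalar; surjectivity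
        of \<sigma> allows this scalar to be absorbed into the argument.\<close>
      obtain b where "\<sigma> b = c * inverse d" using \<sigma>_surj by blast
      hence "y = V (b *\<^sub>C x)" using \<open>d \<noteq> 0\<close> by (simp add: V_scale d x(2) scaleC_scaleC)
      thus ?thesis by blast
    qed
  qed
qed

lemma V_unitary_or_antiunitary: "unitary V \<or> antiunitary V"
  using \<sigma>_cases
proof
  note re = isometry_cinner[OF V_add V_norm]
  { assume id: "\<forall>c. \<sigma> c = c"
    \<comment> \<open>The imaginary part is the real part of the inner product with \<i> times the
      second vector.\<close>
    have "Im (cinner (V x) (V y)) = Im (cinner x y)" for x y
      using re[of x "\<i> *\<^sub>C y"] by (simp add: V_scale id cinner_scaleC_right)
    hence "cinner (V x) (V y) = cinner x y" for x y using re by (simp add: complex_eq_iff)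
    thus ?thesis using V_bij V_add V_scale by (simp add: unitary_def clinear_iff id) }
  { assume cnj: "\<forall>c. \<sigma> c = cnj c"
    have "Im (cinner (V x) (V y)) = - Im (cinner x y)" for x y
      using re[of x "\<i> *\<^sub>C y"] by (simp add: V_scale cnj cinner_scaleC_right)
    hence "cinner (V x) (V y) = cnj (cinner x y)" for x y using re by (simp add: complex_eq_iff)
    thus ?thesis using V_bij V_add V_scale by (simp add: antiunitary_def antilinear_def cnj) }
qed

end

section \<open>The theorem\<close>

text \<open>Composition with \<open>unit_vec\<close> extends the map from unit vectors to all
  nonzero vectors. As \<open>k > 0\<close>, the bound \<open>4 * k\<close> exceeds the at most two
  vectors that \<open>room\<close> has to avoid.\<close>

lemma (in commutativity_preserver) line_map_line_preserver:
  "line_preserver (\<lambda>x. line_map (unit_vec x))"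
proof
  fix x y :: 'a
  show "line_map (unit_vec x) \<noteq> 0" if "x \<noteq> 0"
    using line_map(1)[of "unit_vec x"] that by auto
  show "cinner (line_map (unit_vec x)) (line_map (unit_vec y)) = 0 \<longleftrightarrow> cinner x y = 0"
    if "x \<noteq> 0" "y \<noteq> 0" using line_map_perp_iff[of "unit_vec x" "unit_vec y"] that by simp
next
  fix y :: 'a assume y: "y \<noteq> 0"
  then obtain x c where x: "norm x = 1" "unit_vec y = c *\<^sub>C line_map x"
    using line_map_surj[of "unit_vec y"] by auto
  have "y = (complex_of_real (norm y) * c) *\<^sub>C line_map (unit_vec x)"
    using unit_vec_scale[of y] x by (simp add: scaleC_scaleC)
  moreover have "x \<noteq> 0" using x(1) by auto
  ultimately show "\<exists>x c. x \<noteq> 0 \<and> y = c *\<^sub>C line_map (unit_vec x)" by blast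
next
  fix S :: "'a set" assume S: "finite S" "card S < 3"
  show "\<exists>x. x \<noteq> 0 \<and> (\<forall>s\<in>S. cinner x s = 0)"
    by (rule exists_perp[OF S(1) dim]) (use S(2) k_pos in linarith)
qed

text \<open>On unit vectors \<open>l.V\<close> and \<open>line_map\<close> span the same lines and
  have values of norm 1; so they differ by a phase, which \<open>T\<close> ignores.\<close>

lemma (in commutativity_preserver) implemented:
  "\<exists>V. (unitary V \<or> antiunitary V) \<and> (\<forall>A\<in>C. f A = V \<circ> A \<circ> inv V)"
proof -
  interpret l: line_preserver "\<lambda>x. line_map (unit_vec x)" by (rule line_map_line_preserver)
  have conj: "l.V \<circ> T v \<circ> inv l.V = T (l.V \<circ> v)" for v
    using l.V_unitary_or_antiunitary diag_op_unitary diag_op_antiunitary by blast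
  have "f A = l.V \<circ> A \<circ> inv l.V" if A: "A \<in> C" for A
  proof -
    obtain v where v: "onseq k v" "A = T v" using A C_eq by blast
    have "T (l.V \<circ> v) = T (line_map \<circ> v)"
    proof (rule diag_op_phases)
      fix j assume "j < k"
      hence n: "norm (v j) = 1" by (rule onseq_norm[OF v(1)])
      hence "v j \<noteq> 0" by auto
      then obtain c where c: "l.V (v j) = c *\<^sub>C line_map (v j)" using l.V_line[of "v j"] n by auto
      have "cmod c = 1" using l.V_norm[of "v j"] line_map(1)[OF n] n by (simp add: c norm_scaleC)
      thus "\<exists>c. cmod c = 1 \<and> (l.V \<circ> v) j = c *\<^sub>C (line_map \<circ> v) j" using c by auto
    qed
    thus ?thesis using f_line_map[OF v(1)] v(2) conj by simp
  qed
  thus ?thesis using l.V_unitary_or_antiunitary by blast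
qed

theorem theorem1:
  fixes C :: "('a::chilbert_space \<Rightarrow> 'a) set"
    and f :: "('a \<Rightarrow> 'a) \<Rightarrow> ('a \<Rightarrow> 'a)"
    and k :: nat
  assumes "conjugacy_class C"
    and "\<And>A. A \<in> C \<Longrightarrow> rank_op A = enat k"
    and "\<And>A M N. A \<in> C \<Longrightarrow> maximal_eigenspace A M \<Longrightarrow> maximal_eigenspace A N \<Longrightarrow>
           M \<noteq> N \<Longrightarrow> ecdim M \<noteq> ecdim N"
    and "ecdim (UNIV :: 'a set) \<ge> enat (4 * k)"
    and "bij_betw f C C"
    and "\<And>A B. A \<in> C \<Longrightarrow> B \<in> C \<Longrightarrow> A \<circ> B = B \<circ> A \<longleftrightarrow> f A \<circ> f B = f B \<circ> f A"
  shows "\<exists>U. (unitary U \<and> (\<forall>A\<in>C. f A = U \<circ> A \<circ> cadjoint U)) \<or>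
             (antiunitary U \<and> (\<forall>A\<in>C. f A = U \<circ> A \<circ> inv U))"
proof -
  obtain A0 where A0: "A0 \<in> self_adjoint_finite_rank" "C = {U \<circ> A0 \<circ> cadjoint U |U. unitary U}"
    using assms(1) by (auto simp: conjugacy_class_def)
  \<comment> \<open>\<open>A0\<close> itself belongs to the class, so the hypotheses on rank and
    eigenspaces apply to it.\<close>
  have "id \<circ> A0 \<circ> cadjoint id = A0" by (simp add: cadjoint_unitary)
  hence A0C: "A0 \<in> C" unfolding A0(2) using unitary_id by (metis (mono_tags, lifting) mem_Collect_eq)
  obtain a v where av: "onseq k v" "\<And>j. j < k \<Longrightarrow> a j \<noteq> 0" "A0 = diag_op a k v"
    using spectral_theorem[OF A0(1) assms(2)[OF A0C]] by metis
  have C_eq: "C = {diag_op a k v |v. onseq k v}"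
    unfolding A0(2) av(3) by (rule conjugacy_class_diag_op[OF av(1)])
  have "\<exists>U. (unitary U \<or> antiunitary U) \<and> (\<forall>A\<in>C. f A = U \<circ> A \<circ> inv U)"
  \<comment> \<open>In rank 0 the class consists of the zero operator; the argument with frames
    needs at least one nonzero colour.\<close>
  proof (cases "k = 0")
    case True
    hence "diag_op a k w = (\<lambda>_. 0)" for w :: "nat \<Rightarrow> 'a" by (simp add: diag_op_def fun_eq_iff)
    hence zero: "A = (\<lambda>_. 0)" if "A \<in> C" for A using that C_eq by auto
    have "f A = id \<circ> A \<circ> inv id" if "A \<in> C" for A
      using zero[OF that] zero[OF bij_betw_apply[OF assms(5) that]] by simp
    thus ?thesis using unitary_id by blast
  next
    case False
    interpret commutativity_preserver a k C f
    proof
      show "card {l. l < k \<and> a l = a i} \<noteq> card {l. l < k \<and> a l = a j}"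
        if "i < k" "j < k" "a i \<noteq> a j" for i j
        using multiplicities_distinct[OF av(1,2) _ that] assms(3)[OF A0C] av(3) by blast
    qed (use False C_eq av(2) assms(4-6) in auto)
    show ?thesis by (rule implemented)
  qed
  then obtain U where "unitary U \<or> antiunitary U" "\<forall>A\<in>C. f A = U \<circ> A \<circ> inv U" by blast
  \<comment> \<open>For unitary \<open>U\<close> the adjoint is the inverse; for antiunitary
    \<open>U\<close> the star stands for the inverse by definition.\<close>
  thus ?thesis by (metis cadjoint_unitary)
qed

end
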